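(* Let $\Omega\subset\mathbb{R}^2$, $k>0$, $f\in\overline{H^1(\Omega)}'$ be as in the context, let $p\in(2,\infty]$, and let $\{q_n\}_{n\in\mathbb{N}}\subset L^p(\Omega;[-1,\infty))$ and $q\in L^p(\Omega;[-1,\infty))$ be such that, as $n\to\infty$, $$q_n\rightharpoonup q \text{ weakly in } L^p(\Omega), \text{ i.e. in } \sigma(L^p(\Omega),(L^p(\Omega))'),\quad\text{if } p\in(2,\infty),$$ or $$q_n\stackrel{*}{\rightharpoonup} q \text{ in the weak-}*\text{ topology } \sigma(L^\infty(\Omega),L^1(\Omega)),\quad\text{if } p=\infty.$$ For $r\in L^p(\Omega;[-1,\infty))$ let $u(r)\in H^1(\Omega)$ denote the unique solution of $$(\mathcal S-k^2\mathcal M_{1+r}-\imath k\mathcal B)u(r)=f\quad\text{in }\overline{H^1(\Omega)}'.$$ Then $u(q_n)\to u(q)$ strongly in $H^1(\Omega)$ as $n\to\infty$.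
   Context: Function spaces are spaces of complex-valued functions unless a range is indicated; $H^s(\Omega)$ are Sobolev spaces, $\imath$ is the imaginary unit, and $\overline{H^1(\Omega)}'$ is the anti-dual of $H^1(\Omega)$ (bounded antilinear functionals), with action denoted $\langle f,\phi\rangle$. $\Omega\subset\mathbb{R}^2$ is a bounded domain that is sufficiently smooth, at least $C^1$, so that the embedding $H^2(\Omega)\hookrightarrow H^1(\Omega)$ is compact. "Sufficiently smooth" includes that the following regularity holds: there is $C>0$ such that for every $k>0$ and $g\in L^2(\Omega)$ the unique weak solution $w\in H^1(\Omega)$ of $(-\Delta-k^2)w=g$ in $\Omega$, $(\partial_n-\imath k)w=0$ on $\partial\Omega$ lies in $H^2(\Omega)$ and satisfies $\|w\|_{H^2(\Omega)}\le C(k+1+\frac1k+\frac1{k^2})\|g\|_{L^2(\Omega)}$. The wavenumber $k>0$ and the source $f\in\overline{H^1(\Omega)}'$ are fixed. The operators $\mathcal S,\mathcal B,\mathcal M_m:H^1(\Omega)\to\overline{H^1(\Omega)}'$ are defined by $\langle\mathcal S y,\phi\rangle=(\nabla y,\nabla\phi)_{L^2(\Omega;\mathbb{C}^2)}$, $\langle\mathcal B y,\phi\rangle=(y,\phi)_{L^2(\partial\Omega)}$ (traces), $\langle\mathcal M_m y,\phi\rangle=(my,\phi)_{L^2(\Omega)}=\int_\Omega m y\overline{\phi}\,dx$. It is known that for every $r\in L^p(\Omega;[-1,\infty))$, $p\in(2,\infty]$, the operator $\mathcal S-k^2\mathcal M_{1+r}-\imath k\mathcal B:H^1(\Omega)\to\overline{H^1(\Omega)}'$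 is bijective with bounded inverse, so $u(r)$ is well defined; the equation is the weak form of $(-\Delta-k^2(1+r))u=f$ in $\Omega$, $(\partial_n-\imath k)u=0$ on $\partial\Omega$. *)

theory Defs
  imports "HOL-Analysis.Analysis"
begin

text \<open>Elements of function spaces are represented by functions on the whole plane; only their
  values on the underlying measure space matter, and functions that agree almost everywhere
  represent the same element.\<close>

section \<open>Lebesgue spaces of complex-valued functions\<close>

definition Lp :: "ereal \<Rightarrow> 'a measure \<Rightarrow> ('a \<Rightarrow> complex) set" where
  "Lp p M = {g \<in> borel_measurable M.
     if p = \<infinity> then \<exists>C. AE x in M. cmod (g x) \<le> C
     else integrable M (\<lambda>x. cmod (g x) powr real_of_ereal p)}"

definition Lp_norm :: "ereal \<Rightarrow> 'a measure \<Rightarrow> ('a \<Rightarrow> complex) \<Rightarrow> real" where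
  "Lp_norm p M g =
     (if p = \<infinity> then Inf {C. 0 \<le> C \<and> (AE x in M. cmod (g x) \<le> C)}
      else (\<integral>x. cmod (g x) powr real_of_ereal p \<partial>M) powr (1 / real_of_ereal p))"

abbreviation L2 :: "'a measure \<Rightarrow> ('a \<Rightarrow> complex) set" where
  "L2 \<equiv> Lp 2"

abbreviation L2_norm :: "'a measure \<Rightarrow> ('a \<Rightarrow> complex) \<Rightarrow> real" where
  "L2_norm \<equiv> Lp_norm 2"

definition L2_inner :: "'a measure \<Rightarrow> ('a \<Rightarrow> complex) \<Rightarrow> ('a \<Rightarrow> complex) \<Rightarrow> complex" where
  "L2_inner M g h = (\<integral>x. g x * cnj (h x) \<partial>M)"

text \<open>Bounded linear functionals on \<open>L\<^sup>p\<close>. They respect almost-everywhere equality because of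
  linearity and the norm bound.\<close>

definition Lp_dual :: "ereal \<Rightarrow> 'a measure \<Rightarrow> (('a \<Rightarrow> complex) \<Rightarrow> complex) set" where
  "Lp_dual p M = {l.
     (\<forall>g\<in>Lp p M. \<forall>h\<in>Lp p M. l (\<lambda>x. g x + h x) = l g + l h) \<and>
     (\<forall>c. \<forall>g\<in>Lp p M. l (\<lambda>x. c * g x) = c * l g) \<and>
     (\<exists>C. \<forall>g\<in>Lp p M. cmod (l g) \<le> C * Lp_norm p M g)}"

definition weakly_converges ::
  "ereal \<Rightarrow> 'a measure \<Rightarrow> (nat \<Rightarrow> 'a \<Rightarrow> complex) \<Rightarrow> ('a \<Rightarrow> complex) \<Rightarrow> bool" where
  "weakly_converges p M g h \<longleftrightarrow>
     (\<forall>n. g n \<in> Lp p M) \<and> h \<in> Lp p M \<and>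
     (\<forall>l\<in>Lp_dual p M. (\<lambda>n. l (g n)) \<longlonglongrightarrow> l h)"

definition weak_star_converges ::
  "'a measure \<Rightarrow> (nat \<Rightarrow> 'a \<Rightarrow> complex) \<Rightarrow> ('a \<Rightarrow> complex) \<Rightarrow> bool" where
  "weak_star_converges M g h \<longleftrightarrow>
     (\<forall>n. g n \<in> Lp \<infinity> M) \<and> h \<in> Lp \<infinity> M \<and>
     (\<forall>w\<in>Lp 1 M. (\<lambda>n. \<integral>x. g n x * w x \<partial>M) \<longlonglongrightarrow> (\<integral>x. h x * w x \<partial>M))"

text \<open>The real-valued class \<open>L\<^sup>p(\<Omega>; [-1,\<infinity>))\<close>.\<close>

definition potentials :: "ereal \<Rightarrow> (real^2) set \<Rightarrow> (real^2 \<Rightarrow> real) set" where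
  "potentials p \<Omega> = {r. (\<lambda>x. complex_of_real (r x)) \<in> Lp p (lebesgue_on \<Omega>) \<and>
     (AE x in lebesgue_on \<Omega>. -1 \<le> r x)}"

section \<open>Sobolev spaces\<close>

definition partial_deriv :: "2 \<Rightarrow> (real^2 \<Rightarrow> complex) \<Rightarrow> real^2 \<Rightarrow> complex" where
  "partial_deriv i \<phi> x = frechet_derivative \<phi> (at x) (axis i 1)"

fun Ck :: "nat \<Rightarrow> (real^2 \<Rightarrow> complex) \<Rightarrow> bool" where
  "Ck 0 \<phi> = continuous_on UNIV \<phi>"
| "Ck (Suc n) \<phi> = ((\<forall>x. \<phi> differentiable (at x)) \<and> (\<forall>i. Ck n (partial_deriv i \<phi>)))"

definition smooth :: "(real^2 \<Rightarrow> complex) \<Rightarrow> bool" where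
  "smooth \<phi> \<longleftrightarrow> (\<forall>n. Ck n \<phi>)"

definition test_functions :: "(real^2) set \<Rightarrow> (real^2 \<Rightarrow> complex) set" where
  "test_functions \<Omega> = {\<phi>. smooth \<phi> \<and> (\<exists>K. compact K \<and> K \<subseteq> \<Omega> \<and> (\<forall>x. x \<notin> K \<longrightarrow> \<phi> x = 0))}"

definition has_weak_partial ::
  "(real^2) set \<Rightarrow> 2 \<Rightarrow> (real^2 \<Rightarrow> complex) \<Rightarrow> (real^2 \<Rightarrow> complex) \<Rightarrow> bool" where
  "has_weak_partial \<Omega> i u v \<longleftrightarrow>
     (\<forall>\<phi>\<in>test_functions \<Omega>.
        (\<integral>x. u x * partial_deriv i \<phi> x \<partial>lebesgue_on \<Omega>) = - (\<integral>x. v x * \<phi> x \<partial>lebesgue_on \<Omega>))"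

definition H1 :: "(real^2) set \<Rightarrow> (real^2 \<Rightarrow> complex) set" where
  "H1 \<Omega> = {u \<in> L2 (lebesgue_on \<Omega>). \<forall>i. \<exists>v\<in>L2 (lebesgue_on \<Omega>). has_weak_partial \<Omega> i u v}"

text \<open>For \<open>u \<in> H1 \<Omega>\<close> the weak derivative below is determined up to almost-everywhere equality.\<close>

definition weak_partial :: "(real^2) set \<Rightarrow> 2 \<Rightarrow> (real^2 \<Rightarrow> complex) \<Rightarrow> real^2 \<Rightarrow> complex" where
  "weak_partial \<Omega> i u = (SOME v. v \<in> L2 (lebesgue_on \<Omega>) \<and> has_weak_partial \<Omega> i u v)"

definition H1_norm :: "(real^2) set \<Rightarrow> (real^2 \<Rightarrow> complex) \<Rightarrow> real" where
  "H1_norm \<Omega> u = sqrt ((L2_norm (lebesgue_on \<Omega>) u)\<^sup>2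
     + (\<Sum>i\<in>UNIV. (L2_norm (lebesgue_on \<Omega>) (weak_partial \<Omega> i u))\<^sup>2))"

definition H2 :: "(real^2) set \<Rightarrow> (real^2 \<Rightarrow> complex) set" where
  "H2 \<Omega> = {u \<in> H1 \<Omega>. \<forall>i. weak_partial \<Omega> i u \<in> H1 \<Omega>}"

definition H2_norm :: "(real^2) set \<Rightarrow> (real^2 \<Rightarrow> complex) \<Rightarrow> real" where
  "H2_norm \<Omega> u = sqrt ((L2_norm (lebesgue_on \<Omega>) u)\<^sup>2
     + (\<Sum>i\<in>UNIV. (L2_norm (lebesgue_on \<Omega>) (weak_partial \<Omega> i u))\<^sup>2)
     + (\<Sum>i\<in>UNIV. \<Sum>j\<in>UNIV.
          (L2_norm (lebesgue_on \<Omega>) (weak_partial \<Omega> j (weak_partial \<Omega> i u)))\<^sup>2))"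

definition H2_compactly_embedded_in_H1 :: "(real^2) set \<Rightarrow> bool" where
  "H2_compactly_embedded_in_H1 \<Omega> \<longleftrightarrow>
     (\<forall>v. (\<forall>n. v n \<in> H2 \<Omega>) \<and> (\<exists>B. \<forall>n. H2_norm \<Omega> (v n) \<le> B) \<longrightarrow>
        (\<exists>w\<in>H1 \<Omega>. \<exists>s. strict_mono (s :: nat \<Rightarrow> nat) \<and>
           (\<lambda>n. H1_norm \<Omega> (\<lambda>x. v (s n) x - w x)) \<longlonglongrightarrow> 0))"

text \<open>The anti-dual of \<open>H1 \<Omega>\<close>. Two functionals are equal in the anti-dual iff they agree on
  \<open>H1 \<Omega>\<close>.\<close>

definition antidual :: "(real^2) set \<Rightarrow> ((real^2 \<Rightarrow> complex) \<Rightarrow> complex) set" where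
  "antidual \<Omega> = {F.
     (\<forall>\<phi>\<in>H1 \<Omega>. \<forall>\<psi>\<in>H1 \<Omega>. F (\<lambda>x. \<phi> x + \<psi> x) = F \<phi> + F \<psi>) \<and>
     (\<forall>c. \<forall>\<phi>\<in>H1 \<Omega>. F (\<lambda>x. c * \<phi> x) = cnj c * F \<phi>) \<and>
     (\<exists>C. \<forall>\<phi>\<in>H1 \<Omega>. cmod (F \<phi>) \<le> C * H1_norm \<Omega> \<phi>)}"

definition antidual_norm :: "(real^2) set \<Rightarrow> ((real^2 \<Rightarrow> complex) \<Rightarrow> complex) \<Rightarrow> real" where
  "antidual_norm \<Omega> F = Inf {C. 0 \<le> C \<and> (\<forall>\<phi>\<in>H1 \<Omega>. cmod (F \<phi>) \<le> C * H1_norm \<Omega> \<phi>)}"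

section \<open>Boundary measure and traces\<close>

text \<open>One-dimensional Hausdorff measure, which is arc length on a \<open>C\<^sup>1\<close> curve.
  Boundedness is required explicitly since \<^const>\<open>diameter\<close> is unspecified on unbounded sets.
  The outer measure is metric, hence (Caratheodory) countably additive on Borel sets, so
  \<^const>\<open>measure_of\<close> does not degenerate to the zero measure.\<close>

definition hausdorff1_premeasure :: "real \<Rightarrow> (real^2) set \<Rightarrow> ennreal" where
  "hausdorff1_premeasure \<delta> A =
     (INF E \<in> {E :: nat \<Rightarrow> (real^2) set. A \<subseteq> (\<Union>i. E i) \<and> (\<forall>i. bounded (E i) \<and> diameter (E i) \<le> \<delta>)}.
        (\<Sum>i. ennreal (diameter (E i))))"

definition hausdorff1_outer :: "(real^2) set \<Rightarrow> ennreal" where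
  "hausdorff1_outer A = (SUP \<delta> \<in> {0<..}. hausdorff1_premeasure \<delta> A)"

definition hausdorff1 :: "(real^2) measure" where
  "hausdorff1 = measure_of UNIV (sets borel) hausdorff1_outer"

definition boundary_measure :: "(real^2) set \<Rightarrow> (real^2) measure" where
  "boundary_measure \<Omega> = restrict_space hausdorff1 (frontier \<Omega>)"

text \<open>The trace is the continuous extension to \<open>H1 \<Omega>\<close> of the restriction map
  \<open>\<phi> \<mapsto> \<phi>|\<^bsub>\<partial>\<Omega>\<^esub>\<close> on functions smooth up to the boundary.\<close>

definition has_trace :: "(real^2) set \<Rightarrow> (real^2 \<Rightarrow> complex) \<Rightarrow> (real^2 \<Rightarrow> complex) \<Rightarrow> bool" where
  "has_trace \<Omega> u g \<longleftrightarrow> g \<in> L2 (boundary_measure \<Omega>) \<and>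
     (\<exists>\<phi> :: nat \<Rightarrow> real^2 \<Rightarrow> complex. (\<forall>j. smooth (\<phi> j)) \<and>
        (\<lambda>j. H1_norm \<Omega> (\<lambda>x. \<phi> j x - u x)) \<longlonglongrightarrow> 0 \<and>
        (\<lambda>j. L2_norm (boundary_measure \<Omega>) (\<lambda>x. \<phi> j x - g x)) \<longlonglongrightarrow> 0)"

definition boundary_trace :: "(real^2) set \<Rightarrow> (real^2 \<Rightarrow> complex) \<Rightarrow> real^2 \<Rightarrow> complex" where
  "boundary_trace \<Omega> u = (SOME g. has_trace \<Omega> u g)"

section \<open>The Helmholtz problem with impedance boundary condition\<close>

definition op_S ::
  "(real^2) set \<Rightarrow> (real^2 \<Rightarrow> complex) \<Rightarrow> (real^2 \<Rightarrow> complex) \<Rightarrow> complex" where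
  "op_S \<Omega> y \<phi> = (\<Sum>i\<in>UNIV. L2_inner (lebesgue_on \<Omega>) (weak_partial \<Omega> i y) (weak_partial \<Omega> i \<phi>))"

definition op_B ::
  "(real^2) set \<Rightarrow> (real^2 \<Rightarrow> complex) \<Rightarrow> (real^2 \<Rightarrow> complex) \<Rightarrow> complex" where
  "op_B \<Omega> y \<phi> = L2_inner (boundary_measure \<Omega>) (boundary_trace \<Omega> y) (boundary_trace \<Omega> \<phi>)"

definition op_M ::
  "(real^2) set \<Rightarrow> (real^2 \<Rightarrow> real) \<Rightarrow> (real^2 \<Rightarrow> complex) \<Rightarrow> (real^2 \<Rightarrow> complex) \<Rightarrow> complex" where
  "op_M \<Omega> m y \<phi> = L2_inner (lebesgue_on \<Omega>) (\<lambda>x. complex_of_real (m x) * y x) \<phi>"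

definition helmholtz_op ::
  "(real^2) set \<Rightarrow> real \<Rightarrow> (real^2 \<Rightarrow> real) \<Rightarrow> (real^2 \<Rightarrow> complex) \<Rightarrow> (real^2 \<Rightarrow> complex) \<Rightarrow> complex"
  where
  "helmholtz_op \<Omega> k r y \<phi> =
     op_S \<Omega> y \<phi> - complex_of_real (k\<^sup>2) * op_M \<Omega> (\<lambda>x. 1 + r x) y \<phi>
       - \<i> * complex_of_real k * op_B \<Omega> y \<phi>"

definition helmholtz_solution ::
  "(real^2) set \<Rightarrow> real \<Rightarrow> (real^2 \<Rightarrow> real) \<Rightarrow> ((real^2 \<Rightarrow> complex) \<Rightarrow> complex)
     \<Rightarrow> (real^2 \<Rightarrow> complex) \<Rightarrow> bool" where
  "helmholtz_solution \<Omega> k r F y \<longleftrightarrow> y \<in> H1 \<Omega> \<and> (\<forall>\<phi>\<in>H1 \<Omega>. helmholtz_op \<Omega> k r y \<phi> = F \<phi>)"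

text \<open>The operator maps \<open>H1 \<Omega>\<close> into the anti-dual, is onto, is injective (modulo
  almost-everywhere equality), and has a bounded inverse.\<close>

definition helmholtz_bijective_bounded_inverse ::
  "(real^2) set \<Rightarrow> real \<Rightarrow> (real^2 \<Rightarrow> real) \<Rightarrow> bool" where
  "helmholtz_bijective_bounded_inverse \<Omega> k r \<longleftrightarrow>
     (\<forall>y\<in>H1 \<Omega>. helmholtz_op \<Omega> k r y \<in> antidual \<Omega>) \<and>
     (\<forall>F\<in>antidual \<Omega>. \<exists>y. helmholtz_solution \<Omega> k r F y) \<and>
     (\<forall>y\<in>H1 \<Omega>. \<forall>z\<in>H1 \<Omega>. (\<forall>\<phi>\<in>H1 \<Omega>. helmholtz_op \<Omega> k r y \<phi> = helmholtz_op \<Omega> k r z \<phi>) \<longrightarrow>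
        (AE x in lebesgue_on \<Omega>. y x = z x)) \<and>
     (\<exists>C. \<forall>y\<in>H1 \<Omega>. H1_norm \<Omega> y \<le> C * antidual_norm \<Omega> (helmholtz_op \<Omega> k r y))"

section \<open>Admissible domains\<close>

text \<open>Near each boundary point, in suitable Cartesian coordinates, the set is the region above
  the graph of a \<open>C\<^sup>1\<close> function.\<close>

definition C1_boundary :: "(real^2) set \<Rightarrow> bool" where
  "C1_boundary \<Omega> \<longleftrightarrow>
     (\<forall>z\<in>frontier \<Omega>. \<exists>\<rho>>0. \<exists>Q :: real^2 \<Rightarrow> real^2. \<exists>\<gamma> :: real \<Rightarrow> real.
        orthogonal_transformation Q \<and> \<gamma> C1_differentiable_on UNIV \<and>
        (\<forall>x\<in>ball z \<rho>. x \<in> \<Omega> \<longleftrightarrow> \<gamma> (Q x $ 1) < Q x $ 2))"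

definition bounded_C1_domain :: "(real^2) set \<Rightarrow> bool" where
  "bounded_C1_domain \<Omega> \<longleftrightarrow>
     open \<Omega> \<and> connected \<Omega> \<and> \<Omega> \<noteq> {} \<and> bounded \<Omega> \<and> C1_boundary \<Omega>"

definition helmholtz_H2_regular :: "(real^2) set \<Rightarrow> bool" where
  "helmholtz_H2_regular \<Omega> \<longleftrightarrow>
     (\<exists>C>0. \<forall>\<kappa>>0. \<forall>g\<in>L2 (lebesgue_on \<Omega>).
        \<exists>w. helmholtz_solution \<Omega> \<kappa> (\<lambda>x. 0) (L2_inner (lebesgue_on \<Omega>) g) w \<and>
          (\<forall>w'. helmholtz_solution \<Omega> \<kappa> (\<lambda>x. 0) (L2_inner (lebesgue_on \<Omega>) g) w' \<longrightarrow>
             (AE x in lebesgue_on \<Omega>. w' x = w x)) \<and>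
          w \<in> H2 \<Omega> \<and>
          H2_norm \<Omega> w \<le> C * (\<kappa> + 1 + 1 / \<kappa> + 1 / \<kappa>\<^sup>2) * L2_norm (lebesgue_on \<Omega>) g)"

definition sufficiently_smooth_domain :: "(real^2) set \<Rightarrow> bool" where
  "sufficiently_smooth_domain \<Omega> \<longleftrightarrow>
     bounded_C1_domain \<Omega> \<and> H2_compactly_embedded_in_H1 \<Omega> \<and> helmholtz_H2_regular \<Omega>"

end

(* Write b_m(y,z) for the integral of m y conj(z). The difference d = u(q_n) - u(q) solves the limit
   equation with right-hand side k^2 (b_{1+q_n} - b_{1+q})(u(q_n), .), so by the bounded inverse for q
   alone it suffices that the forms b_{1+q_n} converge to b_{1+q} uniformly on the unit ball of H1.
   This follows from weak convergence once the unit ball is precompact in L2 and bounded in some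
   L^{2s} with s > p/(p-1), and the q_n are bounded in L^p.

   All three facts follow from the hypotheses, without a Sobolev embedding or trace theorem.
   Since the Helmholtz operators for all admissible potentials map into the anti-dual, so do their
   differences b_m (m >= 0 in L^P, P > 2) and the boundary form (take r = -1). By the theorem of
   Hellinger and Toeplitz on the complete space H1 these forms are bounded. Boundedness of all b_m gives
   the L^{2s} bound by duality, and the L^p bound of the q_n is the same argument. Testing the equation for w with source v against v itself bounds the L2
   norm of v by the H1 norm of w, and v -> w is compact through H2, which gives precompactness in L2. *)

theory Submission imports Defs
begin

section \<open>Positive semidefinite Hermitian forms\<close>

text \<open>The hypotheses bound each section \<open>c y\<close> of a form by a constant that may
  depend on \<open>y\<close>. Uniformity in \<open>y\<close> has to be created, and its source is
  completeness of H1; this is why completeness of L2 and uniqueness and closedness of weak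
  derivatives are derived from the definitions first. Functions are not identified almost
  everywhere, \<open>weak_partial\<close> and \<open>boundary_trace\<close> are choices, and all
  norms are seminorms, so the abstract part treats semidefinite forms on sets of functions.
  Nonintegrable integrands have integral 0, hence even integrability of m |y|^2 must be deduced from
  additivity of the form. Positivity drives both bounds by duality: |y|^2 and 1 + q_n are
  nonnegative, so one weight, summed from rescaled bad members, defeats an unbounded family without
  cancellation. Uniformity on the ball needs slack in the exponent: with P strictly between 2 and p,
  the part of the potential above a level T contributes uniformly little, while below T smallness in
  L2 suffices. No a priori bound on u(q_n) enters. Its norm carries a small factor in the final
  estimate and is absorbed into the left side.\<close>

locale hermitian_form =
  fixes V :: "('a \<Rightarrow> complex) set" and b :: "('a \<Rightarrow> complex) \<Rightarrow> ('a \<Rightarrow> complex) \<Rightarrow> complex"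
  assumes add_closed: "x \<in> V \<Longrightarrow> y \<in> V \<Longrightarrow> (\<lambda>t. x t + y t) \<in> V"
    and scale_closed: "x \<in> V \<Longrightarrow> (\<lambda>t. c * x t) \<in> V"
    and add_left: "x \<in> V \<Longrightarrow> y \<in> V \<Longrightarrow> z \<in> V \<Longrightarrow> b (\<lambda>t. x t + y t) z = b x z + b y z"
    and scale_left: "x \<in> V \<Longrightarrow> z \<in> V \<Longrightarrow> b (\<lambda>t. c * x t) z = c * b x z"
    and hermitian: "x \<in> V \<Longrightarrow> y \<in> V \<Longrightarrow> b x y = cnj (b y x)"
    and nonneg: "x \<in> V \<Longrightarrow> 0 \<le> Re (b x x)"
begin

definition nrm :: "('a \<Rightarrow> complex) \<Rightarrow> real" where "nrm x = sqrt (Re (b x x))"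

lemma nrm_sq: "x \<in> V \<Longrightarrow> (nrm x)\<^sup>2 = Re (b x x)"
  by (simp add: nrm_def nonneg)

lemma nrm_nonneg: "x \<in> V \<Longrightarrow> 0 \<le> nrm x"
  by (simp add: nrm_def nonneg)

lemma diff_closed: "x \<in> V \<Longrightarrow> y \<in> V \<Longrightarrow> (\<lambda>t. x t - y t) \<in> V"
  using add_closed[of x "\<lambda>t. (-1) * y t"] scale_closed[of y "-1"] by simp

lemma diff_left: "x \<in> V \<Longrightarrow> y \<in> V \<Longrightarrow> z \<in> V \<Longrightarrow> b (\<lambda>t. x t - y t) z = b x z - b y z"
  using add_left[of x "\<lambda>t. (-1) * y t" z] scale_closed[of y "-1"] scale_left[of y z "-1"] by simp

lemma add_right: "x \<in> V \<Longrightarrow> y \<in> V \<Longrightarrow> z \<in> V \<Longrightarrow> b z (\<lambda>t. x t + y t) = b z x + b z y"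
  using hermitian[of z "\<lambda>t. x t + y t"] add_left[of x y z] hermitian[of x z] hermitian[of y z]
  by (simp add: add_closed)

lemma scale_right: "x \<in> V \<Longrightarrow> z \<in> V \<Longrightarrow> b z (\<lambda>t. c * x t) = cnj c * b z x"
  using hermitian[of z "\<lambda>t. c * x t"] scale_left[of x z c] hermitian[of x z]
  by (simp add: scale_closed)

lemma diff_right: "x \<in> V \<Longrightarrow> y \<in> V \<Longrightarrow> z \<in> V \<Longrightarrow> b z (\<lambda>t. x t - y t) = b z x - b z y"
  using add_right[of x "\<lambda>t. (-1) * y t" z] scale_closed[of y "-1"] scale_right[of y z "-1"] by simp

text \<open>One expansion serves three purposes: a multiple of \<open>b x y\<close> for
  \<open>c\<close> gives the Cauchy-Schwarz inequality, \<open>c = -1\<close> the triangle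
  inequality, and \<open>c = 1\<close> together with \<open>c = -1\<close> the parallelogram
  law.\<close>

lemma quadratic:
  assumes x: "x \<in> V" and y: "y \<in> V"
  shows "Re (b (\<lambda>t. x t - c * y t) (\<lambda>t. x t - c * y t))
    = Re (b x x) - 2 * Re (cnj c * b x y) + (cmod c)\<^sup>2 * Re (b y y)"
proof -
  have cy: "(\<lambda>t. c * y t) \<in> V" using y by (rule scale_closed)
  have d: "(\<lambda>t. x t - c * y t) \<in> V" using x cy by (rule diff_closed)
  have e: "Re (c * b y x) = Re (cnj c * b x y)"
    using hermitian[OF y x] by simp
  have f: "Re (c * (cnj c * b y y)) = (cmod c)\<^sup>2 * Re (b y y)"
    by (subst mult.assoc[symmetric], subst complex_norm_square[symmetric]) simp
  show ?thesis
    using e f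
    by (simp add: diff_left[OF x cy d] diff_right[OF x cy x] diff_right[OF x cy cy]
        scale_left[OF y x] scale_right[OF y x] scale_left[OF y cy] scale_right[OF y y])
qed

lemma cauchy_schwarz_sq:
  assumes x: "x \<in> V" and y: "y \<in> V"
  shows "(cmod (b x y))\<^sup>2 \<le> Re (b x x) * Re (b y y)"
proof -
  let ?B = "b x y" let ?Y = "Re (b y y)"
  have cB: "Re (cnj ?B * ?B) = (cmod ?B)\<^sup>2"
    by (simp add: cmod_power2) (simp add: power2_eq_square)
  have q: "0 \<le> Re (b x x) - 2 * t * (cmod ?B)\<^sup>2 + t\<^sup>2 * (cmod ?B)\<^sup>2 * ?Y" for t :: real
  proof -
    let ?c = "complex_of_real t * ?B"
    have "0 \<le> Re (b (\<lambda>s. x s - ?c * y s) (\<lambda>s. x s - ?c * y s))"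
      by (intro nonneg diff_closed scale_closed x y)
    also have "\<dots> = Re (b x x) - 2 * Re (cnj ?c * ?B) + (cmod ?c)\<^sup>2 * ?Y"
      by (rule quadratic[OF x y])
    also have "Re (cnj ?c * ?B) = t * Re (cnj ?B * ?B)" by (simp add: algebra_simps)
    also have "(cmod ?c)\<^sup>2 = t\<^sup>2 * (cmod ?B)\<^sup>2" by (simp add: norm_mult power_mult_distrib)
    finally show ?thesis using cB by simp
  qed
  show ?thesis
  proof (cases "?Y = 0")
    case True
    have "(cmod ?B)\<^sup>2 = 0"
    proof (rule ccontr)
      assume "(cmod ?B)\<^sup>2 \<noteq> 0"
      then have "0 < (cmod ?B)\<^sup>2" by simp
      \<comment> \<open>In the degenerate case the polynomial in \<open>t\<close> is affine with
        negative slope; at this \<open>t\<close> its value is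
        \<open>- Re (b x x) - 2\<close>.\<close>
      then show False using q[of "(Re (b x x) + 1) / (cmod ?B)\<^sup>2"] True nonneg[OF x]
        by simp
    qed
    then show ?thesis using True by simp
  next
    case False
    then have Y: "0 < ?Y" using nonneg[OF y] by simp
    \<comment> \<open>Here \<open>t = 1 / ?Y\<close> minimises the polynomial.\<close>
    have "0 \<le> Re (b x x) - (cmod ?B)\<^sup>2 / ?Y"
      using q[of "1 / ?Y"] Y by (simp add: power2_eq_square field_simps)
    then show ?thesis using Y by (simp add: field_simps)
  qed
qed

lemma cauchy_schwarz: "x \<in> V \<Longrightarrow> y \<in> V \<Longrightarrow> cmod (b x y) \<le> nrm x * nrm y"
  using cauchy_schwarz_sq[of x y, THEN real_le_rsqrt] by (simp add: nrm_def real_sqrt_mult)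

lemma nrm_triangle:
  assumes x: "x \<in> V" and y: "y \<in> V"
  shows "nrm (\<lambda>t. x t + y t) \<le> nrm x + nrm y"
proof -
  have s: "(\<lambda>t. x t + y t) \<in> V" using x y by (rule add_closed)
  have "(nrm (\<lambda>t. x t + y t))\<^sup>2 = Re (b x x) + 2 * Re (b x y) + Re (b y y)"
    using quadratic[OF x y, of "-1"] nrm_sq[OF s] by simp
  also have "\<dots> \<le> (nrm x)\<^sup>2 + 2 * (nrm x * nrm y) + (nrm y)\<^sup>2"
    using cauchy_schwarz[OF x y] complex_Re_le_cmod[of "b x y"] by (simp add: nrm_sq x y)
  also have "\<dots> = (nrm x + nrm y)\<^sup>2" by (simp add: power2_eq_square algebra_simps)
  finally show ?thesis using nrm_nonneg x y by (simp add: power2_le_iff_abs_le)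
qed

lemma nrm_scale: "x \<in> V \<Longrightarrow> nrm (\<lambda>t. c * x t) = cmod c * nrm x"
proof -
  assume x: "x \<in> V"
  have "b (\<lambda>t. c * x t) (\<lambda>t. c * x t) = (c * cnj c) * b x x"
    using scale_left[OF x scale_closed[OF x], of c c] scale_right[OF x x, of c] by simp
  then have "Re (b (\<lambda>t. c * x t) (\<lambda>t. c * x t)) = (cmod c)\<^sup>2 * Re (b x x)"
    by (simp add: complex_norm_square[symmetric])
  then show ?thesis by (simp add: nrm_def real_sqrt_mult)
qed

lemma nrm_minus: "x \<in> V \<Longrightarrow> y \<in> V \<Longrightarrow> nrm (\<lambda>t. x t - y t) = nrm (\<lambda>t. y t - x t)"
  using nrm_scale[OF diff_closed[of y x], of "-1"] by simp

lemma nrm_triangle_diff: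
  "x \<in> V \<Longrightarrow> y \<in> V \<Longrightarrow> z \<in> V \<Longrightarrow> nrm (\<lambda>t. x t - z t) \<le> nrm (\<lambda>t. x t - y t) + nrm (\<lambda>t. y t - z t)"
  using nrm_triangle[OF diff_closed diff_closed, of x y y z] by simp

lemma nrm_diff_le: "x \<in> V \<Longrightarrow> y \<in> V \<Longrightarrow> nrm (\<lambda>t. x t - y t) \<le> nrm x + nrm y"
  using nrm_triangle[OF _ scale_closed[of y "-1"], of x] nrm_scale[of y "-1"] by simp

lemma nrm_le_add: "x \<in> V \<Longrightarrow> y \<in> V \<Longrightarrow> nrm x \<le> nrm (\<lambda>t. x t - y t) + nrm y"
  using nrm_triangle[OF diff_closed[of x y], of y] by simp

lemma parallelogram:
  assumes x: "x \<in> V" and y: "y \<in> V"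
  shows "Re (b (\<lambda>t. x t + y t) (\<lambda>t. x t + y t)) + Re (b (\<lambda>t. x t - y t) (\<lambda>t. x t - y t))
    = 2 * Re (b x x) + 2 * Re (b y y)"
  using quadratic[OF x y, of 1] quadratic[OF x y, of "-1"] by simp

end

text \<open>A Hermitian form that is separately bounded with respect to a complete one is bounded
  (Hellinger and Toeplitz). If not, nested balls on which the form is larger and larger exist, and
  the form has no finite value at their common point.\<close>

locale complete_hermitian_form = hermitian_form +
  assumes complete: "\<And>X. (\<And>n. X n \<in> V) \<Longrightarrow> (\<And>n. nrm (\<lambda>t. X (Suc n) t - X n t) \<le> (1/4)^n)
    \<Longrightarrow> \<exists>x\<in>V. (\<lambda>n. nrm (\<lambda>t. X n t - x t)) \<longlonglongrightarrow> 0"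
begin

text \<open>Unboundedness supplies a short vector on which \<open>c\<close> is large. By the
  parallelogram law, adding or subtracting it moves \<open>x\<close> to a point where
  \<open>c\<close> is large too, and boundedness of the single section \<open>c x'\<close> carries a
  lower bound to a whole ball around that point.\<close>

lemma hellinger_toeplitz_step:
  assumes "hermitian_form V c"
    and bdd: "\<And>y. y \<in> V \<Longrightarrow> \<exists>C. \<forall>z\<in>V. cmod (c y z) \<le> C * nrm z"
    and unb: "\<And>C. 0 \<le> C \<Longrightarrow> \<exists>y\<in>V. Re (c y y) > C * (nrm y)\<^sup>2"
    and x: "x \<in> V" and e: "0 < e" and a: "0 < a"
  shows "\<exists>x'\<in>V. \<exists>e'. 0 < e' \<and> e' \<le> e / 8 \<and> nrm (\<lambda>t. x' t - x t) \<le> e / 8 \<and>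
    (\<forall>z\<in>V. nrm (\<lambda>t. z t - x' t) \<le> e' \<longrightarrow> a \<le> Re (c z z))"
proof -
  interpret c: hermitian_form V c by fact
  \<comment> \<open>The passage from \<open>x'\<close> to its neighbours costs a factor 4 in the
    quadratic form, so \<open>M\<^sup>2 = 4 * a\<close> is aimed at.\<close>
  define M where "M = 2 * sqrt a"
  have M: "0 < M" "M\<^sup>2 = 4 * a" using a by (auto simp: M_def power_mult_distrib)
  \<comment> \<open>The constant is such that rescaling \<open>y\<close> to the value
    \<open>M\<^sup>2\<close> of the quadratic form leaves it with norm at most
    \<open>e / 8\<close>.\<close>
  obtain y where y: "y \<in> V" and yc: "Re (c y y) > (8 * M / e)\<^sup>2 * (nrm y)\<^sup>2"
    using unb[of "(8 * M / e)\<^sup>2"] by auto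
  have cy: "0 < Re (c y y)" using yc
    by (smt (verit) mult_nonneg_nonneg zero_le_power2)
  define s where "s = M / sqrt (Re (c y y))"
  have s: "0 < s" using M cy by (simp add: s_def)
  let ?y = "\<lambda>t. complex_of_real s * y t"
  have sy: "?y \<in> V" using y by (rule scale_closed)
  have "(8 * M / e * nrm y)\<^sup>2 \<le> Re (c y y)" using yc by (simp add: power_mult_distrib power_divide)
  then have "8 * M / e * nrm y \<le> sqrt (Re (c y y))" by (rule real_le_rsqrt)
  then have "s * nrm y \<le> e / 8" using M e cy by (simp add: s_def field_simps)
  then have n_sy: "nrm ?y \<le> e / 8" using nrm_scale[OF y, of s] s by simp
  have "(c.nrm ?y)\<^sup>2 = s\<^sup>2 * (c.nrm y)\<^sup>2"
    using c.nrm_scale[OF y, of s] s by (simp add: power_mult_distrib)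
  then have c_sy: "Re (c ?y ?y) = M\<^sup>2"
    using c.nrm_sq[OF y] c.nrm_sq[OF sy] cy by (simp add: s_def power_divide)
  define x1 where "x1 = (\<lambda>t. x t + ?y t)"
  define x2 where "x2 = (\<lambda>t. x t - ?y t)"
  have "\<exists>x'\<in>V. nrm (\<lambda>t. x' t - x t) \<le> e / 8 \<and> M\<^sup>2 \<le> Re (c x' x')"
  proof (cases "M\<^sup>2 \<le> Re (c x1 x1)")
    case True
    then show ?thesis using n_sy add_closed[OF x sy]
      by (intro bexI[of _ x1]) (auto simp: x1_def)
  next
    case False
    have "M\<^sup>2 \<le> Re (c x2 x2)"
      using c.parallelogram[OF x sy] c_sy c.nonneg[OF x] False by (simp add: x1_def x2_def)
    moreover have "nrm (\<lambda>t. x2 t - x t) \<le> e / 8"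
      using n_sy nrm_minus[OF x diff_closed[OF x sy]] by (simp add: x2_def)
    ultimately show ?thesis using diff_closed[OF x sy] by (intro bexI[of _ x2]) (auto simp: x2_def)
  qed
  then obtain x' where x': "x' \<in> V" "nrm (\<lambda>t. x' t - x t) \<le> e / 8" "M\<^sup>2 \<le> Re (c x' x')" by blast
  obtain C where C: "\<And>z. z \<in> V \<Longrightarrow> cmod (c x' z) \<le> C * nrm z" using bdd[OF x'(1)] by blast
  let ?R = "Re (c x' x')"
  have R: "0 < ?R" using x'(3) M(1) by (smt (verit) zero_less_power)
  \<comment> \<open>On a ball of this radius the section \<open>c x'\<close> varies by at most
    \<open>?R / 2\<close>.\<close>
  define e' where "e' = min (e / 8) (?R / (2 * (\<bar>C\<bar> + 1)))"
  have e': "0 < e'" "e' \<le> e / 8" "e' \<le> ?R / (2 * (\<bar>C\<bar> + 1))"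
    unfolding e'_def using e R by (auto intro: min.cobounded1 min.cobounded2 simp del: le_divide_eq_numeral1)
  have "a \<le> Re (c z z)" if z: "z \<in> V" "nrm (\<lambda>t. z t - x' t) \<le> e'" for z
  proof -
    have d: "(\<lambda>t. z t - x' t) \<in> V" using z x' diff_closed by blast
    have "cmod (c x' (\<lambda>t. z t - x' t)) \<le> \<bar>C\<bar> * nrm (\<lambda>t. z t - x' t)"
      using C[OF d] nrm_nonneg[OF d] by (smt (verit) mult_right_mono)
    also have "\<dots> \<le> (\<bar>C\<bar> + 1) * e'" using z(2) nrm_nonneg[OF d] by (intro mult_mono) auto
    also have "\<dots> \<le> ?R / 2" using e'(3) by (simp add: field_simps)
    finally have "cmod (c x' z - c x' x') \<le> ?R / 2" using c.diff_right[OF z(1) x'(1) x'(1)] by simp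
    then have "?R / 2 \<le> cmod (c x' z)"
      using norm_triangle_ineq2[of "c x' x'" "c x' z"] complex_Re_le_cmod[of "c x' x'"]
      by (simp add: norm_minus_commute)
    \<comment> \<open>The diagonal of \<open>c\<close> is not known to be continuous. Cauchy-Schwarz
      for \<open>c\<close> turns the lower bound on \<open>c x' z\<close> into one on
      \<open>c z z\<close>.\<close>
    then have "(?R / 2)\<^sup>2 \<le> ?R * Re (c z z)"
      using c.cauchy_schwarz_sq[OF x'(1) z(1)] R by (smt (verit) power_mono divide_nonneg_pos)
    then have "?R / 4 \<le> Re (c z z)" using R by (simp add: power2_eq_square field_simps)
    then show ?thesis using x'(3) M by simp
  qed
  then show ?thesis using x' e' by blast
qed

theorem hellinger_toeplitz:
  assumes c: "hermitian_form V c"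
    and bdd: "\<And>y. y \<in> V \<Longrightarrow> \<exists>C. \<forall>z\<in>V. cmod (c y z) \<le> C * nrm z"
    and v: "v \<in> V"
  shows "\<exists>C\<ge>0. \<forall>y\<in>V. Re (c y y) \<le> C * (nrm y)\<^sup>2"
proof (rule ccontr)
  assume "\<not> ?thesis"
  then have unb: "\<And>C. 0 \<le> C \<Longrightarrow> \<exists>y\<in>V. Re (c y y) > C * (nrm y)\<^sup>2" by (metis not_le)
  let ?P = "\<lambda>n::nat. \<lambda>(x, e). x \<in> V \<and> 0 < e \<and> e \<le> (1::real)"
  let ?Q = "\<lambda>n. \<lambda>(x, e). \<lambda>(x', e'). e' \<le> e / 8 \<and> nrm (\<lambda>t. x' t - x t) \<le> e / 8 \<and>
    (\<forall>z\<in>V. nrm (\<lambda>t. z t - x' t) \<le> e' \<longrightarrow> real (Suc n) \<le> Re (c z z))"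
  have "\<exists>f. \<forall>n. ?P n (f n) \<and> ?Q n (f n) (f (Suc n))"
  proof (rule dependent_nat_choice[of ?P ?Q])
    show "\<exists>p. ?P 0 p" using v by (intro exI[of _ "(v, 1)"]) auto
    fix p :: "('a \<Rightarrow> complex) \<times> real" and n :: nat
    assume "?P n p"
    then obtain x e where p: "p = (x, e)" "x \<in> V" "0 < e" "e \<le> 1" by (cases p) auto
    obtain x' e' where x': "x' \<in> V" "0 < e'" "e' \<le> e / 8" "nrm (\<lambda>t. x' t - x t) \<le> e / 8"
      "\<forall>z\<in>V. nrm (\<lambda>t. z t - x' t) \<le> e' \<longrightarrow> real (Suc n) \<le> Re (c z z)"
      using hellinger_toeplitz_step[OF c bdd unb p(2,3), of "real (Suc n)"] by auto
    then show "\<exists>p'. ?P (Suc n) p' \<and> ?Q n p p'" using p by (intro exI[of _ "(x', e')"]) auto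
  qed
  then obtain f where f: "\<forall>n. ?P n (f n) \<and> ?Q n (f n) (f (Suc n))" by (elim exE)
  define X where "X n = fst (f n)" for n
  define E where "E n = snd (f n)" for n
  have X: "X n \<in> V" and E: "0 < E n" "E n \<le> 1" for n using spec[OF f, of n] by (auto simp: X_def E_def)
  have S: "E (Suc n) \<le> E n / 8" "nrm (\<lambda>t. X (Suc n) t - X n t) \<le> E n / 8"
    "z \<in> V \<Longrightarrow> nrm (\<lambda>t. z t - X (Suc n) t) \<le> E (Suc n) \<Longrightarrow> real (Suc n) \<le> Re (c z z)" for n z
    using spec[OF f, of n] by (auto simp: X_def E_def split: prod.splits)
  \<comment> \<open>Completeness is available for steps of size at most \<open>(1/4)^n\<close>;
    radii that start at most at 1 and shrink by a factor 8 meet this with room to spare.\<close>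
  have Eb: "E n \<le> (1/4)^n" for n
  proof (induction n)
    case (Suc n) then show ?case using S(1)[of n] by simp (smt (verit) E(1))
  qed (use E in simp)
  have "nrm (\<lambda>t. X (Suc n) t - X n t) \<le> (1/4)^n" for n using S(2)[of n] Eb[of n] E(1)[of n] by simp
  then obtain x where x: "x \<in> V" "(\<lambda>n. nrm (\<lambda>t. X n t - x t)) \<longlonglongrightarrow> 0"
    using complete[of X, OF X] by blast
  \<comment> \<open>Since \<open>E (Suc n) \<le> E n / 8\<close>, each step of length
    \<open>E n / 8\<close> is at most \<open>E n - E (Suc n)\<close>, and these differences
    telescope. Hence the limit stays in every ball.\<close>
  have nest: "nrm (\<lambda>t. X (n + m) t - X n t) \<le> E n - E (n + m)" for n m
  proof (induction m)
    case 0 show ?case using nrm_scale[OF X[of n], of 0] by simp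
  next
    case (Suc m)
    have "nrm (\<lambda>t. X (Suc (n + m)) t - X n t)
        \<le> nrm (\<lambda>t. X (Suc (n + m)) t - X (n + m) t) + nrm (\<lambda>t. X (n + m) t - X n t)"
      by (intro nrm_triangle_diff X)
    then show ?case using Suc S(1,2)[of "n + m"] E(1)[of "n + m"] by simp
  qed
  have "nrm (\<lambda>t. x t - X n t) \<le> E n" for n
  proof (rule field_le_epsilon)
    fix e :: real assume "0 < e"
    then obtain N where N: "\<And>m. m \<ge> N \<Longrightarrow> \<bar>nrm (\<lambda>t. X m t - x t)\<bar> < e"
      using x(2) by (auto simp: LIMSEQ_iff)
    have "nrm (\<lambda>t. x t - X n t) \<le> nrm (\<lambda>t. x t - X (n + N) t) + nrm (\<lambda>t. X (n + N) t - X n t)"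
      by (intro nrm_triangle_diff X x)
    also have "\<dots> \<le> e + E n"
      using N[of "n + N"] nest[of n N] E(1)[of "n + N"] nrm_minus[OF x(1) X[of "n + N"]] by simp
    finally show "nrm (\<lambda>t. x t - X n t) \<le> E n + e" by simp
  qed
  then have "real (Suc n) \<le> Re (c x x)" for n using S(3)[OF x(1)] by blast
  moreover obtain n where "Re (c x x) < real n" using reals_Archimedean2 by blast
  ultimately show False by (smt (verit) of_nat_Suc)
qed

end

section \<open>The space of square integrable functions\<close>

text \<open>Otherwise the simplifier rewrites \<open>L2\<close>, an abbreviation of \<open>Lp 2\<close>, to \<open>Lp (ereal 2)\<close>.\<close>

declare numeral_eq_ereal [simp del]

lemma borel_measurable_cnj [measurable]:
  "f \<in> borel_measurable M \<Longrightarrow> (\<lambda>x. cnj (f x)) \<in> borel_measurable M"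
  by (rule borel_measurable_continuous_on[where f = cnj]) (auto intro: continuous_intros)

lemma cmod_powr2: "cmod z powr 2 = (cmod z)\<^sup>2"
  by (cases "z = 0") auto

lemma L2_iff: "g \<in> L2 M \<longleftrightarrow> g \<in> borel_measurable M \<and> integrable M (\<lambda>x. (cmod (g x))\<^sup>2)"
  by (simp add: Lp_def numeral_eq_ereal cmod_powr2)

lemma L2_inner_self: "L2_inner M g g = complex_of_real (\<integral>x. (cmod (g x))\<^sup>2 \<partial>M)"
  unfolding L2_inner_def by (simp add: complex_norm_square[symmetric] flip: of_real_power)

lemma L2_norm_eq: "L2_norm M g = sqrt (Re (L2_inner M g g))"
  by (simp add: Lp_norm_def numeral_eq_ereal L2_inner_self cmod_powr2 powr_half_sqrt)

lemma L2_norm_sq: "(L2_norm M g)\<^sup>2 = (\<integral>x. (cmod (g x))\<^sup>2 \<partial>M)"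
  by (simp add: L2_norm_eq L2_inner_self)

lemma L2_norm_nonneg: "0 \<le> L2_norm M g"
  by (simp add: L2_norm_eq L2_inner_self)

lemma L2_norm_cong:
  assumes "AE x in M. g x = h x" "g \<in> borel_measurable M" "h \<in> borel_measurable M"
  shows "L2_norm M g = L2_norm M h"
proof -
  have "(\<integral>x. (cmod (g x))\<^sup>2 \<partial>M) = (\<integral>x. (cmod (h x))\<^sup>2 \<partial>M)"
    using assms by (intro integral_cong_AE) auto
  then show ?thesis by (simp add: L2_norm_eq L2_inner_self)
qed

lemma L2_inner_cong:
  assumes "AE x in M. g x = h x" "g \<in> borel_measurable M" "h \<in> borel_measurable M"
    "AE x in M. g' x = h' x" "g' \<in> borel_measurable M" "h' \<in> borel_measurable M"
  shows "L2_inner M g g' = L2_inner M h h'"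
  unfolding L2_inner_def using assms by (intro integral_cong_AE) auto

lemma L2_mult_integrable:
  assumes "g \<in> L2 M" "h \<in> L2 M"
  shows "integrable M (\<lambda>x. g x * h x)"
proof (rule Bochner_Integration.integrable_bound)
  show "integrable M (\<lambda>x. (cmod (g x))\<^sup>2 + (cmod (h x))\<^sup>2)" using assms by (auto simp: L2_iff)
  show "(\<lambda>x. g x * h x) \<in> borel_measurable M" using assms by (auto simp: L2_iff)
  have "a * c \<le> a\<^sup>2 + c\<^sup>2" if "0 \<le> a" "0 \<le> c" for a c :: real
    using sum_squares_bound[of a c] mult_nonneg_nonneg[OF that] by linarith
  then show "AE x in M. norm (g x * h x) \<le> norm ((cmod (g x))\<^sup>2 + (cmod (h x))\<^sup>2)"
    by (simp add: norm_mult)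
qed

lemma L2_cnj: "g \<in> L2 M \<Longrightarrow> (\<lambda>x. cnj (g x)) \<in> L2 M"
  by (auto simp: L2_iff)

lemma L2_inner_integrable: "g \<in> L2 M \<Longrightarrow> h \<in> L2 M \<Longrightarrow> integrable M (\<lambda>x. g x * cnj (h x))"
  by (intro L2_mult_integrable L2_cnj)

lemma L2_add:
  assumes "g \<in> L2 M" "h \<in> L2 M"
  shows "(\<lambda>x. g x + h x) \<in> L2 M"
  unfolding L2_iff
proof
  show "integrable M (\<lambda>x. (cmod (g x + h x))\<^sup>2)"
  proof (rule Bochner_Integration.integrable_bound)
    show "integrable M (\<lambda>x. 2 * (cmod (g x))\<^sup>2 + 2 * (cmod (h x))\<^sup>2)"
      using assms by (auto simp: L2_iff)
    show "(\<lambda>x. (cmod (g x + h x))\<^sup>2) \<in> borel_measurable M" using assms by (auto simp: L2_iff)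
    have "(cmod (a + c))\<^sup>2 \<le> 2 * (cmod a)\<^sup>2 + 2 * (cmod c)\<^sup>2" for a c
    proof -
      have "(cmod (a + c))\<^sup>2 \<le> (cmod a + cmod c)\<^sup>2"
        by (intro power_mono norm_triangle_ineq) auto
      then show ?thesis using sum_squares_bound[of "cmod a" "cmod c"]
        by (simp add: power2_sum)
    qed
    then show "AE x in M. norm ((cmod (g x + h x))\<^sup>2) \<le> norm (2 * (cmod (g x))\<^sup>2 + 2 * (cmod (h x))\<^sup>2)"
      by simp
  qed
qed (use assms in \<open>auto simp: L2_iff\<close>)

lemma L2_scale: "g \<in> L2 M \<Longrightarrow> (\<lambda>x. c * g x) \<in> L2 M"
  by (auto simp: L2_iff norm_mult power_mult_distrib)

lemma L2_inner_hermitian: "L2_inner M g h = cnj (L2_inner M h g)"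
  unfolding L2_inner_def Bochner_Integration.integral_cnj[symmetric, of M "\<lambda>t. h t * cnj (g t)"]
  by (intro Bochner_Integration.integral_cong refl) (simp add: mult.commute)

lemma L2_form: "hermitian_form (L2 M) (L2_inner M)"
proof
  fix x y z :: "'a \<Rightarrow> complex" and c
  assume x: "x \<in> L2 M"
  show "(\<lambda>t. c * x t) \<in> L2 M" using x by (rule L2_scale)
  show "0 \<le> Re (L2_inner M x x)" by (simp add: L2_inner_self)
  assume z: "z \<in> L2 M"
  show "L2_inner M (\<lambda>t. c * x t) z = c * L2_inner M x z"
    by (simp add: L2_inner_def mult.assoc)
  assume y: "y \<in> L2 M"
  show "(\<lambda>t. x t + y t) \<in> L2 M" using x y by (rule L2_add)
  show "L2_inner M (\<lambda>t. x t + y t) z = L2_inner M x z + L2_inner M y z"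
    using L2_inner_integrable[OF x z] L2_inner_integrable[OF y z]
    by (simp add: L2_inner_def distrib_right)
next
  fix x y :: "'a \<Rightarrow> complex"
  show "L2_inner M x y = cnj (L2_inner M y x)" by (rule L2_inner_hermitian)
qed

lemma L2_nrm: "hermitian_form.nrm (L2_inner M) = L2_norm M"
  by (simp add: hermitian_form.nrm_def[OF L2_form] L2_norm_eq fun_eq_iff)

section \<open>Completeness of L2 along fast sequences\<close>

text \<open>Cauchy-Schwarz for the factorisation of \<open>cmod (d i)\<close> into
  \<open>(1/2)^i\<close> and \<open>2^i * cmod (d i)\<close>; the first factors contribute the
  geometric tail \<open>(1/4)^n\<close>.\<close>

lemma square_sum_le_weighted:
  fixes d :: "nat \<Rightarrow> complex"
  assumes "summable (\<lambda>i. 4 ^ i * (cmod (d i))\<^sup>2)"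
  shows "(cmod (\<Sum>i=n..<n+m. d i))\<^sup>2 \<le> 2 * (1/4)^n * (\<Sum>i. 4 ^ i * (cmod (d i))\<^sup>2)"
proof -
  have geo: "(\<Sum>i=n..<n+m. (1/4::real)^i) \<le> 2 * (1/4)^n"
  proof -
    have "(\<Sum>i=n..<n+m. (1/4::real)^i) = 4 / 3 * ((1/4)^n - (1/4)^(n+m))"
      by (induction m) auto
    also have "\<dots> \<le> 4 / 3 * (1/4)^n" by simp
    also have "\<dots> \<le> 2 * (1/4)^n" by (intro mult_right_mono) auto
    finally show ?thesis .
  qed
  have "cmod (\<Sum>i=n..<n+m. d i) \<le> (\<Sum>i=n..<n+m. (1/2)^i * (2^i * cmod (d i)))"
    by (rule order_trans[OF norm_sum]) (simp add: power_one_over)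
  then have "(cmod (\<Sum>i=n..<n+m. d i))\<^sup>2 \<le> (\<Sum>i=n..<n+m. (1/2)^i * (2^i * cmod (d i)))\<^sup>2"
    by (intro power_mono) auto
  also have "\<dots> \<le> (\<Sum>i=n..<n+m. ((1/2)^i)\<^sup>2) * (\<Sum>i=n..<n+m. (2^i * cmod (d i))\<^sup>2)"
    by (rule Cauchy_Schwarz_ineq_sum)
  also have "(\<Sum>i=n..<n+m. ((1/2::real)^i)\<^sup>2) = (\<Sum>i=n..<n+m. (1/4)^i)"
    by (simp add: power2_eq_square flip: power_mult_distrib)
  also have "(\<Sum>i=n..<n+m. (2^i * cmod (d i))\<^sup>2) = (\<Sum>i=n..<n+m. 4 ^ i * (cmod (d i))\<^sup>2)"
    by (intro sum.cong refl) (simp add: power_mult_distrib, simp add: power2_eq_square flip: power_mult_distrib)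
  also have "(\<Sum>i=n..<n+m. (1/4)^i) * (\<Sum>i=n..<n+m. 4 ^ i * (cmod (d i))\<^sup>2)
      \<le> (2 * (1/4)^n) * (\<Sum>i. 4 ^ i * (cmod (d i))\<^sup>2)"
    by (intro mult_mono geo sum_le_suminf assms sum_nonneg) auto
  finally show ?thesis .
qed

text \<open>The same weighted sum yields both convergence and a rate. When applied at each point of
  a measure space it is one majorant for all \<open>n\<close>.\<close>

lemma pointwise_limit:
  fixes X :: "nat \<Rightarrow> complex"
  assumes "summable (\<lambda>i. 4 ^ i * (cmod (X (Suc i) - X i))\<^sup>2)"
  shows "(cmod (X n - lim X))\<^sup>2 \<le> 2 * (1/4)^n * (\<Sum>i. 4 ^ i * (cmod (X (Suc i) - X i))\<^sup>2)"
proof -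
  let ?h = "\<Sum>i. 4 ^ i * (cmod (X (Suc i) - X i))\<^sup>2"
  have b: "(cmod (X (n + m) - X n))\<^sup>2 \<le> 2 * (1/4)^n * ?h" for n m
    using square_sum_le_weighted[OF assms, of n m] sum_Suc_diff'[of n "n + m" X] by simp
  have h0: "0 \<le> ?h" by (intro suminf_nonneg assms) auto
  have lim0: "(\<lambda>n. sqrt (2 * (1/4)^n * ?h)) \<longlonglongrightarrow> sqrt (2 * 0 * ?h)"
    by (intro tendsto_intros LIMSEQ_power_zero) auto
  have "Cauchy X"
  proof (rule metric_CauchyI)
    fix e :: real assume "0 < e"
    then obtain N where N: "sqrt (2 * (1/4)^N * ?h) < e / 2"
      using order_tendstoD(2)[OF lim0, of "e / 2"] by (auto simp: eventually_sequentially)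
    have c: "dist (X (N + m)) (X N) < e / 2" for m
      using real_le_rsqrt[OF b[of N m]] N by (simp add: dist_norm)
    show "\<exists>M. \<forall>m\<ge>M. \<forall>n\<ge>M. dist (X m) (X n) < e"
    proof (intro exI allI impI)
      fix m n assume "N \<le> m" "N \<le> n"
      then show "dist (X m) (X n) < e"
        using c[of "m - N"] c[of "n - N"] dist_triangle_half_l[of "X m" "X N" e "X n"]
        by (simp add: dist_commute)
    qed
  qed
  then have "X \<longlonglongrightarrow> lim X" using Cauchy_convergent convergent_LIMSEQ_iff by blast
  then have l: "(\<lambda>m. X (n + m)) \<longlonglongrightarrow> lim X" using LIMSEQ_ignore_initial_segment[of X "lim X" n]
    by (simp add: add.commute)
  have "(\<lambda>m. (cmod (X (n + m) - X n))\<^sup>2) \<longlonglongrightarrow> (cmod (lim X - X n))\<^sup>2"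
    by (intro tendsto_intros l)
  then have "(cmod (lim X - X n))\<^sup>2 \<le> 2 * (1/4)^n * ?h"
    by (rule LIMSEQ_le_const2) (use b in auto)
  then show ?thesis by (simp add: norm_minus_commute)
qed

text \<open>The weighted square function \<open>H\<close> of the increments is integrable, because
  \<open>4^i\<close> times the squared norm \<open>(1/16)^i\<close> is summable. Where
  \<open>H\<close> is finite, \<open>pointwise_limit\<close> applies, and integrating its estimate
  gives the rate in norm directly.\<close>

theorem L2_complete:
  assumes X: "\<And>n. X n \<in> L2 M"
    and fast: "\<And>n. L2_norm M (\<lambda>x. X (Suc n) x - X n x) \<le> (1/4)^n"
  shows "\<exists>g\<in>L2 M. (\<lambda>n. L2_norm M (\<lambda>x. X n x - g x)) \<longlonglongrightarrow> 0"
proof -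
  interpret hermitian_form "L2 M" "L2_inner M" by (rule L2_form)
  have [measurable]: "X n \<in> borel_measurable M" for n using X[of n] by (simp add: L2_iff)
  let ?d = "\<lambda>i x. 4 ^ i * (cmod (X (Suc i) x - X i x))\<^sup>2"
  define H where "H x = (\<Sum>i. ennreal (?d i x))" for x
  have [measurable]: "H \<in> borel_measurable M" unfolding H_def by measurable
  \<comment> \<open>Off the null set where \<open>H\<close> is infinite this is a true limit;
    elsewhere the value of \<open>lim\<close> is arbitrary, yet \<open>g\<close> is measurable on
    the whole space.\<close>
  define g where "g x = lim (\<lambda>n. X n x)" for x
  have [measurable]: "g \<in> borel_measurable M" unfolding g_def by measurable
  have di: "(\<integral>\<^sup>+ x. ennreal (?d i x) \<partial>M) \<le> ennreal ((1/4)^i)" for i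
  proof -
    have d2: "(\<lambda>x. X (Suc i) x - X i x) \<in> L2 M" by (intro diff_closed X)
    have "(\<integral>\<^sup>+ x. ennreal (?d i x) \<partial>M) = ennreal (\<integral>x. ?d i x \<partial>M)"
      using d2 by (intro nn_integral_eq_integral) (auto simp: L2_iff)
    also have "(\<integral>x. ?d i x \<partial>M) = 4 ^ i * (L2_norm M (\<lambda>x. X (Suc i) x - X i x))\<^sup>2"
      by (simp add: L2_norm_sq)
    also have "\<dots> \<le> 4 ^ i * ((1/4)^i)\<^sup>2"
      by (intro mult_left_mono power_mono fast L2_norm_nonneg) auto
    also have "\<dots> = (1/4)^i" by (simp add: power2_eq_square power_one_over)
    finally show ?thesis by (simp add: ennreal_leI)
  qed
  have "(\<integral>\<^sup>+ x. H x \<partial>M) = (\<Sum>i. \<integral>\<^sup>+ x. ennreal (?d i x) \<partial>M)"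
    unfolding H_def by (rule nn_integral_suminf) measurable
  also have "\<dots> \<le> (\<Sum>i. ennreal ((1/4)^i))" by (intro suminf_le di) auto
  also have "\<dots> = ennreal (\<Sum>i. (1/4)^i)" by (intro suminf_ennreal2) (auto intro: summable_geometric)
  finally have HI: "(\<integral>\<^sup>+ x. H x \<partial>M) < \<infinity>" by (simp add: order_le_less_trans)
  have AEH: "AE x in M. H x \<noteq> \<infinity>" using HI by (intro nn_integral_PInf_AE) auto
  have pw: "ennreal ((cmod (X n x - g x))\<^sup>2) \<le> ennreal (2 * (1/4)^n) * H x" if "H x \<noteq> \<infinity>" for n x
  proof -
    have s: "summable (\<lambda>i. ?d i x)"
      using that unfolding H_def by (intro summable_suminf_not_top) auto
    have "H x = ennreal (\<Sum>i. ?d i x)" unfolding H_def using s by (intro suminf_ennreal2) auto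
    then show ?thesis using pointwise_limit[OF s, of n] suminf_nonneg[OF s]
      by (simp add: g_def ennreal_leI flip: ennreal_mult)
  qed
  have nn: "(\<integral>\<^sup>+ x. ennreal ((cmod (X n x - g x))\<^sup>2) \<partial>M) \<le> ennreal (2 * (1/4)^n) * (\<integral>\<^sup>+ x. H x \<partial>M)" for n
  proof -
    have "(\<integral>\<^sup>+ x. ennreal ((cmod (X n x - g x))\<^sup>2) \<partial>M) \<le> (\<integral>\<^sup>+ x. ennreal (2 * (1/4)^n) * H x \<partial>M)"
      using AEH pw by (intro nn_integral_mono_AE) auto
    then show ?thesis by (simp add: nn_integral_cmult)
  qed
  have dL: "(\<lambda>x. X n x - g x) \<in> L2 M" for n
    unfolding L2_iff
  proof (intro conjI integrableI_bounded)
    show "(\<integral>\<^sup>+ x. ennreal (norm ((cmod (X n x - g x))\<^sup>2)) \<partial>M) < \<infinity>"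
      using nn[of n] HI by (simp add: ennreal_mult_less_top order_le_less_trans)
  qed measurable
  have "g \<in> L2 M" using diff_closed[OF X[of 0] dL[of 0]] by simp
  moreover have "(\<lambda>n. L2_norm M (\<lambda>x. X n x - g x)) \<longlonglongrightarrow> 0"
  proof -
    let ?h = "enn2real (\<integral>\<^sup>+ x. H x \<partial>M)"
    have b: "(L2_norm M (\<lambda>x. X n x - g x))\<^sup>2 \<le> 2 * (1/4)^n * ?h" for n
    proof -
      have "ennreal ((L2_norm M (\<lambda>x. X n x - g x))\<^sup>2) = (\<integral>\<^sup>+ x. ennreal ((cmod (X n x - g x))\<^sup>2) \<partial>M)"
        using dL[of n] unfolding L2_norm_sq by (intro nn_integral_eq_integral[symmetric]) (auto simp: L2_iff)
      also have "\<dots> \<le> ennreal (2 * (1/4)^n * ?h)"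
        using nn[of n] HI by (simp add: ennreal_mult')
      finally show ?thesis by (simp add: ennreal_le_iff)
    qed
    have "(\<lambda>n. sqrt (2 * (1/4)^n * ?h)) \<longlonglongrightarrow> sqrt (2 * 0 * ?h)"
      by (intro tendsto_intros LIMSEQ_power_zero) auto
    then have l: "(\<lambda>n. sqrt (2 * (1/4)^n * ?h)) \<longlonglongrightarrow> 0" by simp
    have "norm (L2_norm M (\<lambda>x. X n x - g x)) \<le> sqrt (2 * (1/4)^n * ?h)" for n
      using real_le_rsqrt[OF b[of n]] by (simp only: real_norm_def abs_of_nonneg L2_norm_nonneg)
    then show ?thesis by (intro Lim_null_comparison[OF _ l] always_eventually allI)
  qed
  ultimately show ?thesis by blast
qed

section \<open>Smooth bump functions\<close>

lemma partial_deriv_eq: "(f has_derivative f') (at x) \<Longrightarrow> partial_deriv i f x = f' (axis i 1)"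
  unfolding partial_deriv_def by (drule frechet_derivative_at) simp

lemma Ck_Suc_imp: "Ck (Suc n) f \<Longrightarrow> Ck n f"
proof (induction n arbitrary: f)
  case 0
  then show ?case
    by (auto intro!: continuous_at_imp_continuous_on differentiable_imp_continuous_within)
next
  case (Suc n)
  then show ?case by (simp only: Ck.simps(2)) blast
qed

lemma Ck_scale: "Ck n f \<Longrightarrow> Ck n (\<lambda>x. c * f x)"
proof (induction n arbitrary: f)
  case 0
  then show ?case by (auto intro!: continuous_intros)
next
  case (Suc n)
  have d: "(f has_derivative frechet_derivative f (at x)) (at x)" for x
    using Suc.prems by (auto intro: frechet_derivative_works[THEN iffD1])
  have d': "((\<lambda>x. c * f x) has_derivative (\<lambda>h. c * frechet_derivative f (at x) h)) (at x)" for x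
    by (intro has_derivative_mult_right d)
  then have "partial_deriv i (\<lambda>x. c * f x) = (\<lambda>x. c * partial_deriv i f x)" for i
    by (intro ext) (subst partial_deriv_eq[OF d'], simp add: partial_deriv_def)
  then show ?case using Suc differentiableI[OF d'] by simp
qed

lemma Ck_add: "Ck n f \<Longrightarrow> Ck n g \<Longrightarrow> Ck n (\<lambda>x. f x + g x)"
proof (induction n arbitrary: f g)
  case 0
  then show ?case by (auto intro!: continuous_intros)
next
  case (Suc n)
  have d: "(f has_derivative frechet_derivative f (at x)) (at x)"
    "(g has_derivative frechet_derivative g (at x)) (at x)" for x
    using Suc.prems by (auto intro: frechet_derivative_works[THEN iffD1])
  have d': "((\<lambda>x. f x + g x) has_derivative
      (\<lambda>h. frechet_derivative f (at x) h + frechet_derivative g (at x) h)) (at x)" for x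
    by (intro has_derivative_add d)
  then have "partial_deriv i (\<lambda>x. f x + g x) = (\<lambda>x. partial_deriv i f x + partial_deriv i g x)" for i
    by (intro ext) (subst partial_deriv_eq[OF d'], simp add: partial_deriv_def)
  then show ?case using Suc differentiableI[OF d'] by simp
qed

lemma Ck_mult: "Ck n f \<Longrightarrow> Ck n g \<Longrightarrow> Ck n (\<lambda>x. f x * g x)"
proof (induction n arbitrary: f g)
  case 0
  then show ?case by (auto intro!: continuous_intros)
next
  case (Suc n)
  have d: "(f has_derivative frechet_derivative f (at x)) (at x)"
    "(g has_derivative frechet_derivative g (at x)) (at x)" for x
    using Suc.prems by (auto intro: frechet_derivative_works[THEN iffD1])
  have d': "((\<lambda>x. f x * g x) has_derivative
      (\<lambda>h. f x * frechet_derivative g (at x) h + frechet_derivative f (at x) h * g x)) (at x)" for x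
    by (intro has_derivative_mult d)
  then have "partial_deriv i (\<lambda>x. f x * g x)
      = (\<lambda>x. f x * partial_deriv i g x + partial_deriv i f x * g x)" for i
    by (intro ext) (subst partial_deriv_eq[OF d'], simp add: partial_deriv_def)
  moreover have "Ck n (\<lambda>x. f x * partial_deriv i g x + partial_deriv i f x * g x)" for i
    using Suc.prems Ck_Suc_imp by (intro Ck_add Suc.IH) auto
  ultimately show ?case using differentiableI[OF d'] by simp
qed

text \<open>The power of \<open>1 / t\<close> makes the family closed under differentiation, so that
  smoothness at 0 becomes one induction in which \<open>k\<close> is free. The case
  \<open>k = 0\<close> is the classical exp(-1/t).\<close>

definition flat :: "nat \<Rightarrow> real \<Rightarrow> real" where
  "flat k t = (if t \<le> 0 then 0 else (1 / t) ^ k * exp (- (1 / t)))"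

lemma flat_tendsto_0: "(flat k \<longlongrightarrow> 0) (at 0)"
proof (rule filterlim_split_at)
  show "(flat k \<longlongrightarrow> 0) (at_left 0)"
    by (rule tendsto_eventually) (auto simp: flat_def eventually_at_filter)
  have "((\<lambda>t::real. (inverse t) ^ k / exp (inverse t)) \<longlongrightarrow> 0) (at_right 0)"
    by (rule filterlim_compose[OF tendsto_power_div_exp_0 filterlim_inverse_at_top_right])
  moreover have "\<forall>\<^sub>F t in at_right 0. (inverse t) ^ k / exp (inverse t) = flat k t"
    by (auto simp: flat_def eventually_at_filter exp_minus field_simps)
  ultimately show "(flat k \<longlongrightarrow> 0) (at_right 0)" by (rule Lim_transform_eventually)
qed

lemma flat_deriv:
  "(flat k has_real_derivative flat (Suc (Suc k)) t - real k * flat (Suc k) t) (at t)"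
proof -
  consider "t < 0" | "t = 0" | "0 < t" by linarith
  then show ?thesis
  proof cases
    case 1
    have "(flat k has_real_derivative 0) (at t)"
      by (rule has_field_derivative_transform_within_open[of "\<lambda>_. 0" _ _ "{..<0}"])
        (use 1 in \<open>auto simp: flat_def\<close>)
    then show ?thesis using 1 by (simp add: flat_def)
  next
    case 2
    \<comment> \<open>At the origin the difference quotient of \<open>flat k\<close> is
      \<open>flat (Suc k)\<close> itself, on the negative side because both vanish.\<close>
    have "\<forall>\<^sub>F s in at 0. flat (Suc k) s = (flat k s - flat k 0) / (s - 0)"
      by (auto simp: flat_def eventually_at_filter)
    then have "((\<lambda>s. (flat k s - flat k 0) / (s - 0)) \<longlongrightarrow> 0) (at 0)"
      by (rule Lim_transform_eventually[OF flat_tendsto_0])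
    then show ?thesis using 2 by (simp add: has_field_derivative_iff flat_def)
  next
    case 3
    define y where "y = 1 / t"
    have D: "((\<lambda>s. 1 / s) has_real_derivative - (y ^ 2)) (at t)"
      using 3 by (auto intro!: derivative_eq_intros simp: y_def power2_eq_square)
    have "((\<lambda>s. (1 / s) ^ k * exp (- (1 / s))) has_real_derivative
        (real k * (- (y ^ 2) * y ^ (k - 1))) * exp (- y) + y ^ k * (exp (- y) * y ^ 2)) (at t)"
      using DERIV_mult[OF DERIV_power[OF D, of k] DERIV_chain2[OF DERIV_exp DERIV_minus[OF D]]]
      by (simp add: y_def mult_ac)
    also have "(real k * (- (y ^ 2) * y ^ (k - 1))) * exp (- y) + y ^ k * (exp (- y) * y ^ 2)
        = y ^ Suc (Suc k) * exp (- y) - real k * (y ^ Suc k * exp (- y))"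
      by (cases k) (auto simp: algebra_simps power2_eq_square)
    finally have "((\<lambda>s. (1 / s) ^ k * exp (- (1 / s))) has_real_derivative
        (1 / t) ^ Suc (Suc k) * exp (- (1 / t)) - real k * ((1 / t) ^ Suc k * exp (- (1 / t)))) (at t)"
      by (simp only: y_def)
    then have "(flat k has_real_derivative
        (1 / t) ^ Suc (Suc k) * exp (- (1 / t)) - real k * ((1 / t) ^ Suc k * exp (- (1 / t)))) (at t)"
      by (rule has_field_derivative_transform_within_open[of _ _ _ "{0<..}"])
        (use 3 in \<open>auto simp: flat_def\<close>)
    then show ?thesis using 3 by (simp add: flat_def)
  qed
qed

lemma Ck_flat: "Ck n (\<lambda>x. complex_of_real (flat k (c * x $ i + d)))"
proof (induction n arbitrary: k)
  have D: "((\<lambda>x. complex_of_real (flat k (c * x $ i + d))) has_derivative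
     (\<lambda>h. complex_of_real ((c * h $ i) * (flat (Suc (Suc k)) (c * x $ i + d) - real k * flat (Suc k) (c * x $ i + d))))) (at x)"
    for k and x :: "real^2"
  proof -
    have "((\<lambda>x. c * x $ i + d) has_derivative (\<lambda>h. c * h $ i)) (at x)"
      by (auto intro!: derivative_eq_intros bounded_linear_imp_has_derivative bounded_linear_vec_nth)
    then have "((\<lambda>x. flat k (c * x $ i + d)) has_derivative
      (\<lambda>h. (c * h $ i) * (flat (Suc (Suc k)) (c * x $ i + d) - real k * flat (Suc k) (c * x $ i + d)))) (at x)"
      using flat_deriv by (rule has_derivative_compose[OF _ has_field_derivative_imp_has_derivative, THEN has_derivative_eq_rhs])
        (auto simp: mult.commute)
    then show ?thesis by (rule has_derivative_of_real)
  qed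
  {
    case 0
    then show ?case unfolding Ck.simps
      by (intro continuous_at_imp_continuous_on ballI has_derivative_continuous[OF D])
  next
    case (Suc n)
    have "partial_deriv j (\<lambda>x. complex_of_real (flat k (c * x $ i + d))) =
      (\<lambda>x. complex_of_real (c * axis j 1 $ i) * (complex_of_real (flat (Suc (Suc k)) (c * x $ i + d))
         + complex_of_real (- real k) * complex_of_real (flat (Suc k) (c * x $ i + d))))" for j
      by (rule ext, subst partial_deriv_eq[OF D]) simp
    moreover have "Ck n (\<lambda>x. complex_of_real (c * axis j 1 $ i) * (complex_of_real (flat (Suc (Suc k)) (c * x $ i + d))
         + complex_of_real (- real k) * complex_of_real (flat (Suc k) (c * x $ i + d))))" for j
      by (intro Ck_scale Ck_add Suc.IH)
    ultimately show ?case using differentiableI[OF D] by simp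
  }
qed

text \<open>A smooth minorant of the indicator of the open box: every factor lies between 0 and 1,
  vanishes outside its half-plane, and tends to 1 inside it as \<open>m\<close> grows.\<close>

definition bump :: "real^2 \<Rightarrow> real^2 \<Rightarrow> nat \<Rightarrow> real^2 \<Rightarrow> real" where
  "bump a b m x = flat 0 (real m * (x $ 1 - a $ 1)) * flat 0 (real m * (b $ 1 - x $ 1))
     * (flat 0 (real m * (x $ 2 - a $ 2)) * flat 0 (real m * (b $ 2 - x $ 2)))"

lemma smooth_bump: "smooth (\<lambda>x. complex_of_real (bump a b m x))"
proof -
  have 1: "Ck n (\<lambda>x. complex_of_real (flat 0 (real m * (x $ i - c))))" for n i c
    using Ck_flat[of n 0 "real m" i "- real m * c"] by (simp add: algebra_simps)
  have 2: "Ck n (\<lambda>x. complex_of_real (flat 0 (real m * (c - x $ i))))" for n i c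
    using Ck_flat[of n 0 "- real m" i "real m * c"] by (simp add: algebra_simps)
  show ?thesis unfolding smooth_def bump_def of_real_mult by (intro allI Ck_mult 1 2)
qed

lemma flat_0_bounds: "0 \<le> flat 0 t" "flat 0 t \<le> 1"
  by (auto simp: flat_def)

lemma bump_bounds: "0 \<le> bump a b m x" "bump a b m x \<le> 1"
  unfolding bump_def by (intro mult_nonneg_nonneg mult_le_one flat_0_bounds)+

lemma bump_eq_0: "x \<notin> box a b \<Longrightarrow> bump a b m x = 0"
  by (auto simp: bump_def flat_def mem_box_cart forall_2 not_less mult_nonneg_nonpos)

lemma bump_test_function:
  assumes "cbox a b \<subseteq> \<Omega>"
  shows "(\<lambda>x. complex_of_real (bump a b m x)) \<in> test_functions \<Omega>"
proof -
  have "bump a b m x = 0" if "x \<notin> cbox a b" for x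
    using that box_subset_cbox by (intro bump_eq_0) blast
  then show ?thesis unfolding test_functions_def
    using assms smooth_bump by (auto intro!: exI[of _ "cbox a b"])
qed

lemma flat_0_scaled_tendsto: "0 < s \<Longrightarrow> (\<lambda>m. flat 0 (real m * s)) \<longlonglongrightarrow> 1"
proof -
  assume s: "0 < s"
  have "(\<lambda>m. exp (- (inverse s * (1 / real m)))) \<longlonglongrightarrow> exp (- (inverse s * 0))"
    by (intro tendsto_intros lim_1_over_n)
  moreover have "\<forall>\<^sub>F m in sequentially. exp (- (inverse s * (1 / real m))) = flat 0 (real m * s)"
    using s by (intro eventually_sequentiallyI[of 1])
      (auto simp: flat_def field_simps mult_le_0_iff)
  ultimately show ?thesis by (simp add: tendsto_cong)
qed

lemma bump_tendsto: "(\<lambda>m. bump a b m x) \<longlonglongrightarrow> indicator (box a b) x"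
proof (cases "x \<in> box a b")
  case True
  then have "(\<lambda>m. bump a b m x) \<longlonglongrightarrow> 1 * 1 * (1 * 1)"
    unfolding bump_def by (intro tendsto_mult flat_0_scaled_tendsto) (auto simp: mem_box_cart)
  then show ?thesis using True by simp
qed (simp add: bump_eq_0)

section \<open>The fundamental lemma of the calculus of variations\<close>

lemma box_Int_box_cart:
  "box a b \<inter> box c d = box ((\<chi> i. max (a $ i) (c $ i)) :: real^'n) (\<chi> i. min (b $ i) (d $ i))"
  by (auto simp: mem_box_cart)

text \<open>Open boxes generate the Borel sets and are stable under intersection, so the sets on
  which \<open>W\<close> integrates to zero, a Dynkin system thanks to \<open>UN\<close>, comprise
  all Borel sets. Lebesgue sets differ from Borel sets by null sets, and real and imaginary parts
  are then compared with the density 0.\<close>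

lemma AE_zero_if_box_integrals_zero:
  fixes W :: "real^2 \<Rightarrow> complex"
  assumes W: "integrable lebesgue W"
    and UN: "(\<integral>x. W x \<partial>lebesgue) = 0"
    and box: "\<And>a b. (\<integral>x\<in>box a b. W x \<partial>lebesgue) = 0"
  shows "AE x in lebesgue. W x = 0"
proof -
  have si: "set_integrable lebesgue A W" if "A \<in> sets lebesgue" for A
    using integrable_mult_indicator[OF that W] by (simp add: set_integrable_def)
  have B: "(\<integral>x\<in>A. W x \<partial>lebesgue) = 0" if "A \<in> sets borel" for A
  proof -
    have "A \<in> sigma_sets UNIV (range (\<lambda>(a, b). box a b :: (real^2) set))"
      using that by (simp add: borel_eq_box)
    then show ?thesis
    proof (rule sigma_sets_induct_disjoint[rotated 2])
      show "Int_stable (range (\<lambda>(a, b). box a b :: (real^2) set))"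
      proof (rule Int_stableI_image)
        fix p q :: "(real^2) \<times> (real^2)"
        show "\<exists>r\<in>UNIV. (case p of (a, b) \<Rightarrow> box a b) \<inter> (case q of (a, b) \<Rightarrow> box a b) = (case r of (a, b) \<Rightarrow> box a b)"
          by (cases p, cases q) (auto simp: box_Int_box_cart)
      qed
      show "(\<integral>x\<in>UNIV - A. W x \<partial>lebesgue) = 0"
        if "A \<in> sigma_sets UNIV (range (\<lambda>(a, b). box a b))" "(\<integral>x\<in>A. W x \<partial>lebesgue) = 0" for A
      proof -
        have A: "A \<in> sets lebesgue" using that(1) by (simp add: borel_eq_box)
        have "(\<integral>x\<in>A \<union> (UNIV - A). W x \<partial>lebesgue) = (\<integral>x\<in>A. W x \<partial>lebesgue) + (\<integral>x\<in>UNIV - A. W x \<partial>lebesgue)"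
          using sets.compl_sets[OF A] by (intro set_integral_Un si A) auto
        then show ?thesis using that UN by (simp add: set_lebesgue_integral_def)
      qed
      show "(\<integral>x\<in>(\<Union>i. A i). W x \<partial>lebesgue) = 0"
        if "disjoint_family A" "range A \<subseteq> sigma_sets UNIV (range (\<lambda>(a, b). box a b))"
          "\<And>i. (\<integral>x\<in>A i. W x \<partial>lebesgue) = 0" for A :: "nat \<Rightarrow> (real^2) set"
      proof -
        have "A i \<in> sets borel" for i
          using that(2) unfolding borel_eq_box by (simp add: range_subsetD)
        then have A: "A i \<in> sets lebesgue" for i by simp
        have "(\<integral>x\<in>(\<Union>i. A i). W x \<partial>lebesgue) = (\<Sum>i. \<integral>x\<in>A i. W x \<partial>lebesgue)"
          using A that(1) by (intro lebesgue_integral_countable_add si sets.countable_UN)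
            (auto simp: disjoint_family_on_def)
        then show ?thesis using that(3) by simp
      qed
    qed (use box in \<open>auto simp: set_lebesgue_integral_def\<close>)
  qed
  have "(\<integral>x\<in>A. W x \<partial>lebesgue) = 0" if A: "A \<in> sets lebesgue" for A
  proof -
    obtain S N N' where S: "A = S \<union> N" "N \<subseteq> N'" "N' \<in> null_sets lborel" "S \<in> sets lborel"
      using sets_completionE[OF A] by blast
    have "AE x in lebesgue. x \<notin> N'"
      using S(3) by (intro AE_not_in null_sets_completionI)
    then have "(\<integral>x\<in>A. W x \<partial>lebesgue) = (\<integral>x\<in>S. W x \<partial>lebesgue)"
      unfolding set_lebesgue_integral_def
      using si[OF A] si[of S] S
      by (intro integral_cong_AE) (auto simp: set_integrable_def indicator_def)
    then show ?thesis using B S(4) by simp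
  qed
  then have z: "(\<integral>x. indicat_real A x *\<^sub>R W x \<partial>lebesgue) = 0" if "A \<in> sets lebesgue" for A
    using that by (simp add: set_lebesgue_integral_def)
  have "AE x in lebesgue. Re (W x) = 0"
    by (rule density_unique_real)
      (use W integral_Re[OF si[unfolded set_integrable_def]] z in \<open>auto simp: set_lebesgue_integral_def\<close>)
  moreover have "AE x in lebesgue. Im (W x) = 0"
    by (rule density_unique_real)
      (use W integral_Im[OF si[unfolded set_integrable_def]] z in \<open>auto simp: set_lebesgue_integral_def\<close>)
  ultimately show ?thesis by eventually_elim (simp add: complex_eq_iff)
qed

text \<open>Bump functions take the place of mollifiers: they converge boundedly to indicators of
  boxes, so \<open>v\<close> integrates to zero over each open box whose closed box lies in
  \<open>\<Omega>\<close>. Countably many closed boxes cover \<open>\<Omega>\<close>.\<close>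

theorem fundamental_lemma:
  fixes v :: "real^2 \<Rightarrow> complex"
  assumes \<Omega>: "open \<Omega>" and v: "integrable (lebesgue_on \<Omega>) v"
    and orth: "\<And>\<phi>. \<phi> \<in> test_functions \<Omega> \<Longrightarrow> (\<integral>x. v x * \<phi> x \<partial>lebesgue_on \<Omega>) = 0"
  shows "AE x in lebesgue_on \<Omega>. v x = 0"
proof -
  have ms: "\<Omega> \<inter> space lebesgue \<in> sets lebesgue" "\<Omega> \<in> sets lebesgue" using \<Omega> by auto
  define V where "V x = indicator \<Omega> x *\<^sub>R v x" for x
  have V: "integrable lebesgue V"
    using v unfolding V_def by (simp add: integrable_restrict_space ms)
  have bx: "(\<integral>x\<in>box a b. V x \<partial>lebesgue) = 0" if ab: "cbox a b \<subseteq> \<Omega>" for a b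
  proof -
    have "(\<lambda>m. \<integral>x. bump a b m x *\<^sub>R V x \<partial>lebesgue) \<longlonglongrightarrow> (\<integral>x. indicator (box a b) x *\<^sub>R V x \<partial>lebesgue)"
    proof (rule integral_dominated_convergence[where w = "\<lambda>x. norm (V x)"])
      show "integrable lebesgue (\<lambda>x. norm (V x))" using V by simp
      have [measurable]: "V \<in> borel_measurable lebesgue" using V by auto
      have "continuous_on UNIV (\<lambda>x. complex_of_real (bump a b m x))" for m
        using smooth_bump[of a b m] unfolding smooth_def by (metis Ck.simps(1))
      then have "continuous_on UNIV (bump a b m)" for m
        using continuous_on_Re[of UNIV "\<lambda>x. complex_of_real (bump a b m x)"] by simp
      then have [measurable]: "bump a b m \<in> borel_measurable lebesgue" for m
        by (intro measurable_completion) (simp add: borel_measurable_continuous_onI)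
      show "(\<lambda>x. bump a b m x *\<^sub>R V x) \<in> borel_measurable lebesgue" for m by measurable
      have [measurable]: "box a b \<in> sets lebesgue" by simp
      show "(\<lambda>x. indicat_real (box a b) x *\<^sub>R V x) \<in> borel_measurable lebesgue" by measurable
      show "AE x in lebesgue. (\<lambda>m. bump a b m x *\<^sub>R V x) \<longlonglongrightarrow> indicat_real (box a b) x *\<^sub>R V x"
        by (intro always_eventually allI tendsto_intros bump_tendsto)
      show "AE x in lebesgue. norm (bump a b m x *\<^sub>R V x) \<le> norm (V x)" for m
        using bump_bounds[of a b m] by (auto simp: mult_left_le_one_le)
    qed
    moreover have "(\<integral>x. bump a b m x *\<^sub>R V x \<partial>lebesgue) = 0" for m
    proof -
      have "(\<integral>x. bump a b m x *\<^sub>R V x \<partial>lebesgue) = (\<integral>x. indicator \<Omega> x *\<^sub>R (v x * complex_of_real (bump a b m x)) \<partial>lebesgue)"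
        by (simp add: V_def scaleR_conv_of_real mult_ac)
      also have "\<dots> = (\<integral>x. v x * complex_of_real (bump a b m x) \<partial>lebesgue_on \<Omega>)"
        using ms by (simp add: integral_restrict_space)
      also have "\<dots> = 0" by (intro orth bump_test_function ab)
      finally show ?thesis .
    qed
    ultimately show ?thesis by (simp add: set_lebesgue_integral_def LIMSEQ_const_iff)
  qed
  have cb: "AE x in lebesgue. x \<in> cbox c d \<longrightarrow> V x = 0" if cd: "cbox c d \<subseteq> \<Omega>" for c d
  proof -
    \<comment> \<open>After the cut-off, the integral over an arbitrary box is one over its
      intersection with \<open>box c d\<close>, which is again a box covered by
      \<open>bx\<close>.\<close>
    define W where "W x = indicator (box c d) x *\<^sub>R V x" for x
    have "AE x in lebesgue. W x = 0"
    proof (rule AE_zero_if_box_integrals_zero)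
      show "integrable lebesgue W" unfolding W_def by (intro integrable_mult_indicator V) simp
      show "(\<integral>x. W x \<partial>lebesgue) = 0" using bx[OF cd] by (simp add: W_def set_lebesgue_integral_def)
      fix a b :: "real^2"
      let ?a = "\<chi> i. max (a $ i) (c $ i)" and ?b = "\<chi> i. min (b $ i) (d $ i)"
      have "cbox ?a ?b \<subseteq> cbox c d" by (auto simp: mem_box_cart)
      then have "(\<integral>x\<in>box ?a ?b. V x \<partial>lebesgue) = 0" using cd by (intro bx) auto
      then show "(\<integral>x\<in>box a b. W x \<partial>lebesgue) = 0"
        by (simp add: W_def set_lebesgue_integral_def box_Int_box_cart[symmetric] indicator_inter_arith
            flip: scaleR_scaleR)
    qed
    moreover have "AE x in lebesgue. x \<notin> cbox c d - box c d"
      using negligible_frontier_interval by (intro AE_not_in) (simp add: negligible_iff_null_sets)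
    ultimately show ?thesis by eventually_elim (auto simp: W_def)
  qed
  obtain D where D: "countable D" "D \<subseteq> Pow \<Omega>" "\<And>X. X \<in> D \<Longrightarrow> \<exists>a b. X = cbox a b" "\<Union>D = \<Omega>"
    using open_countable_Union_open_cbox[OF \<Omega>] by metis
  have "AE x in lebesgue. \<forall>X\<in>D. x \<in> X \<longrightarrow> V x = 0"
    unfolding AE_ball_countable[OF D(1)] using cb D by (metis PowD subsetD)
  then have "AE x in lebesgue. x \<in> \<Omega> \<longrightarrow> v x = 0"
  proof eventually_elim
    case (elim x)
    show ?case
    proof
      assume x: "x \<in> \<Omega>"
      then have "V x = 0" using elim D(4) by blast
      then show "v x = 0" using x by (simp add: V_def)
    qed
  qed
  then show ?thesis using ms by (simp add: AE_restrict_space_iff)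
qed

section \<open>The Sobolev space as a complete Hermitian space\<close>

lemma test_function_smooth: "\<phi> \<in> test_functions \<Omega> \<Longrightarrow> smooth \<phi>"
  by (simp add: test_functions_def)

lemma test_function_has_derivative:
  "\<phi> \<in> test_functions \<Omega> \<Longrightarrow> (\<phi> has_derivative frechet_derivative \<phi> (at x)) (at x)"
  using test_function_smooth[of \<phi> \<Omega>] unfolding smooth_def
  by (metis Ck.simps(2) frechet_derivative_works)

lemma test_function_continuous:
  assumes "\<phi> \<in> test_functions \<Omega>"
  shows "continuous_on UNIV \<phi>" "continuous_on UNIV (partial_deriv i \<phi>)"
  using test_function_smooth[OF assms] unfolding smooth_def by (metis Ck.simps)+

lemma test_function_support:
  assumes "\<phi> \<in> test_functions \<Omega>"
  obtains K where "compact K" "K \<subseteq> \<Omega>" "\<And>x. x \<notin> K \<Longrightarrow> \<phi> x = 0"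
    "\<And>x i. x \<notin> K \<Longrightarrow> partial_deriv i \<phi> x = 0"
proof -
  obtain K where K: "compact K" "K \<subseteq> \<Omega>" "\<And>x. x \<notin> K \<Longrightarrow> \<phi> x = 0"
    using assms by (auto simp: test_functions_def)
  have "partial_deriv i \<phi> x = 0" if "x \<notin> K" for x i
  proof -
    have "(\<phi> has_derivative (\<lambda>h. 0)) (at x)"
      by (rule has_derivative_transform_within_open[of "\<lambda>_. 0" _ _ _ "- K"])
        (use that K compact_imp_closed in \<open>auto intro: open_Compl\<close>)
    then show ?thesis by (simp add: partial_deriv_eq)
  qed
  then show ?thesis using that K by blast
qed

lemma test_function_bounded:
  assumes "\<phi> \<in> test_functions \<Omega>"
  shows "\<exists>B\<ge>0. \<forall>x. cmod (\<phi> x) \<le> B" "\<exists>B\<ge>0. \<forall>x. cmod (partial_deriv i \<phi> x) \<le> B"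
proof -
  obtain K where K: "compact K" "\<And>x. x \<notin> K \<Longrightarrow> \<phi> x = 0" "\<And>x i. x \<notin> K \<Longrightarrow> partial_deriv i \<phi> x = 0"
    using test_function_support[OF assms] by metis
  have *: "\<exists>B\<ge>0. \<forall>x. cmod (g x) \<le> B" if g: "continuous_on UNIV g" "\<And>x. x \<notin> K \<Longrightarrow> g x = 0" for g
  proof -
    have "bounded (g ` K)"
      using g(1) K(1) by (intro compact_imp_bounded compact_continuous_image)
        (auto intro: continuous_on_subset)
    then obtain B where B: "0 < B" "\<forall>x\<in>K. cmod (g x) \<le> B" by (auto simp: bounded_pos)
    then have "cmod (g x) \<le> B" for x using g(2)[of x] by (cases "x \<in> K") auto
    then show ?thesis using B by (intro exI[of _ B]) auto
  qed
  show "\<exists>B\<ge>0. \<forall>x. cmod (\<phi> x) \<le> B" "\<exists>B\<ge>0. \<forall>x. cmod (partial_deriv i \<phi> x) \<le> B"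
    using *[OF test_function_continuous(1)[OF assms] K(2)]
      *[OF test_function_continuous(2)[OF assms] K(3)] by auto
qed

section \<open>Integrals of derivatives of test functions\<close>

lemma integral_translate:
  fixes g :: "real^2 \<Rightarrow> complex"
  assumes "continuous_on UNIV g"
  shows "(\<integral>x. g (x + c) \<partial>lborel) = (\<integral>x. g x \<partial>lborel)"
proof -
  have "(\<integral>x. g x \<partial>lborel) = (\<integral>x. g x \<partial>distr lborel borel ((+) c))" by (simp add: lborel_distr_plus)
  also have "\<dots> = (\<integral>x. g (c + x) \<partial>lborel)"
    using assms by (intro integral_distr) (auto intro: borel_measurable_continuous_onI)
  finally show ?thesis by (simp add: add.commute)
qed

lemma integrable_bounded_support:
  fixes g :: "real^2 \<Rightarrow> complex"
  assumes g: "continuous_on UNIV g" and B: "\<And>x. cmod (g x) \<le> B * indicator (cball 0 R) x"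
  shows "integrable lborel g"
proof (rule Bochner_Integration.integrable_bound)
  show "integrable lborel (\<lambda>x. B * indicator (cball (0::real^2) R) x)"
    by (intro integrable_mult_right integrable_real_indicator) (use emeasure_bounded_finite[of "cball (0::real^2) _"] in auto)
  show "g \<in> borel_measurable lborel" using g by (simp add: borel_measurable_continuous_onI)
  show "AE x in lborel. norm (g x) \<le> norm (B * indicator (cball 0 R) x)"
    using B by (intro always_eventually allI) (smt (verit) real_norm_def)
qed

text \<open>Difference quotients integrate to zero by translation invariance, and dominated
  convergence passes to the derivative. This avoids Fubini and is what puts constants into
  H1.\<close>

lemma integral_partial_deriv_eq_0:
  assumes "\<phi> \<in> test_functions \<Omega>"
  shows "(\<integral>x. partial_deriv i \<phi> x \<partial>lborel) = 0"
proof -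
  obtain K where K: "compact K" "\<And>x. x \<notin> K \<Longrightarrow> \<phi> x = 0" "\<And>x i. x \<notin> K \<Longrightarrow> partial_deriv i \<phi> x = 0"
    using test_function_support[OF assms] by metis
  obtain R where R: "0 < R" "\<And>x. x \<in> K \<Longrightarrow> norm x \<le> R"
    using compact_imp_bounded[OF K(1)] by (auto simp: bounded_pos)
  obtain A where A: "0 \<le> A" "\<And>x. cmod (\<phi> x) \<le> A" using test_function_bounded(1)[OF assms] by blast
  obtain B where B: "0 \<le> B" "\<And>x. cmod (partial_deriv i \<phi> x) \<le> B"
    using test_function_bounded(2)[OF assms] by blast
  note cont = test_function_continuous[OF assms]
  let ?e = "axis i 1 :: real^2"
  define D where "D n x = (\<phi> (x + (1 / real (Suc n)) *\<^sub>R ?e) - \<phi> x) * of_nat (Suc n)" for n x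
  have line: "((\<lambda>t. \<phi> (x + t *\<^sub>R ?e)) has_vector_derivative partial_deriv i \<phi> (x + t *\<^sub>R ?e)) (at t within S)"
    for x t S
  proof -
    have "((\<lambda>t. \<phi> (x + t *\<^sub>R ?e)) has_derivative (\<lambda>h. frechet_derivative \<phi> (at (x + t *\<^sub>R ?e)) (h *\<^sub>R ?e))) (at t within S)"
      by (rule has_derivative_compose[OF _ test_function_has_derivative[OF assms]])
        (auto intro!: derivative_eq_intros)
    moreover have "frechet_derivative \<phi> (at y) (h *\<^sub>R ?e) = h *\<^sub>R partial_deriv i \<phi> y" for y h
      unfolding partial_deriv_def
      using has_derivative_linear[OF test_function_has_derivative[OF assms]] by (simp add: linear_cmul)
    ultimately show ?thesis by (simp add: has_vector_derivative_def)
  qed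
  have mvt: "cmod (\<phi> (x + s *\<^sub>R ?e) - \<phi> x) \<le> s * B" if "0 \<le> s" for x s
  proof -
    have "norm (\<phi> (x + s *\<^sub>R ?e) - \<phi> (x + 0 *\<^sub>R ?e)) \<le> B * norm (s - 0)"
    proof (rule differentiable_bound[OF convex_UNIV line[unfolded has_vector_derivative_def]])
      show "onorm (\<lambda>h. h *\<^sub>R partial_deriv i \<phi> (x + t *\<^sub>R ?e)) \<le> B" for t
        using B by (intro onorm_bound) (auto simp: mult.commute[of B] intro: mult_left_mono)
    qed auto
    then show ?thesis using that by (simp add: mult.commute)
  qed
  have "(\<lambda>n. \<integral>x. D n x \<partial>lborel) \<longlonglongrightarrow> (\<integral>x. partial_deriv i \<phi> x \<partial>lborel)"
  \<comment> \<open>Shifts have length at most 1, hence the radius \<open>R + 1\<close>; the height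
    \<open>B\<close> comes from the mean value inequality.\<close>
  proof (rule integral_dominated_convergence[where w = "\<lambda>x. B * indicator (cball 0 (R + 1)) x"])
    show "partial_deriv i \<phi> \<in> borel_measurable lborel"
      using cont(2) by (simp add: borel_measurable_continuous_onI)
    have "continuous_on UNIV (D n)" for n
      unfolding D_def by (intro continuous_intros continuous_on_compose2[OF cont(1)]) auto
    then show "D n \<in> borel_measurable lborel" for n by (simp add: borel_measurable_continuous_onI)
    show "integrable lborel (\<lambda>x. B * indicat_real (cball (0::real^2) (R + 1)) x)"
      by (intro integrable_mult_right integrable_real_indicator) (use emeasure_bounded_finite[of "cball (0::real^2) _"] in auto)
    show "AE x in lborel. (\<lambda>n. D n x) \<longlonglongrightarrow> partial_deriv i \<phi> x"
    proof (intro always_eventually allI)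
      fix x
      let ?r = "\<lambda>h. norm (\<phi> (x + h *\<^sub>R ?e) - \<phi> x - h *\<^sub>R partial_deriv i \<phi> x) / norm h"
      have "?r \<midarrow>0\<rightarrow> 0"
        using line[of x 0 UNIV] by (simp add: has_vector_derivative_def has_derivative_at)
      moreover have "filterlim (\<lambda>n. 1 / real (Suc n)) (at 0) sequentially"
        using LIMSEQ_Suc[OF lim_1_over_n] by (intro filterlim_atI) auto
      ultimately have "(\<lambda>n. ?r (1 / real (Suc n))) \<longlonglongrightarrow> 0" by (rule filterlim_compose)
      moreover have "?r (1 / real (Suc n)) = norm (D n x - partial_deriv i \<phi> x)" for n
      proof -
        have "D n x - partial_deriv i \<phi> x = (\<phi> (x + (1 / real (Suc n)) *\<^sub>R ?e) - \<phi> x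
            - (1 / real (Suc n)) *\<^sub>R partial_deriv i \<phi> x) * of_nat (Suc n)"
          unfolding D_def scaleR_conv_of_real by (simp add: left_diff_distrib del: of_nat_Suc)
        then show ?thesis by (simp add: norm_mult del: of_nat_Suc)
      qed
      ultimately show "(\<lambda>n. D n x) \<longlonglongrightarrow> partial_deriv i \<phi> x"
        by (simp only: tendsto_norm_zero_iff LIM_zero_iff)
    qed
    show "AE x in lborel. norm (D n x) \<le> B * indicat_real (cball 0 (R + 1)) x" for n
    proof (intro always_eventually allI)
      fix x :: "real^2"
      show "norm (D n x) \<le> B * indicat_real (cball 0 (R + 1)) x"
      proof (cases "norm x \<le> R + 1")
        case True
        have "norm (D n x) = cmod (\<phi> (x + (1 / real (Suc n)) *\<^sub>R ?e) - \<phi> x) * real (Suc n)"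
          unfolding D_def norm_mult norm_of_nat ..
        also have "\<dots> \<le> (1 / real (Suc n) * B) * real (Suc n)" by (intro mult_right_mono mvt) auto
        finally show ?thesis using True by simp
      next
        case False
        have "norm x \<le> norm (x + (1 / real (Suc n)) *\<^sub>R ?e) + norm ((1 / real (Suc n)) *\<^sub>R ?e)"
          using norm_triangle_ineq4[of "x + (1 / real (Suc n)) *\<^sub>R ?e" "(1 / real (Suc n)) *\<^sub>R ?e"] by simp
        moreover have "norm ((1 / real (Suc n)) *\<^sub>R ?e) \<le> 1" by simp
        ultimately have "x + (1 / real (Suc n)) *\<^sub>R ?e \<notin> K" "x \<notin> K"
          using False R(2)[of x] R(2)[of "x + (1 / real (Suc n)) *\<^sub>R ?e"] by linarith+
        then have "D n x = 0" by (simp add: D_def K(2))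
        then show ?thesis using B(1) by simp
      qed
    qed
  qed
  moreover have "(\<integral>x. D n x \<partial>lborel) = 0" for n
  proof -
    have "cmod (\<phi> x) \<le> A * indicator (cball 0 R) x" for x
      using A R(2)[of x] K(2)[of x] by (cases "x \<in> K") (auto simp: indicator_def)
    then have i1: "integrable lborel \<phi>" by (rule integrable_bounded_support[OF cont(1)])
    have "cmod (\<phi> (x + (1 / real (Suc n)) *\<^sub>R ?e)) \<le> A * indicator (cball 0 (R + 1)) x" for x
    proof (cases "norm x \<le> R + 1")
      case False
      have "norm x \<le> norm (x + (1 / real (Suc n)) *\<^sub>R ?e) + norm ((1 / real (Suc n)) *\<^sub>R ?e)"
        using norm_triangle_ineq4[of "x + (1 / real (Suc n)) *\<^sub>R ?e" "(1 / real (Suc n)) *\<^sub>R ?e"] by simp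
      moreover have "norm ((1 / real (Suc n)) *\<^sub>R ?e) \<le> 1" by simp
      ultimately have "x + (1 / real (Suc n)) *\<^sub>R ?e \<notin> K"
        using False R(2)[of "x + (1 / real (Suc n)) *\<^sub>R ?e"] by linarith
      then show ?thesis using A(1) by (simp add: K(2))
    qed (use A in auto)
    then have i2: "integrable lborel (\<lambda>x. \<phi> (x + (1 / real (Suc n)) *\<^sub>R ?e))"
      by (intro integrable_bounded_support[of _ A "R + 1"] continuous_on_compose2[OF cont(1)])
        (auto intro!: continuous_intros)
    show ?thesis unfolding D_def using i1 i2 integral_translate[OF cont(1)] by simp
  qed
  ultimately show ?thesis by (simp add: LIMSEQ_const_iff)
qed

section \<open>Weak derivatives on a bounded open set\<close>

locale bounded_open_set =
  fixes \<Omega> :: "(real^2) set"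
  assumes open_\<Omega>: "open \<Omega>" and bounded_\<Omega>: "bounded \<Omega>"
begin

abbreviation M :: "(real^2) measure" where "M \<equiv> lebesgue_on \<Omega>"

lemma finite_M: "finite_measure M"
  by (intro finite_measure_lebesgue_on lmeasurable_open open_\<Omega> bounded_\<Omega>)

lemma integrable_const_M: "integrable M (\<lambda>x. c :: 'b :: {banach, second_countable_topology})"
  using finite_measure.integrable_const[OF finite_M] .

lemma continuous_bounded_L2:
  assumes "continuous_on UNIV g" "\<And>x. cmod (g x) \<le> B"
  shows "g \<in> L2 M"
  unfolding L2_iff
proof
  have "g \<in> borel_measurable lebesgue"
    using assms(1) by (intro measurable_completion) (simp add: borel_measurable_continuous_onI)
  then show m: "g \<in> borel_measurable M" by (intro measurable_restrict_space1)
  show "integrable M (\<lambda>x. (cmod (g x))\<^sup>2)"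
  proof (rule Bochner_Integration.integrable_bound)
    show "integrable M (\<lambda>x. B\<^sup>2)" by (rule integrable_const_M)
    show "(\<lambda>x. (cmod (g x))\<^sup>2) \<in> borel_measurable M" using m by measurable
    show "AE x in M. norm ((cmod (g x))\<^sup>2) \<le> norm (B\<^sup>2)"
      using assms(2) by (intro always_eventually allI) (simp add: power_mono)
  qed
qed

lemma test_function_L2:
  assumes "\<phi> \<in> test_functions \<Omega>"
  shows "\<phi> \<in> L2 M" "partial_deriv i \<phi> \<in> L2 M"
  using test_function_bounded[OF assms] test_function_continuous[OF assms] continuous_bounded_L2
  by blast+

lemma L2_integrable: "g \<in> L2 M \<Longrightarrow> integrable M g"
  using L2_mult_integrable[of g M "\<lambda>_. 1"] continuous_bounded_L2[of "\<lambda>_. 1" 1] by simp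

text \<open>This renders the choice in \<open>weak_partial\<close> harmless. Rules are proved for
  the relation \<open>has_weak_partial\<close> and then transferred to the chosen derivative, where
  they hold almost everywhere only.\<close>

lemma weak_partial_unique:
  assumes "v \<in> L2 M" "w \<in> L2 M" "has_weak_partial \<Omega> i u v" "has_weak_partial \<Omega> i u w"
  shows "AE x in M. v x = w x"
proof -
  have "AE x in M. v x - w x = 0"
  proof (rule fundamental_lemma[OF open_\<Omega>])
    show "integrable M (\<lambda>x. v x - w x)" using assms L2_integrable by simp
    fix \<phi> assume p: "\<phi> \<in> test_functions \<Omega>"
    have "integrable M (\<lambda>x. v x * \<phi> x)" "integrable M (\<lambda>x. w x * \<phi> x)"
      using L2_mult_integrable test_function_L2[OF p] assms by auto
    then show "(\<integral>x. (v x - w x) * \<phi> x \<partial>M) = 0"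
      using assms(3,4) p by (simp add: left_diff_distrib has_weak_partial_def)
  qed
  then show ?thesis by simp
qed

lemma H1_weak_partial:
  assumes "u \<in> H1 \<Omega>"
  shows "weak_partial \<Omega> i u \<in> L2 M" "has_weak_partial \<Omega> i u (weak_partial \<Omega> i u)"
proof -
  have "\<exists>v. v \<in> L2 M \<and> has_weak_partial \<Omega> i u v" using assms by (auto simp: H1_def)
  then have "weak_partial \<Omega> i u \<in> L2 M \<and> has_weak_partial \<Omega> i u (weak_partial \<Omega> i u)"
    unfolding weak_partial_def by (rule someI_ex)
  then show "weak_partial \<Omega> i u \<in> L2 M" "has_weak_partial \<Omega> i u (weak_partial \<Omega> i u)" by auto
qed

lemma H1_L2: "u \<in> H1 \<Omega> \<Longrightarrow> u \<in> L2 M" by (simp add: H1_def)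

lemma weak_partial_AE:
  assumes "u \<in> H1 \<Omega>" "v \<in> L2 M" "has_weak_partial \<Omega> i u v"
  shows "AE x in M. weak_partial \<Omega> i u x = v x"
  using weak_partial_unique[OF H1_weak_partial(1)[OF assms(1)] assms(2) H1_weak_partial(2)[OF assms(1)] assms(3)] .

lemma has_weak_partial_add:
  assumes "u \<in> L2 M" "v \<in> L2 M" "u' \<in> L2 M" "v' \<in> L2 M"
    "has_weak_partial \<Omega> i u u'" "has_weak_partial \<Omega> i v v'"
  shows "has_weak_partial \<Omega> i (\<lambda>x. u x + v x) (\<lambda>x. u' x + v' x)"
  unfolding has_weak_partial_def
proof
  fix \<phi> assume p: "\<phi> \<in> test_functions \<Omega>"
  have "integrable M (\<lambda>x. u x * partial_deriv i \<phi> x)" "integrable M (\<lambda>x. v x * partial_deriv i \<phi> x)"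
    "integrable M (\<lambda>x. u' x * \<phi> x)" "integrable M (\<lambda>x. v' x * \<phi> x)"
    using L2_mult_integrable test_function_L2[OF p] assms by auto
  then show "(\<integral>x. (u x + v x) * partial_deriv i \<phi> x \<partial>M) = - (\<integral>x. (u' x + v' x) * \<phi> x \<partial>M)"
    using assms(5,6) p by (simp add: distrib_right has_weak_partial_def)
qed

lemma has_weak_partial_scale:
  "has_weak_partial \<Omega> i u u' \<Longrightarrow> has_weak_partial \<Omega> i (\<lambda>x. c * u x) (\<lambda>x. c * u' x)"
  unfolding has_weak_partial_def by (simp add: mult.assoc)

lemma H1_add:
  assumes "u \<in> H1 \<Omega>" "v \<in> H1 \<Omega>"
  shows "(\<lambda>x. u x + v x) \<in> H1 \<Omega>"
proof -
  have "\<exists>w\<in>L2 M. has_weak_partial \<Omega> i (\<lambda>x. u x + v x) w" for i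
    by (intro bexI[of _ "\<lambda>x. weak_partial \<Omega> i u x + weak_partial \<Omega> i v x"]
        has_weak_partial_add L2_add H1_L2 H1_weak_partial assms)
  then show ?thesis using L2_add[OF H1_L2[OF assms(1)] H1_L2[OF assms(2)]] by (simp add: H1_def)
qed

lemma H1_scale:
  assumes "u \<in> H1 \<Omega>"
  shows "(\<lambda>x. c * u x) \<in> H1 \<Omega>"
proof -
  have "\<exists>w\<in>L2 M. has_weak_partial \<Omega> i (\<lambda>x. c * u x) w" for i
    by (intro bexI[of _ "\<lambda>x. c * weak_partial \<Omega> i u x"]
        has_weak_partial_scale L2_scale H1_weak_partial assms)
  then show ?thesis using L2_scale[OF H1_L2[OF assms]] by (simp add: H1_def)
qed

lemma weak_partial_add:
  assumes "u \<in> H1 \<Omega>" "v \<in> H1 \<Omega>"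
  shows "AE x in M. weak_partial \<Omega> i (\<lambda>x. u x + v x) x = weak_partial \<Omega> i u x + weak_partial \<Omega> i v x"
  by (intro weak_partial_AE H1_add L2_add has_weak_partial_add H1_weak_partial H1_L2 assms)

lemma weak_partial_scale:
  assumes "u \<in> H1 \<Omega>"
  shows "AE x in M. weak_partial \<Omega> i (\<lambda>x. c * u x) x = c * weak_partial \<Omega> i u x"
  by (intro weak_partial_AE H1_scale L2_scale has_weak_partial_scale H1_weak_partial assms)

lemma weak_partial_diff:
  assumes "u \<in> H1 \<Omega>" "v \<in> H1 \<Omega>"
  shows "AE x in M. weak_partial \<Omega> i (\<lambda>x. u x - v x) x = weak_partial \<Omega> i u x - weak_partial \<Omega> i v x"
proof -
  have "AE x in M. weak_partial \<Omega> i (\<lambda>x. u x - v x) x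
      = weak_partial \<Omega> i u x + weak_partial \<Omega> i (\<lambda>x. - v x) x"
    using weak_partial_add[OF assms(1) H1_scale[OF assms(2), of "-1"], of i] by simp
  moreover have "AE x in M. weak_partial \<Omega> i (\<lambda>x. - v x) x = - weak_partial \<Omega> i v x"
    using weak_partial_scale[OF assms(2), of i "-1"] by simp
  ultimately show ?thesis by eventually_elim simp
qed

lemma L2_measurable: "g \<in> L2 N \<Longrightarrow> g \<in> borel_measurable N" by (simp add: L2_iff)

lemma op_S_form: "hermitian_form (H1 \<Omega>) (op_S \<Omega>)"
proof
  interpret L: hermitian_form "L2 M" "L2_inner M" by (rule L2_form)
  fix x y z :: "real^2 \<Rightarrow> complex" and c
  note W = H1_weak_partial(1) and m = H1_weak_partial(1)[THEN L2_measurable]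
  assume x: "x \<in> H1 \<Omega>"
  show "(\<lambda>t. c * x t) \<in> H1 \<Omega>" using x by (rule H1_scale)
  show "0 \<le> Re (op_S \<Omega> x x)" unfolding op_S_def by (simp add: L2_inner_self sum_nonneg)
  assume z: "z \<in> H1 \<Omega>"
  have "L2_inner M (weak_partial \<Omega> i (\<lambda>t. c * x t)) (weak_partial \<Omega> i z)
      = L2_inner M (\<lambda>t. c * weak_partial \<Omega> i x t) (weak_partial \<Omega> i z)" for i
    using weak_partial_scale[OF x] m[OF x] m[OF z] m[OF H1_scale[OF x]] by (intro L2_inner_cong) auto
  then show "op_S \<Omega> (\<lambda>t. c * x t) z = c * op_S \<Omega> x z"
    unfolding op_S_def sum_distrib_left using L.scale_left[OF W[OF x] W[OF z]] by simp
  assume y: "y \<in> H1 \<Omega>"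
  show xy: "(\<lambda>t. x t + y t) \<in> H1 \<Omega>" using x y by (rule H1_add)
  have "L2_inner M (weak_partial \<Omega> i (\<lambda>t. x t + y t)) (weak_partial \<Omega> i z)
      = L2_inner M (\<lambda>t. weak_partial \<Omega> i x t + weak_partial \<Omega> i y t) (weak_partial \<Omega> i z)" for i
    using weak_partial_add[OF x y] m[OF x] m[OF y] m[OF z] m[OF xy] by (intro L2_inner_cong) auto
  then show "op_S \<Omega> (\<lambda>t. x t + y t) z = op_S \<Omega> x z + op_S \<Omega> y z"
    unfolding op_S_def sum.distrib[symmetric] using L.add_left[OF W[OF x] W[OF y] W[OF z]] by simp
next
  interpret L: hermitian_form "L2 M" "L2_inner M" by (rule L2_form)
  fix x y :: "real^2 \<Rightarrow> complex"
  assume "x \<in> H1 \<Omega>" "y \<in> H1 \<Omega>"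
  then show "op_S \<Omega> x y = cnj (op_S \<Omega> y x)"
    unfolding op_S_def cnj_sum by (intro sum.cong refl L.hermitian H1_weak_partial)
qed

section \<open>The inner product of H1 and its completeness\<close>

definition H1_inner :: "(real^2 \<Rightarrow> complex) \<Rightarrow> (real^2 \<Rightarrow> complex) \<Rightarrow> complex" where
  "H1_inner u v = L2_inner M u v + op_S \<Omega> u v"

lemma H1_form: "hermitian_form (H1 \<Omega>) H1_inner"
proof -
  interpret L: hermitian_form "L2 M" "L2_inner M" by (rule L2_form)
  interpret S: hermitian_form "H1 \<Omega>" "op_S \<Omega>" by (rule op_S_form)
  show ?thesis
  proof
    fix x y z :: "real^2 \<Rightarrow> complex" and c
    assume x: "x \<in> H1 \<Omega>"
    show "(\<lambda>t. c * x t) \<in> H1 \<Omega>" using x by (rule H1_scale)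
    show "0 \<le> Re (H1_inner x x)"
      using L.nonneg[OF H1_L2[OF x]] S.nonneg[OF x] by (simp add: H1_inner_def)
    assume z: "z \<in> H1 \<Omega>"
    show "H1_inner (\<lambda>t. c * x t) z = c * H1_inner x z"
      using x z H1_L2 by (simp add: H1_inner_def L.scale_left S.scale_left distrib_left)
    assume y: "y \<in> H1 \<Omega>"
    show "(\<lambda>t. x t + y t) \<in> H1 \<Omega>" using x y by (rule H1_add)
    show "H1_inner (\<lambda>t. x t + y t) z = H1_inner x z + H1_inner y z"
      using x y z H1_L2 by (simp add: H1_inner_def L.add_left S.add_left)
  next
    fix x y :: "real^2 \<Rightarrow> complex"
    assume "x \<in> H1 \<Omega>" "y \<in> H1 \<Omega>"
    then show "H1_inner x y = cnj (H1_inner y x)"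
      using L.hermitian[of x y] S.hermitian[of x y] H1_L2 by (simp add: H1_inner_def)
  qed
qed

lemma H1_nrm: "hermitian_form.nrm H1_inner = H1_norm \<Omega>"
  by (simp add: hermitian_form.nrm_def[OF H1_form] H1_norm_def H1_inner_def op_S_def L2_norm_sq
      L2_inner_self fun_eq_iff)

lemma L2_norm_le_H1_norm: "L2_norm M u \<le> H1_norm \<Omega> u"
  unfolding H1_norm_def by (rule real_le_rsqrt) (simp add: sum_nonneg)

lemma L2_norm_weak_partial_le: "L2_norm M (weak_partial \<Omega> i u) \<le> H1_norm \<Omega> u"
proof -
  have "(L2_norm M (weak_partial \<Omega> i u))\<^sup>2 \<le> (\<Sum>i\<in>UNIV. (L2_norm M (weak_partial \<Omega> i u))\<^sup>2)"
    by (rule member_le_sum) auto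
  then show ?thesis unfolding H1_norm_def by (intro real_le_rsqrt) (simp add: add_increasing)
qed

lemma H1_norm_nonneg: "0 \<le> H1_norm \<Omega> u"
  by (simp add: H1_norm_def sum_nonneg)

text \<open>Both sides of the defining identity are pairings with a fixed L2 function, hence
  continuous in the L2 norm.\<close>

lemma has_weak_partial_limit:
  assumes X: "\<And>n. X n \<in> L2 M" "\<And>n. Y n \<in> L2 M" "\<And>n. has_weak_partial \<Omega> i (X n) (Y n)"
    and u: "u \<in> L2 M" "(\<lambda>n. L2_norm M (\<lambda>x. X n x - u x)) \<longlonglongrightarrow> 0"
    and v: "v \<in> L2 M" "(\<lambda>n. L2_norm M (\<lambda>x. Y n x - v x)) \<longlonglongrightarrow> 0"
  shows "has_weak_partial \<Omega> i u v"
  unfolding has_weak_partial_def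
proof
  interpret L: hermitian_form "L2 M" "L2_inner M" by (rule L2_form)
  have lim: "(\<lambda>n. \<integral>x. X n x * p x \<partial>M) \<longlonglongrightarrow> (\<integral>x. u x * p x \<partial>M)"
    if X: "\<And>n. X n \<in> L2 M" and u: "u \<in> L2 M" "(\<lambda>n. L2_norm M (\<lambda>x. X n x - u x)) \<longlonglongrightarrow> 0" and p: "p \<in> L2 M"
    for X u p
  proof -
    \<comment> \<open>The conjugate turns the bilinear integral into \<open>L2_inner\<close>, for
      which Cauchy-Schwarz is available.\<close>
    let ?q = "\<lambda>x. cnj (p x)"
    have q: "?q \<in> L2 M" using p by (rule L2_cnj)
    have "cmod (L2_inner M (X n) ?q - L2_inner M u ?q) \<le> L2_norm M (\<lambda>x. X n x - u x) * L2_norm M ?q" for n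
      using L.cauchy_schwarz[OF L.diff_closed[OF X u(1)] q, of n]
      by (simp add: L.diff_left[OF X u(1) q] L2_nrm)
    moreover have "(\<lambda>n. L2_norm M (\<lambda>x. X n x - u x) * L2_norm M ?q) \<longlonglongrightarrow> 0"
      using tendsto_mult_right[OF u(2)] by simp
    ultimately have "(\<lambda>n. L2_inner M (X n) ?q - L2_inner M u ?q) \<longlonglongrightarrow> 0"
      by (rule Lim_null_comparison[OF always_eventually[OF allI]])
    then show ?thesis by (simp add: LIM_zero_iff L2_inner_def)
  qed
  fix \<phi> assume p: "\<phi> \<in> test_functions \<Omega>"
  have "(\<lambda>n. \<integral>x. X n x * partial_deriv i \<phi> x \<partial>M) \<longlonglongrightarrow> (\<integral>x. u x * partial_deriv i \<phi> x \<partial>M)"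
    by (intro lim X u test_function_L2 p)
  moreover have "(\<lambda>n. - (\<integral>x. Y n x * \<phi> x \<partial>M)) \<longlonglongrightarrow> - (\<integral>x. v x * \<phi> x \<partial>M)"
    by (intro tendsto_minus lim X v test_function_L2 p)
  moreover have "(\<integral>x. X n x * partial_deriv i \<phi> x \<partial>M) = - (\<integral>x. Y n x * \<phi> x \<partial>M)" for n
    using X(3) p by (simp add: has_weak_partial_def)
  ultimately show "(\<integral>x. u x * partial_deriv i \<phi> x \<partial>M) = - (\<integral>x. v x * \<phi> x \<partial>M)"
    by (metis (no_types, lifting) LIMSEQ_unique ext)
qed

text \<open>The functions and each of their weak derivatives converge in L2 separately; closedness
  of the weak derivative identifies the limits.\<close>

lemma H1_complete:
  assumes X: "\<And>n. X n \<in> H1 \<Omega>"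
    and fast: "\<And>n. H1_norm \<Omega> (\<lambda>t. X (Suc n) t - X n t) \<le> (1/4)^n"
  shows "\<exists>x\<in>H1 \<Omega>. (\<lambda>n. H1_norm \<Omega> (\<lambda>t. X n t - x t)) \<longlonglongrightarrow> 0"
proof -
  interpret H: hermitian_form "H1 \<Omega>" H1_inner by (rule H1_form)
  interpret L: hermitian_form "L2 M" "L2_inner M" by (rule L2_form)
  let ?W = "weak_partial \<Omega>"
  have W: "?W i (X n) \<in> L2 M" for i n using H1_weak_partial(1)[OF X] .
  \<comment> \<open>The derivative chosen for a difference need not be the difference of the chosen
    derivatives, but their norms agree.\<close>
  have Wd: "L2_norm M (\<lambda>t. ?W i (X n) t - ?W i (X m) t) = L2_norm M (?W i (\<lambda>t. X n t - X m t))" for i n m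
    using weak_partial_diff[OF X X, of i n m] H1_weak_partial(1)[OF H.diff_closed[OF X X], of i n m]
      L.diff_closed[OF W W, of i n i m]
    by (intro L2_norm_cong L2_measurable) (auto elim: eventually_mono)
  have "\<exists>u\<in>L2 M. (\<lambda>n. L2_norm M (\<lambda>x. X n x - u x)) \<longlonglongrightarrow> 0"
    by (intro L2_complete H1_L2 X order_trans[OF L2_norm_le_H1_norm fast])
  then obtain u where u: "u \<in> L2 M" "(\<lambda>n. L2_norm M (\<lambda>x. X n x - u x)) \<longlonglongrightarrow> 0" by blast
  have "\<exists>v\<in>L2 M. (\<lambda>n. L2_norm M (\<lambda>x. ?W i (X n) x - v x)) \<longlonglongrightarrow> 0" for i
    by (intro L2_complete W) (simp only: Wd order_trans[OF L2_norm_weak_partial_le fast])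
  then have "\<exists>v. \<forall>i. v i \<in> L2 M \<and> (\<lambda>n. L2_norm M (\<lambda>x. ?W i (X n) x - v i x)) \<longlonglongrightarrow> 0"
    by (intro choice) blast
  then obtain v where v: "\<And>i. v i \<in> L2 M" "\<And>i. (\<lambda>n. L2_norm M (\<lambda>x. ?W i (X n) x - v i x)) \<longlonglongrightarrow> 0"
    by blast
  have wp: "has_weak_partial \<Omega> i u (v i)" for i
    by (rule has_weak_partial_limit[OF H1_L2[OF X] W H1_weak_partial(2)[OF X] u v])
  then have uH: "u \<in> H1 \<Omega>" using u(1) v(1) by (auto simp: H1_def)
  have "L2_norm M (?W i (\<lambda>t. X n t - u t)) = L2_norm M (\<lambda>x. ?W i (X n) x - v i x)" for i n
  proof (intro L2_norm_cong L2_measurable L.diff_closed W v H1_weak_partial H.diff_closed X uH)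
    show "AE x in M. ?W i (\<lambda>t. X n t - u t) x = ?W i (X n) x - v i x"
      using weak_partial_diff[OF X uH, of i n] weak_partial_AE[OF uH v(1) wp, of i]
      by eventually_elim simp
  qed
  then have "H1_norm \<Omega> (\<lambda>t. X n t - u t) = sqrt ((L2_norm M (\<lambda>x. X n x - u x))\<^sup>2
      + (\<Sum>i\<in>UNIV. (L2_norm M (\<lambda>x. ?W i (X n) x - v i x))\<^sup>2))" for n
    by (simp add: H1_norm_def)
  moreover have "(\<lambda>n. sqrt ((L2_norm M (\<lambda>x. X n x - u x))\<^sup>2
      + (\<Sum>i\<in>UNIV. (L2_norm M (\<lambda>x. ?W i (X n) x - v i x))\<^sup>2))) \<longlonglongrightarrow> sqrt (0\<^sup>2 + (\<Sum>i\<in>(UNIV::2 set). 0\<^sup>2))"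
    by (intro tendsto_intros u v)
  ultimately show ?thesis using uH by (intro bexI[of _ u]) auto
qed

lemma H1_complete_form: "complete_hermitian_form (H1 \<Omega>) H1_inner"
  unfolding complete_hermitian_form_def complete_hermitian_form_axioms_def H1_nrm
  using H1_form H1_complete by blast

text \<open>Constants provide an element of H1 for \<open>hellinger_toeplitz\<close> and the
  function 1 by which an integrand is perturbed in \<open>weight_square_integrable\<close>. As test
  functions are supported in \<open>\<Omega>\<close>, the integral may be taken over the
  plane.\<close>

lemma const_H1: "(\<lambda>x. c) \<in> H1 \<Omega>"
proof -
  have "has_weak_partial \<Omega> i (\<lambda>x. c) (\<lambda>x. 0)" for i
    unfolding has_weak_partial_def
  proof
    fix \<phi> assume p: "\<phi> \<in> test_functions \<Omega>"
    obtain K where K: "K \<subseteq> \<Omega>" "\<And>x i. x \<notin> K \<Longrightarrow> partial_deriv i \<phi> x = 0"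
      using test_function_support[OF p] by metis
    have "(\<integral>x. partial_deriv i \<phi> x \<partial>M) = (\<integral>x. indicator \<Omega> x *\<^sub>R partial_deriv i \<phi> x \<partial>lebesgue)"
      using open_\<Omega> by (simp add: integral_restrict_space)
    also have "\<dots> = (\<integral>x. partial_deriv i \<phi> x \<partial>lebesgue)"
      using K by (intro Bochner_Integration.integral_cong refl) (auto simp: indicator_def)
    also have "\<dots> = (\<integral>x. partial_deriv i \<phi> x \<partial>lborel)"
      using test_function_continuous(2)[OF p] by (intro integral_completion) (simp add: borel_measurable_continuous_onI)
    also have "\<dots> = 0" by (rule integral_partial_deriv_eq_0[OF p])
    finally show "(\<integral>x. c * partial_deriv i \<phi> x \<partial>M) = - (\<integral>x. 0 * \<phi> x \<partial>M)" by simp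
  qed
  moreover have "(\<lambda>x. c) \<in> L2 M" "(\<lambda>x. 0) \<in> L2 M"
    by (rule continuous_bounded_L2[of _ "cmod c"]; simp)+
  ultimately show ?thesis by (auto simp: H1_def)
qed

end

section \<open>Boundedness of the boundary form and of the weighted forms\<close>

context bounded_open_set
begin

lemma antidual_lincomb:
  assumes "F \<in> antidual \<Omega>" "G \<in> antidual \<Omega>"
  shows "(\<lambda>\<phi>. a * F \<phi> + c * G \<phi>) \<in> antidual \<Omega>"
proof -
  obtain A B where AB: "\<And>\<phi>. \<phi> \<in> H1 \<Omega> \<Longrightarrow> cmod (F \<phi>) \<le> A * H1_norm \<Omega> \<phi>"
    "\<And>\<phi>. \<phi> \<in> H1 \<Omega> \<Longrightarrow> cmod (G \<phi>) \<le> B * H1_norm \<Omega> \<phi>"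
    using assms unfolding antidual_def by blast
  have "cmod (a * F \<phi> + c * G \<phi>) \<le> (cmod a * A + cmod c * B) * H1_norm \<Omega> \<phi>" if "\<phi> \<in> H1 \<Omega>" for \<phi>
  proof -
    have "cmod (a * F \<phi> + c * G \<phi>) \<le> cmod a * cmod (F \<phi>) + cmod c * cmod (G \<phi>)"
      by (metis norm_mult norm_triangle_ineq)
    also have "\<dots> \<le> cmod a * (A * H1_norm \<Omega> \<phi>) + cmod c * (B * H1_norm \<Omega> \<phi>)"
      by (intro add_mono mult_left_mono AB that) auto
    finally show ?thesis by (simp add: algebra_simps)
  qed
  then have "\<exists>C. \<forall>\<phi>\<in>H1 \<Omega>. cmod (a * F \<phi> + c * G \<phi>) \<le> C * H1_norm \<Omega> \<phi>" by blast
  moreover have "a * F (\<lambda>x. \<phi> x + \<psi> x) + c * G (\<lambda>x. \<phi> x + \<psi> x) = (a * F \<phi> + c * G \<phi>) + (a * F \<psi> + c * G \<psi>)"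
    if "\<phi> \<in> H1 \<Omega>" "\<psi> \<in> H1 \<Omega>" for \<phi> \<psi>
    using assms that by (simp add: antidual_def algebra_simps)
  moreover have "a * F (\<lambda>x. d * \<phi> x) + c * G (\<lambda>x. d * \<phi> x) = cnj d * (a * F \<phi> + c * G \<phi>)"
    if "\<phi> \<in> H1 \<Omega>" for \<phi> d
    using assms that by (simp add: antidual_def algebra_simps)
  ultimately show ?thesis unfolding antidual_def by blast
qed

lemma op_S_antidual:
  assumes y: "y \<in> H1 \<Omega>"
  shows "op_S \<Omega> y \<in> antidual \<Omega>"
proof -
  interpret S: hermitian_form "H1 \<Omega>" "op_S \<Omega>" by (rule op_S_form)
  have le: "S.nrm \<phi> \<le> H1_norm \<Omega> \<phi>" for \<phi>
    unfolding S.nrm_def H1_norm_def op_S_def by (simp add: L2_inner_self L2_norm_sq)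
  have "cmod (op_S \<Omega> y \<phi>) \<le> S.nrm y * H1_norm \<Omega> \<phi>" if "\<phi> \<in> H1 \<Omega>" for \<phi>
    using S.cauchy_schwarz[OF y that] mult_left_mono[OF le[of \<phi>] S.nrm_nonneg[OF y]] by linarith
  then show ?thesis using S.add_right[OF _ _ y] S.scale_right[OF _ y] by (auto simp: antidual_def)
qed

text \<open>A Hermitian expression whose sections lie in the anti-dual is automatically sesquilinear, and
  then bounded by the theorem of Hellinger and Toeplitz.\<close>

lemma hermitian_form_if_antidual:
  assumes ad: "\<And>y. y \<in> H1 \<Omega> \<Longrightarrow> c y \<in> antidual \<Omega>"
    and herm: "\<And>y z. c y z = cnj (c z y)"
    and pos: "\<And>y. y \<in> H1 \<Omega> \<Longrightarrow> 0 \<le> Re (c y y)"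
  shows "hermitian_form (H1 \<Omega>) c"
proof
  fix x y z :: "real^2 \<Rightarrow> complex" and d
  assume x: "x \<in> H1 \<Omega>"
  show "(\<lambda>t. d * x t) \<in> H1 \<Omega>" using x by (rule H1_scale)
  show "0 \<le> Re (c x x)" using x by (rule pos)
  assume z: "z \<in> H1 \<Omega>"
  have "c z (\<lambda>t. d * x t) = cnj d * c z x" using ad[OF z] x by (simp add: antidual_def)
  then show "c (\<lambda>t. d * x t) z = d * c x z"
    using herm[of "\<lambda>t. d * x t" z] herm[of x z] by simp
  assume y: "y \<in> H1 \<Omega>"
  show "(\<lambda>t. x t + y t) \<in> H1 \<Omega>" using x y by (rule H1_add)
  have "c z (\<lambda>t. x t + y t) = c z x + c z y" using ad[OF z] x y by (simp add: antidual_def)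
  then show "c (\<lambda>t. x t + y t) z = c x z + c y z"
    using herm[of "\<lambda>t. x t + y t" z] herm[of x z] herm[of y z] by simp
qed (rule herm)

lemma bounded_if_antidual:
  assumes ad: "\<And>y. y \<in> H1 \<Omega> \<Longrightarrow> c y \<in> antidual \<Omega>"
    and herm: "\<And>y z. c y z = cnj (c z y)"
    and pos: "\<And>y. y \<in> H1 \<Omega> \<Longrightarrow> 0 \<le> Re (c y y)"
  shows "\<exists>C\<ge>0. \<forall>y\<in>H1 \<Omega>. Re (c y y) \<le> C * (H1_norm \<Omega> y)\<^sup>2"
proof -
  interpret H: complete_hermitian_form "H1 \<Omega>" H1_inner by (rule H1_complete_form)
  have "\<exists>C\<ge>0. \<forall>y\<in>H1 \<Omega>. Re (c y y) \<le> C * (H.nrm y)\<^sup>2"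
  proof (rule H.hellinger_toeplitz[of c])
    show "hermitian_form (H1 \<Omega>) c" using assms by (rule hermitian_form_if_antidual)
    show "\<exists>C. \<forall>z\<in>H1 \<Omega>. cmod (c y z) \<le> C * H.nrm z" if "y \<in> H1 \<Omega>" for y
      using ad[OF that] by (auto simp: antidual_def H1_nrm)
  qed (rule const_H1)
  then show ?thesis by (simp only: H1_nrm)
qed

end

lemma op_B_hermitian: "op_B \<Omega> y z = cnj (op_B \<Omega> z y)"
  unfolding op_B_def by (rule L2_inner_hermitian)

lemma op_B_nonneg: "0 \<le> Re (op_B \<Omega> y y)"
  by (simp add: op_B_def L2_inner_self)

lemma op_M_hermitian: "op_M \<Omega> m y z = cnj (op_M \<Omega> m z y)"
  unfolding op_M_def L2_inner_def
    Bochner_Integration.integral_cnj[symmetric, of _ "\<lambda>t. complex_of_real (m t) * z t * cnj (y t)"]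
  by (intro Bochner_Integration.integral_cong refl) (simp add: mult_ac)

lemma op_M_self: "op_M \<Omega> m y y = complex_of_real (\<integral>x. m x * (cmod (y x))\<^sup>2 \<partial>lebesgue_on \<Omega>)"
  unfolding op_M_def L2_inner_def mult.assoc complex_norm_square[symmetric] of_real_mult[symmetric]
  by (rule integral_complex_of_real)

text \<open>The exponent \<open>P\<close> is universally quantified, independently of the exponent
  of the given potentials. This permits later arguments with weights in \<open>L^P\<close> for P
  strictly below p.\<close>

locale impedance_problem = bounded_open_set +
  fixes k :: real
  assumes k_pos: "0 < k"
    and op_antidual: "\<And>P r y. 2 < P \<Longrightarrow> r \<in> potentials P \<Omega> \<Longrightarrow> y \<in> H1 \<Omega> \<Longrightarrow> helmholtz_op \<Omega> k r y \<in> antidual \<Omega>"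
begin

lemma helmholtz_op_minus_1: "helmholtz_op \<Omega> k (\<lambda>x. -1) y \<phi> = op_S \<Omega> y \<phi> - \<i> * complex_of_real k * op_B \<Omega> y \<phi>"
  by (simp add: helmholtz_op_def op_M_def L2_inner_def)

lemma helmholtz_op_minus_1_antidual:
  assumes "y \<in> H1 \<Omega>"
  shows "helmholtz_op \<Omega> k (\<lambda>x. -1) y \<in> antidual \<Omega>"
proof (rule op_antidual[OF _ _ assms])
  show "(\<lambda>x. -1) \<in> potentials \<infinity> \<Omega>" by (auto simp: potentials_def Lp_def)
qed (simp add: numeral_eq_ereal)

text \<open>The potential -1 cancels the mass term, so the boundary form is a combination of the
  Helmholtz operator and the gradient form. Its antilinearity and bounds are read off from there;
  existence and linearity of the chosen trace are never examined.\<close>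

lemma op_B_antidual:
  assumes y: "y \<in> H1 \<Omega>"
  shows "op_B \<Omega> y \<in> antidual \<Omega>"
proof -
  have "op_B \<Omega> y = (\<lambda>\<phi>. (1 / (\<i> * complex_of_real k)) * op_S \<Omega> y \<phi>
      + (- 1 / (\<i> * complex_of_real k)) * helmholtz_op \<Omega> k (\<lambda>x. -1) y \<phi>)"
    using k_pos by (simp add: fun_eq_iff helmholtz_op_minus_1 field_simps)
  then show ?thesis
    using antidual_lincomb[OF op_S_antidual[OF y] helmholtz_op_minus_1_antidual[OF y]] by (simp only:)
qed

lemma op_B_form: "hermitian_form (H1 \<Omega>) (op_B \<Omega>)"
  by (intro hermitian_form_if_antidual op_B_antidual op_B_hermitian op_B_nonneg)

lemma op_B_bounded: "\<exists>C\<ge>0. \<forall>y\<in>H1 \<Omega>. Re (op_B \<Omega> y y) \<le> C * (H1_norm \<Omega> y)\<^sup>2"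
  by (intro bounded_if_antidual op_B_antidual op_B_hermitian op_B_nonneg)

text \<open>\<open>m\<close> stands for \<open>1 + r\<close>, so its sign condition is the
  constraint \<open>-1 \<le> r\<close>.\<close>

definition weight :: "real \<Rightarrow> (real^2 \<Rightarrow> real) \<Rightarrow> bool" where
  "weight P m \<longleftrightarrow> m \<in> borel_measurable M \<and> (AE x in M. 0 \<le> m x) \<and> integrable M (\<lambda>x. m x powr P)"

context
  fixes P :: real and m :: "real^2 \<Rightarrow> real"
  assumes P: "2 < P" and m: "weight P m"
begin

lemma weight_potential: "(\<lambda>x. m x - 1) \<in> potentials (ereal P) \<Omega>"
proof -
  have [measurable]: "m \<in> borel_measurable M" using m by (simp add: weight_def)
  have "integrable M (\<lambda>x. \<bar>m x - 1\<bar> powr P)"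
  proof (rule Bochner_Integration.integrable_bound)
    show "integrable M (\<lambda>x. m x powr P + 1)"
      using m integrable_const_M[of "1::real"] by (auto simp: weight_def)
    have "\<bar>t - 1\<bar> powr P \<le> t powr P + 1" if "0 \<le> t" for t
    proof (cases "t \<le> 1")
      case True
      then have "\<bar>t - 1\<bar> powr P \<le> 1 powr P" using that P by (intro powr_mono2) auto
      then show ?thesis using powr_ge_zero[of t P] unfolding powr_one_eq_one by linarith
    next
      case False
      then have "\<bar>t - 1\<bar> powr P \<le> t powr P" using P by (intro powr_mono2) auto
      then show ?thesis by simp
    qed
    then show "AE x in M. norm (\<bar>m x - 1\<bar> powr P) \<le> norm (m x powr P + 1)"
      using m unfolding weight_def by (auto elim!: eventually_mono)
  qed measurable
  then show ?thesis using m
    by (auto simp: potentials_def Lp_def weight_def cmod_def elim: eventually_mono)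
qed

text \<open>The potentials \<open>m - 1\<close> and -1 are both admissible, and their Helmholtz
  operators differ by \<open>k\<^sup>2\<close> times the mass form of \<open>m\<close>
  alone.\<close>

lemma op_M_antidual:
  assumes y: "y \<in> H1 \<Omega>"
  shows "op_M \<Omega> m y \<in> antidual \<Omega>"
proof -
  have h: "helmholtz_op \<Omega> k (\<lambda>x. m x - 1) y \<phi>
      = helmholtz_op \<Omega> k (\<lambda>x. -1) y \<phi> - complex_of_real (k\<^sup>2) * op_M \<Omega> m y \<phi>" for \<phi>
    unfolding helmholtz_op_minus_1 by (simp add: helmholtz_op_def)
  have "op_M \<Omega> m y = (\<lambda>\<phi>. (1 / complex_of_real (k\<^sup>2)) * helmholtz_op \<Omega> k (\<lambda>x. -1) y \<phi>
      + (- 1 / complex_of_real (k\<^sup>2)) * helmholtz_op \<Omega> k (\<lambda>x. m x - 1) y \<phi>)"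
    using k_pos by (simp add: fun_eq_iff h field_simps)
  moreover have "helmholtz_op \<Omega> k (\<lambda>x. m x - 1) y \<in> antidual \<Omega>"
    using P by (intro op_antidual[OF _ weight_potential y]) (simp add: numeral_eq_ereal)
  ultimately show ?thesis using antidual_lincomb[OF helmholtz_op_minus_1_antidual[OF y]] by (simp only:)
qed

lemma op_M_nonneg: "0 \<le> Re (op_M \<Omega> m y y)"
  using m by (auto simp: op_M_self weight_def intro!: integral_nonneg_AE elim: eventually_mono)

lemma op_M_form: "hermitian_form (H1 \<Omega>) (op_M \<Omega> m)"
  by (intro hermitian_form_if_antidual op_M_antidual op_M_hermitian op_M_nonneg)

lemma weight_le: "0 \<le> t \<Longrightarrow> t \<le> 1 + t powr P"
proof (cases "t \<le> 1")
  case False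
  then have "t powr 1 \<le> t powr P" using P by (intro powr_mono) auto
  then show ?thesis using False by simp
qed (simp add: add_increasing2)

lemma weight_integrable: "integrable M m"
proof (rule Bochner_Integration.integrable_bound)
  show "integrable M (\<lambda>x. 1 + m x powr P)"
    using m integrable_const_M[of "1::real"] by (auto simp: weight_def)
  show "m \<in> borel_measurable M" using m by (simp add: weight_def)
  show "AE x in M. norm (m x) \<le> norm (1 + m x powr P)"
    using m weight_le unfolding weight_def by (auto elim!: eventually_mono)
qed

text \<open>If \<open>m |y|\<^sup>2\<close> were not integrable, neither would be \<open>m |y \<plusminus> 1|\<^sup>2\<close>; the three Bochner integrals
  would then have the junk value \<open>0\<close> and the parallelogram law would force \<open>\<integral> m = 0\<close>.\<close>

lemma weight_square_integrable:
  assumes y: "y \<in> H1 \<Omega>"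
  shows "integrable M (\<lambda>x. m x * (cmod (y x))\<^sup>2)"
proof (rule ccontr)
  assume ni: "\<not> ?thesis"
  interpret b: hermitian_form "H1 \<Omega>" "op_M \<Omega> m" by (rule op_M_form)
  have mm [measurable]: "m \<in> borel_measurable M" and m0: "AE x in M. 0 \<le> m x" using m by (auto simp: weight_def)
  have ym [measurable]: "y \<in> borel_measurable M" using y H1_L2 L2_measurable by blast
  have ni': "\<not> integrable M (\<lambda>x. m x * (cmod (y x + c))\<^sup>2)" if c: "cmod c = 1" for c
  proof
    assume i: "integrable M (\<lambda>x. m x * (cmod (y x + c))\<^sup>2)"
    have "integrable M (\<lambda>x. m x * (cmod (y x))\<^sup>2)"
    proof (rule Bochner_Integration.integrable_bound)
      show "integrable M (\<lambda>x. 2 * (m x * (cmod (y x + c))\<^sup>2) + 2 * m x)" using i weight_integrable by auto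
      have le: "(cmod a)\<^sup>2 \<le> 2 * (cmod (a + c))\<^sup>2 + 2" for a
      proof -
        have "cmod a \<le> cmod (a + c) + 1" using norm_triangle_ineq4[of "a + c" c] c by simp
        then have "(cmod a)\<^sup>2 \<le> (cmod (a + c) + 1)\<^sup>2" by (intro power_mono) auto
        then show ?thesis using sum_squares_bound[of "cmod (a + c)" 1] by (simp add: power2_sum)
      qed
      show "AE x in M. norm (m x * (cmod (y x))\<^sup>2) \<le> norm (2 * (m x * (cmod (y x + c))\<^sup>2) + 2 * m x)"
        using m0
      proof eventually_elim
        case (elim x)
        have "m x * (cmod (y x))\<^sup>2 \<le> m x * (2 * (cmod (y x + c))\<^sup>2 + 2)" using elim le by (rule mult_left_mono[rotated])
        then show ?case using elim by (simp add: algebra_simps abs_mult)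
      qed
    qed measurable
    then show False using ni by simp
  qed
  have z: "Re (op_M \<Omega> m (\<lambda>x. y x + 1) (\<lambda>x. y x + 1)) = 0" "Re (op_M \<Omega> m (\<lambda>x. y x - 1) (\<lambda>x. y x - 1)) = 0"
    "Re (op_M \<Omega> m y y) = 0"
    using ni'[of 1] ni'[of "-1"] ni by (simp_all add: op_M_self not_integrable_integral_eq)
  have "Re (op_M \<Omega> m (\<lambda>x. 1) (\<lambda>x. 1)) = 0" using b.parallelogram[OF y const_H1[of 1]] z by simp
  then have "(\<integral>x. m x \<partial>M) = 0" by (simp add: op_M_self)
  then have "AE x in M. m x = 0" using integral_nonneg_eq_0_iff_AE[OF weight_integrable m0] by simp
  then have "AE x in M. m x * (cmod (y x))\<^sup>2 = 0" by eventually_elim simp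
  then have "integrable M (\<lambda>x. m x * (cmod (y x))\<^sup>2) \<longleftrightarrow> integrable M (\<lambda>x. 0 :: real)"
    by (intro integrable_cong_AE) auto
  then show False using ni by simp
qed

theorem weight_bounded:
  "\<exists>C\<ge>0. \<forall>y\<in>H1 \<Omega>. (\<integral>x. m x * (cmod (y x))\<^sup>2 \<partial>M) \<le> C * (H1_norm \<Omega> y)\<^sup>2"
  using bounded_if_antidual[of "op_M \<Omega> m", OF op_M_antidual op_M_hermitian op_M_nonneg]
  by (simp add: op_M_self)

end

end

section \<open>Compactness of the embedding into the square integrable functions\<close>

text \<open>Hellinger and Toeplitz bound the diagonal; Cauchy-Schwarz for \<open>c\<close> extends
  this to all pairs with the same constant.\<close>

lemma (in hermitian_form) bounded_form_le:
  assumes c: "hermitian_form V c" and C: "0 \<le> C" "\<And>y. y \<in> V \<Longrightarrow> Re (c y y) \<le> C * (nrm y)\<^sup>2"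
    and x: "x \<in> V" and y: "y \<in> V"
  shows "cmod (c x y) \<le> C * nrm x * nrm y"
proof -
  interpret c: hermitian_form V c by fact
  have le: "c.nrm z \<le> sqrt C * nrm z" if "z \<in> V" for z
    unfolding c.nrm_def using real_sqrt_le_mono[OF C(2)[OF that]] nrm_nonneg[OF that]
    by (simp add: real_sqrt_mult)
  have "cmod (c x y) \<le> c.nrm x * c.nrm y" by (rule c.cauchy_schwarz[OF x y])
  also have "\<dots> \<le> (sqrt C * nrm x) * (sqrt C * nrm y)"
    using C(1) by (intro mult_mono le x y c.nrm_nonneg mult_nonneg_nonneg nrm_nonneg) auto
  also have "\<dots> = (sqrt C * sqrt C) * nrm x * nrm y" by (simp add: mult_ac)
  finally show ?thesis using C(1) by simp
qed

context impedance_problem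
begin

lemma helmholtz_op_diff:
  assumes w: "2 < P" "weight P (\<lambda>x. 1 + r x)" and y: "y \<in> H1 \<Omega>" and z: "z \<in> H1 \<Omega>" and \<phi>: "\<phi> \<in> H1 \<Omega>"
  shows "helmholtz_op \<Omega> k r (\<lambda>x. y x - z x) \<phi> = helmholtz_op \<Omega> k r y \<phi> - helmholtz_op \<Omega> k r z \<phi>"
proof -
  note S = hermitian_form.diff_left[OF op_S_form y z \<phi>]
  note B = hermitian_form.diff_left[OF op_B_form y z \<phi>]
  note M = hermitian_form.diff_left[OF op_M_form[OF w] y z \<phi>]
  show ?thesis by (simp add: helmholtz_op_def S B M algebra_simps)
qed

lemma weight_1: "weight 3 (\<lambda>x. 1)"
  using integrable_const_M[of "1::real"] by (simp add: weight_def)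

lemma helmholtz_op_0_bounded:
  "\<exists>C\<ge>0. \<forall>y\<in>H1 \<Omega>. \<forall>z\<in>H1 \<Omega>. cmod (helmholtz_op \<Omega> k (\<lambda>x. 0) y z) \<le> C * H1_norm \<Omega> y * H1_norm \<Omega> z"
proof -
  interpret H: hermitian_form "H1 \<Omega>" H1_inner by (rule H1_form)
  interpret L: hermitian_form "L2 M" "L2_inner M" by (rule L2_form)
  obtain CB where CB: "0 \<le> CB" "\<And>y. y \<in> H1 \<Omega> \<Longrightarrow> Re (op_B \<Omega> y y) \<le> CB * (H1_norm \<Omega> y)\<^sup>2"
    using op_B_bounded by blast
  have B: "cmod (op_B \<Omega> y z) \<le> CB * H1_norm \<Omega> y * H1_norm \<Omega> z" if "y \<in> H1 \<Omega>" "z \<in> H1 \<Omega>" for y z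
    using H.bounded_form_le[OF op_B_form CB(1) _ that] CB(2) by (simp add: H1_nrm)
  have "Re (op_S \<Omega> y y) \<le> 1 * (H.nrm y)\<^sup>2" if "y \<in> H1 \<Omega>" for y
    using L.nonneg[OF H1_L2[OF that]] by (simp add: H.nrm_sq[OF that] H1_inner_def)
  then have S: "cmod (op_S \<Omega> y z) \<le> H1_norm \<Omega> y * H1_norm \<Omega> z" if "y \<in> H1 \<Omega>" "z \<in> H1 \<Omega>" for y z
    using H.bounded_form_le[OF op_S_form zero_le_one _ that] by (simp add: H1_nrm)
  have M: "cmod (op_M \<Omega> (\<lambda>x. 1 + 0) y z) \<le> H1_norm \<Omega> y * H1_norm \<Omega> z" if "y \<in> H1 \<Omega>" "z \<in> H1 \<Omega>" for y z
  proof -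
    have "cmod (L2_inner M y z) \<le> L2_norm M y * L2_norm M z"
      using L.cauchy_schwarz[of y z] H1_L2 that by (simp add: L2_nrm)
    also have "\<dots> \<le> H1_norm \<Omega> y * H1_norm \<Omega> z"
      by (intro mult_mono L2_norm_le_H1_norm L2_norm_nonneg H1_norm_nonneg)
    finally show ?thesis by (simp add: op_M_def)
  qed
  have "cmod (helmholtz_op \<Omega> k (\<lambda>x. 0) y z) \<le> (1 + k\<^sup>2 + k * CB) * H1_norm \<Omega> y * H1_norm \<Omega> z"
    if "y \<in> H1 \<Omega>" "z \<in> H1 \<Omega>" for y z
  proof -
    have "cmod (helmholtz_op \<Omega> k (\<lambda>x. 0) y z)
      \<le> cmod (op_S \<Omega> y z) + cmod (complex_of_real (k\<^sup>2) * op_M \<Omega> (\<lambda>x. 1 + 0) y z)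
         + cmod (\<i> * complex_of_real k * op_B \<Omega> y z)"
      unfolding helmholtz_op_def by (intro order_trans[OF norm_triangle_ineq4] add_mono order_refl)
    also have "\<dots> = cmod (op_S \<Omega> y z) + k\<^sup>2 * cmod (op_M \<Omega> (\<lambda>x. 1 + 0) y z) + k * cmod (op_B \<Omega> y z)"
      using k_pos by (simp add: norm_mult norm_power)
    also have "\<dots> \<le> H1_norm \<Omega> y * H1_norm \<Omega> z + k\<^sup>2 * (H1_norm \<Omega> y * H1_norm \<Omega> z)
        + k * (CB * H1_norm \<Omega> y * H1_norm \<Omega> z)"
      using k_pos by (intro add_mono mult_left_mono S B M that) auto
    finally show ?thesis by (simp add: algebra_simps)
  qed
  moreover have "0 \<le> 1 + k\<^sup>2 + k * CB" using k_pos CB(1) by simp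
  ultimately show ?thesis by blast
qed

text \<open>With \<open>w\<close> the solution for the source \<open>v\<close>, testing the equation with \<open>v\<close> gives
  \<open>\<parallel>v\<parallel>\<^sup>2 \<le> C \<parallel>w\<parallel> \<parallel>v\<parallel>\<close> in terms of the \<open>L\<^sup>2\<close> norm on the left and the \<open>H\<^sup>1\<close> norms on the right. The map
  \<open>v \<mapsto> w\<close> is compact since it factors through the space \<open>H2\<close>.\<close>

theorem rellich:
  assumes emb: "H2_compactly_embedded_in_H1 \<Omega>" and reg: "helmholtz_H2_regular \<Omega>"
    and v: "\<And>n. v n \<in> H1 \<Omega>" and R: "\<And>n. H1_norm \<Omega> (v n) \<le> R"
  shows "\<exists>s. strict_mono (s :: nat \<Rightarrow> nat) \<and>
    (\<forall>e>0. \<exists>N. \<forall>i\<ge>N. \<forall>j\<ge>N. L2_norm M (\<lambda>x. v (s i) x - v (s j) x) < e)"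
proof -
  interpret H: hermitian_form "H1 \<Omega>" H1_inner by (rule H1_form)
  interpret L: hermitian_form "L2 M" "L2_inner M" by (rule L2_form)
  let ?N = "H1_norm \<Omega>"
  obtain C0 where C0: "0 < C0" "\<And>g. g \<in> L2 M \<Longrightarrow>
        \<exists>w. helmholtz_solution \<Omega> k (\<lambda>x. 0) (L2_inner M g) w \<and> w \<in> H2 \<Omega> \<and>
          H2_norm \<Omega> w \<le> C0 * (k + 1 + 1 / k + 1 / k\<^sup>2) * L2_norm M g"
  proof -
    obtain C0 where C0: "0 < C0" and all: "\<forall>\<kappa>>0. \<forall>g\<in>L2 M.
        \<exists>w. helmholtz_solution \<Omega> \<kappa> (\<lambda>x. 0) (L2_inner M g) w \<and>
          (\<forall>w'. helmholtz_solution \<Omega> \<kappa> (\<lambda>x. 0) (L2_inner M g) w' \<longrightarrow> (AE x in M. w' x = w x)) \<and>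
          w \<in> H2 \<Omega> \<and> H2_norm \<Omega> w \<le> C0 * (\<kappa> + 1 + 1 / \<kappa> + 1 / \<kappa>\<^sup>2) * L2_norm M g"
      using reg unfolding helmholtz_H2_regular_def by (elim exE conjE)
    show ?thesis
    proof (rule that[OF C0])
      fix g assume "g \<in> L2 M"
      from bspec[OF mp[OF spec[OF all] k_pos] this]
      show "\<exists>w. helmholtz_solution \<Omega> k (\<lambda>x. 0) (L2_inner M g) w \<and> w \<in> H2 \<Omega> \<and>
          H2_norm \<Omega> w \<le> C0 * (k + 1 + 1 / k + 1 / k\<^sup>2) * L2_norm M g"
        by (elim exE conjE) (intro exI conjI)
    qed
  qed
  let ?A = "C0 * (k + 1 + 1 / k + 1 / k\<^sup>2)"
  have A: "0 \<le> ?A" using C0(1) k_pos by simp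
  have "\<exists>w. \<forall>n. helmholtz_solution \<Omega> k (\<lambda>x. 0) (L2_inner M (v n)) (w n) \<and> w n \<in> H2 \<Omega> \<and>
          H2_norm \<Omega> (w n) \<le> ?A * L2_norm M (v n)"
    using C0(2)[OF H1_L2[OF v]] by (intro choice allI)
  then obtain w where w: "\<And>n. helmholtz_solution \<Omega> k (\<lambda>x. 0) (L2_inner M (v n)) (w n)" "\<And>n. w n \<in> H2 \<Omega>"
    "\<And>n. H2_norm \<Omega> (w n) \<le> ?A * L2_norm M (v n)" by blast
  have "H2_norm \<Omega> (w n) \<le> ?A * R" for n
    using w(3)[of n] mult_left_mono[OF order_trans[OF L2_norm_le_H1_norm R[of n]] A] by linarith
  then obtain W s where W: "W \<in> H1 \<Omega>" "strict_mono (s :: nat \<Rightarrow> nat)" "(\<lambda>n. ?N (\<lambda>x. w (s n) x - W x)) \<longlonglongrightarrow> 0"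
    using emb w(2) unfolding H2_compactly_embedded_in_H1_def by blast
  have wH: "w n \<in> H1 \<Omega>" for n using w(2)[of n] by (simp add: H2_def)
  obtain C where C: "0 \<le> C" "\<And>y z. y \<in> H1 \<Omega> \<Longrightarrow> z \<in> H1 \<Omega> \<Longrightarrow> cmod (helmholtz_op \<Omega> k (\<lambda>x. 0) y z) \<le> C * ?N y * ?N z"
    using helmholtz_op_0_bounded by blast
  have R0: "0 \<le> R" using R[of 0] H1_norm_nonneg order_trans by blast
  have key: "(L2_norm M (\<lambda>x. v i x - v j x))\<^sup>2
      \<le> C * (2 * R) * (?N (\<lambda>x. w i x - W x) + ?N (\<lambda>x. w j x - W x))" for i j
  proof -
    let ?e = "\<lambda>x. v i x - v j x" and ?d = "\<lambda>x. w i x - w j x"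
    have e: "?e \<in> H1 \<Omega>" and d: "?d \<in> H1 \<Omega>" using v wH by (auto intro: H.diff_closed)
    \<comment> \<open>By linearity \<open>?d\<close> solves the equation with source
      \<open>?e\<close>, which is then tested with \<open>?e\<close>. The exponent 3 is one at which
      the constant weight 1 qualifies.\<close>
    have "helmholtz_op \<Omega> k (\<lambda>x. 0) ?d ?e = L2_inner M ?e ?e"
      using w(1) e weight_1 L.diff_left[OF H1_L2[OF v] H1_L2[OF v] H1_L2[OF e]]
      by (subst helmholtz_op_diff[OF _ _ wH wH e, of 3]) (simp_all add: helmholtz_solution_def)
    then have "(L2_norm M ?e)\<^sup>2 = Re (helmholtz_op \<Omega> k (\<lambda>x. 0) ?d ?e)"
      by (simp add: L2_norm_sq L2_inner_self)
    also have "\<dots> \<le> C * ?N ?d * ?N ?e" using C(2)[OF d e] complex_Re_le_cmod order_trans by blast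
    also have "\<dots> \<le> C * (?N (\<lambda>x. w i x - W x) + ?N (\<lambda>x. w j x - W x)) * (2 * R)"
    proof (intro mult_mono mult_left_mono C mult_nonneg_nonneg add_nonneg_nonneg H1_norm_nonneg)
      show "?N ?d \<le> ?N (\<lambda>x. w i x - W x) + ?N (\<lambda>x. w j x - W x)"
        using H.nrm_triangle_diff[OF wH W(1) wH, of i j] H.nrm_minus[OF W(1) wH, of j] by (simp add: H1_nrm)
      show "?N ?e \<le> 2 * R"
        using H.nrm_diff_le[OF v v, of i j] R[of i] R[of j] by (simp add: H1_nrm)
    qed simp
    finally show ?thesis by (simp add: mult_ac)
  qed
  have "\<exists>N. \<forall>i\<ge>N. \<forall>j\<ge>N. L2_norm M (\<lambda>x. v (s i) x - v (s j) x) < e" if e: "0 < e" for e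
  proof -
    \<comment> \<open>The added 1 keeps the divisor positive when \<open>C\<close> or
      \<open>R\<close> is zero.\<close>
    define B where "B = C * (2 * R) + 1"
    have B: "0 < B" using C(1) R0 by (simp add: B_def add_nonneg_pos)
    have "\<forall>\<^sub>F n in sequentially. ?N (\<lambda>x. w (s n) x - W x) < e\<^sup>2 / (2 * B)"
      using order_tendstoD(2)[OF W(3), of "e\<^sup>2 / (2 * B)"] e B by simp
    then obtain N where N: "\<And>n. n \<ge> N \<Longrightarrow> ?N (\<lambda>x. w (s n) x - W x) < e\<^sup>2 / (2 * B)"
      unfolding eventually_sequentially by blast
    have "L2_norm M (\<lambda>x. v (s i) x - v (s j) x) < e" if "i \<ge> N" "j \<ge> N" for i j
    proof -
      let ?S = "?N (\<lambda>x. w (s i) x - W x) + ?N (\<lambda>x. w (s j) x - W x)"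
      have S: "0 \<le> ?S" "?S < e\<^sup>2 / B"
        using add_strict_mono[OF N[OF that(1)] N[OF that(2)]] H1_norm_nonneg B
        by (auto simp: field_simps intro: add_nonneg_nonneg)
      have "(L2_norm M (\<lambda>x. v (s i) x - v (s j) x))\<^sup>2 \<le> C * (2 * R) * ?S" by (rule key)
      also have "\<dots> \<le> B * ?S" using S(1) by (intro mult_right_mono) (auto simp: B_def)
      also have "\<dots> < B * (e\<^sup>2 / B)" using S(2) B by (intro mult_strict_left_mono)
      also have "\<dots> = e\<^sup>2" using B by simp
      finally show ?thesis using e by (intro power_less_imp_less_base[of _ 2 e]) auto
    qed
    then show ?thesis by blast
  qed
  then show ?thesis using W(2) by blast
qed

end

section \<open>A uniform boundedness principle for nonnegative functions\<close>

text \<open>The weight built below divides by such integrals, so they must be finite as well as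
  large. Truncated functions are bounded, and monotone convergence preserves the largeness.\<close>

lemma truncation_large:
  fixes g :: "'a \<Rightarrow> real"
  assumes g: "g \<in> borel_measurable N" "\<And>x. 0 \<le> g x" and s: "0 < s"
    and D: "D < (\<integral>\<^sup>+ x. ennreal (g x powr s) \<partial>N)"
  shows "\<exists>n::nat. D < (\<integral>\<^sup>+ x. ennreal (min (g x) (real n) powr s) \<partial>N)"
proof -
  note [measurable] = g(1)
  have sup: "(SUP n. ennreal (min (g x) (real n) powr s)) = ennreal (g x powr s)" for x
  proof (rule antisym)
    show "(SUP n. ennreal (min (g x) (real n) powr s)) \<le> ennreal (g x powr s)"
      using g(2) s by (intro SUP_least ennreal_leI powr_mono2) auto
    obtain n where "g x \<le> real n" using real_arch_simple by blast
    then show "ennreal (g x powr s) \<le> (SUP n. ennreal (min (g x) (real n) powr s))"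
      by (intro SUP_upper2[of n]) auto
  qed
  have "(\<integral>\<^sup>+ x. ennreal (g x powr s) \<partial>N) = (SUP n. \<integral>\<^sup>+ x. ennreal (min (g x) (real n) powr s) \<partial>N)"
    unfolding sup[symmetric]
  proof (rule nn_integral_monotone_convergence_SUP)
    show "incseq (\<lambda>n x. ennreal (min (g x) (real n) powr s))"
      using g(2) s by (auto simp: incseq_def le_fun_def intro!: ennreal_leI powr_mono2)
  qed measurable
  then show ?thesis using D by (simp add: less_SUP_iff)
qed

text \<open>Positivity replaces the gliding hump: if members \<open>a\<^sub>j\<close> of the family (truncated) had integrals
  \<open>I\<^sub>j = \<integral> a\<^sub>j powr s\<close> growing fast, then the weight \<open>m\<close> with
  \<open>m powr P = (\<Sum>j. 2\<^sup>-\<^sup>j (a\<^sub>j powr s) / I\<^sub>j)\<close> would be unbounded on the family.\<close>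

theorem positive_uniform_boundedness:
  fixes A :: "('a \<Rightarrow> real) set"
  assumes fin: "finite_measure N" and P: "1 < P"
    and A: "\<And>g. g \<in> A \<Longrightarrow> g \<in> borel_measurable N" "\<And>g x. g \<in> A \<Longrightarrow> 0 \<le> g x"
    and bdd: "\<And>m. m \<in> borel_measurable N \<Longrightarrow> (\<And>x. 0 \<le> m x) \<Longrightarrow> integrable N (\<lambda>x. m x powr P) \<Longrightarrow>
      \<exists>C. \<forall>g\<in>A. (\<integral>\<^sup>+ x. ennreal (m x * g x) \<partial>N) \<le> ennreal C"
  shows "\<exists>D. \<forall>g\<in>A. (\<integral>\<^sup>+ x. ennreal (g x powr (P / (P - 1))) \<partial>N) \<le> ennreal D"
proof (rule ccontr)
  assume neg: "\<not> ?thesis"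
  define s where "s = P / (P - 1)"
  have s: "1 < s" "s / P + 1 = s" "1 - 1 / P = 1 / s"
    using P by (auto simp: s_def field_simps)
  \<comment> \<open>The power \<open>s\<close> is undone by \<open>1 - 1 / P = 1 / s\<close> below:
    a member with integral above \<open>L j\<close> pairs with the weight to at least
    \<open>(1/2)^j * (2^j * (j + 1))\<close>.\<close>
  define L where "L j = (2 ^ j * (real j + 1)) powr s" for j :: nat
  have L: "0 < L j" for j by (simp add: L_def)
  have "\<exists>a. a \<in> borel_measurable N \<and> (\<forall>x. 0 \<le> a x) \<and> (\<exists>c. \<forall>x. a x \<le> c) \<and> (\<exists>g\<in>A. \<forall>x. a x \<le> g x) \<and>
      ennreal (L j) < (\<integral>\<^sup>+ x. ennreal (a x powr s) \<partial>N)" for j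
  proof -
    obtain g where g: "g \<in> A" "ennreal (L j) < (\<integral>\<^sup>+ x. ennreal (g x powr s) \<partial>N)"
      using neg unfolding s_def by (meson not_less)
    obtain n :: nat where "ennreal (L j) < (\<integral>\<^sup>+ x. ennreal (min (g x) (real n) powr s) \<partial>N)"
      using truncation_large[OF A(1,2)[OF g(1)] _ g(2)] s(1) by auto
    then show ?thesis using A[OF g(1)] g(1)
      by (intro exI[of _ "\<lambda>x. min (g x) (real n)"]) (auto intro: min.cobounded2 min.cobounded1)
  qed
  then have "\<exists>a. \<forall>j. a j \<in> borel_measurable N \<and> (\<forall>x. 0 \<le> a j x) \<and> (\<exists>c. \<forall>x. a j x \<le> c) \<and>
      (\<exists>g\<in>A. \<forall>x. a j x \<le> g x) \<and> ennreal (L j) < (\<integral>\<^sup>+ x. ennreal (a j x powr s) \<partial>N)"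
    by (intro choice allI)
  then obtain a where a [measurable]: "\<And>j. a j \<in> borel_measurable N"
    and a0: "\<And>j x. 0 \<le> a j x" and ac: "\<And>j. \<exists>c. \<forall>x. a j x \<le> c"
    and ag: "\<And>j. \<exists>g\<in>A. \<forall>x. a j x \<le> g x" and aL: "\<And>j. ennreal (L j) < (\<integral>\<^sup>+ x. ennreal (a j x powr s) \<partial>N)"
    by blast
  have ai: "integrable N (\<lambda>x. a j x powr s)" for j
  proof -
    obtain c where c: "\<And>x. a j x \<le> c" using ac by blast
    show ?thesis
    proof (rule Bochner_Integration.integrable_bound)
      show "integrable N (\<lambda>x. c powr s)" by (rule finite_measure.integrable_const[OF fin])
      show "AE x in N. norm (a j x powr s) \<le> norm (c powr s)"
        using a0 c s(1) by (intro always_eventually allI) (simp add: powr_mono2)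
    qed measurable
  qed
  define J where "J j = (\<integral>x. a j x powr s \<partial>N)" for j
  have nnJ: "(\<integral>\<^sup>+ x. ennreal (a j x powr s) \<partial>N) = ennreal (J j)" for j
    unfolding J_def by (intro nn_integral_eq_integral ai) auto
  have JL: "L j < J j" for j
    using aL[of j] L[of j] unfolding nnJ by (simp add: ennreal_less_iff less_imp_le)
  have J: "0 < J j" for j using JL[of j] L[of j] by simp
  define \<rho> where "\<rho> x = (\<Sum>j. ennreal ((1/2)^j * (a j x powr s / J j)))" for x
  have [measurable]: "\<rho> \<in> borel_measurable N" unfolding \<rho>_def by measurable
  have "(\<integral>\<^sup>+ x. \<rho> x \<partial>N) = (\<Sum>j. \<integral>\<^sup>+ x. ennreal ((1/2)^j * (a j x powr s / J j)) \<partial>N)"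
    unfolding \<rho>_def by (rule nn_integral_suminf) measurable
  also have "(\<lambda>j. \<integral>\<^sup>+ x. ennreal ((1/2)^j * (a j x powr s / J j)) \<partial>N) = (\<lambda>j. ennreal ((1/2)^j))"
  proof
    fix j
    have "(\<integral>\<^sup>+ x. ennreal ((1/2)^j * (a j x powr s / J j)) \<partial>N) = ennreal (\<integral>x. (1/2)^j * (a j x powr s / J j) \<partial>N)"
      using ai[of j] J[of j] by (intro nn_integral_eq_integral) auto
    also have "(\<integral>x. (1/2)^j * (a j x powr s / J j) \<partial>N) = (1/2)^j"
      using J[of j] by (simp add: J_def[symmetric])
    finally show "(\<integral>\<^sup>+ x. ennreal ((1/2)^j * (a j x powr s / J j)) \<partial>N) = ennreal ((1/2)^j)" .
  qed
  also have "(\<Sum>j. ennreal ((1/2)^j)) = ennreal (\<Sum>j. (1/2)^j)"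
    by (intro suminf_ennreal2) (auto intro: summable_geometric)
  finally have \<rho>_fin: "(\<integral>\<^sup>+ x. \<rho> x \<partial>N) < \<infinity>" by simp
  then have AE\<rho>: "AE x in N. \<rho> x \<noteq> \<infinity>" by (intro nn_integral_PInf_AE) auto
  \<comment> \<open>\<open>enn2real\<close> maps the infinite values of \<open>\<rho>\<close>, which
    occur on a null set only, to 0.\<close>
  define m where "m x = enn2real (\<rho> x) powr (1 / P)" for x
  have [measurable]: "m \<in> borel_measurable N" unfolding m_def by measurable
  have m0: "0 \<le> m x" for x by (simp add: m_def)
  have mP: "m x powr P = enn2real (\<rho> x)" for x
    using P by (simp add: m_def powr_powr)
  have "integrable N (\<lambda>x. m x powr P)"
  proof (rule integrableI_bounded)
    have "(\<integral>\<^sup>+ x. ennreal (norm (m x powr P)) \<partial>N) \<le> (\<integral>\<^sup>+ x. \<rho> x \<partial>N)"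
      using AE\<rho> unfolding mP
      by (intro nn_integral_mono_AE) (auto elim!: eventually_mono simp: ennreal_enn2real_if)
    then show "(\<integral>\<^sup>+ x. ennreal (norm (m x powr P)) \<partial>N) < \<infinity>" using \<rho>_fin by (rule order_le_less_trans)
  qed measurable
  then obtain C where C: "\<And>g. g \<in> A \<Longrightarrow> (\<integral>\<^sup>+ x. ennreal (m x * g x) \<partial>N) \<le> ennreal C"
    using bdd[of m] m0 by auto
  have "real j + 1 \<le> max C 0" for j :: nat
  proof -
    obtain g where g: "g \<in> A" "\<And>x. a j x \<le> g x" using ag by blast
    \<comment> \<open>Of the series for \<open>\<rho>\<close> only the term \<open>j\<close> is
      kept; its root contributes \<open>a j x powr (s / P)\<close>, and \<open>s / P + 1 = s\<close>
      restores the integrand of \<open>J j\<close>.\<close>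
    have "ennreal (((1/2)^j / J j) powr (1 / P) * (a j x powr s)) \<le> ennreal (m x * g x)" if "\<rho> x \<noteq> \<infinity>" for x
    proof -
      have "ennreal ((1/2)^j * (a j x powr s / J j)) \<le> \<rho> x"
        unfolding \<rho>_def using sum_le_suminf[of "\<lambda>j. ennreal ((1/2)^j * (a j x powr s / J j))" "{j}"] by simp
      then have "(1/2)^j * (a j x powr s / J j) \<le> enn2real (\<rho> x)"
        using that enn2real_mono[of "ennreal ((1/2)^j * (a j x powr s / J j))" "\<rho> x"] J[of j]
        by (simp add: top.not_eq_extremum)
      then have "((1/2)^j * (a j x powr s / J j)) powr (1 / P) \<le> m x"
        unfolding m_def using P J[of j] by (intro powr_mono2) auto
      moreover have "((1/2)^j * (a j x powr s / J j)) powr (1 / P) = ((1/2)^j / J j) powr (1 / P) * a j x powr (s / P)"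
      proof -
        have e: "(1/2)^j * (a j x powr s / J j) = ((1/2)^j / J j) * (a j x powr s)" by simp
        show ?thesis unfolding e using J[of j] by (subst powr_mult) (auto simp: powr_powr)
      qed
      ultimately have "((1/2)^j / J j) powr (1 / P) * a j x powr (s / P) * a j x \<le> m x * g x"
        using g(2) a0 m0 by (intro mult_mono) auto
      moreover have "a j x powr (s / P) * a j x = a j x powr s"
        using a0[of j x] s(2) powr_add[of "a j x" "s / P" 1] by (cases "a j x = 0") auto
      ultimately show ?thesis by (intro ennreal_leI) (simp add: mult.assoc)
    qed
    then have "(\<integral>\<^sup>+ x. ennreal (((1/2)^j / J j) powr (1 / P) * (a j x powr s)) \<partial>N) \<le> (\<integral>\<^sup>+ x. ennreal (m x * g x) \<partial>N)"
      using AE\<rho> by (intro nn_integral_mono_AE) (auto elim!: eventually_mono)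
    also have "\<dots> \<le> ennreal C" by (rule C[OF g(1)])
    also have "\<dots> \<le> ennreal (max C 0)" by (intro ennreal_leI) auto
    also have "(\<integral>\<^sup>+ x. ennreal (((1/2)^j / J j) powr (1 / P) * (a j x powr s)) \<partial>N) = ennreal (((1/2)^j / J j) powr (1 / P) * J j)"
      unfolding ennreal_mult'[OF powr_ge_zero] by (simp add: nn_integral_cmult nnJ)
    finally have b: "((1/2)^j / J j) powr (1 / P) * J j \<le> max C 0" by simp
    have "((1/2)^j / J j) powr (1 / P) * J j = ((1/2)^j) powr (1 / P) * (J j powr (1 - 1 / P))"
      using J[of j] by (simp add: powr_divide powr_diff)
    also have "\<dots> \<ge> (1/2)^j * (2 ^ j * (real j + 1))"
    proof (rule mult_mono)
      have "((1/2)^j) powr 1 \<le> ((1/2::real)^j) powr (1 / P)"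
        using P by (intro powr_mono') (auto simp: power_le_one)
      then show "(1/2)^j \<le> ((1/2::real)^j) powr (1 / P)" by simp
      have "L j powr (1 / s) \<le> J j powr (1 / s)" using JL[of j] L[of j] s(1) by (intro powr_mono2) auto
      then show "2 ^ j * (real j + 1) \<le> J j powr (1 - 1 / P)"
        using s(1) unfolding s(3) L_def by (simp add: powr_powr)
    qed auto
    finally show ?thesis using b by (simp add: power_one_over)
  qed
  moreover obtain j :: nat where "max C 0 < real j" using reals_Archimedean2 by blast
  ultimately show False by (meson add_increasing2 not_le zero_le_one order_refl le_less_trans less_le_trans)
qed

section \<open>Uniform convergence of the weighted forms on the unit ball\<close>

text \<open>The comparison of \<open>y\<close> with \<open>x powr (p - 1)\<close> decides which of
  the two terms dominates alone, so the usual factors \<open>1 / p\<close> and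
  \<open>1 - 1 / p\<close> are dispensed with.\<close>

lemma young_le:
  fixes x y p :: real
  assumes "0 \<le> x" "0 \<le> y" "1 < p"
  shows "x * y \<le> x powr p + y powr (p / (p - 1))"
proof (cases "y \<le> x powr (p - 1)")
  case True
  then have "x * y \<le> x * x powr (p - 1)" using assms by (intro mult_left_mono)
  also have "\<dots> = x powr p" using assms by (simp add: powr_mult_base)
  finally show ?thesis by (simp add: add_increasing2)
next
  case False
  then have "(x powr (p - 1)) powr (1 / (p - 1)) \<le> y powr (1 / (p - 1))"
    using assms by (intro powr_mono2) auto
  then have "x \<le> y powr (1 / (p - 1))" using assms by (simp add: powr_powr)
  then have "x * y \<le> y powr (1 / (p - 1)) * y" using assms by (intro mult_right_mono)
  also have "\<dots> = y powr (1 + 1 / (p - 1))" using assms by (simp add: powr_mult_base mult.commute)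
  also have "1 + 1 / (p - 1) = p / (p - 1)" using assms by (simp add: field_simps)
  finally show ?thesis by (simp add: add_increasing)
qed

text \<open>Above the level \<open>T\<close>, \<open>a\<close> is at most
  \<open>T powr (1 - p / P) * a powr (p / P)\<close>, since \<open>1 - p / P\<close> is negative.
  Young's inequality with exponent \<open>P\<close> then leaves a tail whose factor vanishes as
  \<open>T\<close> grows; below \<open>T\<close> the bound is linear in \<open>t\<close>.\<close>

lemma truncated_young_le:
  fixes a t T p P :: real
  assumes "0 \<le> a" "0 \<le> t" "1 \<le> T" "1 < P" "P < p"
  shows "a * t \<le> T * t + T powr (1 - p / P) * (a powr p + t powr (P / (P - 1)))"
proof (cases "a \<le> T")
  case True
  have "a * t \<le> T * t" using True assms by (intro mult_right_mono) auto
  moreover have "0 \<le> T powr (1 - p / P) * (a powr p + t powr (P / (P - 1)))"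
    by (intro mult_nonneg_nonneg add_nonneg_nonneg) auto
  ultimately show ?thesis by linarith
next
  case False
  have "a = a powr (1 - p / P) * a powr (p / P)"
    using False assms by (simp flip: powr_add)
  also have "\<dots> \<le> T powr (1 - p / P) * a powr (p / P)"
    using False assms by (intro mult_right_mono powr_mono2') (auto simp: field_simps)
  finally have "a * t \<le> T powr (1 - p / P) * a powr (p / P) * t" using assms by (intro mult_right_mono)
  also have "\<dots> = T powr (1 - p / P) * (a powr (p / P) * t)" by simp
  also have "\<dots> \<le> T powr (1 - p / P) * ((a powr (p / P)) powr P + t powr (P / (P - 1)))"
    using assms by (intro mult_left_mono young_le) auto
  also have "(a powr (p / P)) powr P = a powr p" using assms by (simp add: powr_powr)
  finally show ?thesis using assms by (simp add: add_increasing)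
qed

lemma young_integrable:
  fixes g w :: "'a \<Rightarrow> complex"
  assumes [measurable]: "g \<in> borel_measurable N" "w \<in> borel_measurable N" and p: "1 < p"
    and i: "integrable N (\<lambda>x. cmod (g x) powr p)" "integrable N (\<lambda>x. cmod (w x) powr (p / (p - 1)))"
  shows "integrable N (\<lambda>x. g x * w x)"
    "cmod (\<integral>x. g x * w x \<partial>N) \<le> (\<integral>x. cmod (g x) powr p \<partial>N) + (\<integral>x. cmod (w x) powr (p / (p - 1)) \<partial>N)"
proof -
  have le: "cmod (g x * w x) \<le> cmod (g x) powr p + cmod (w x) powr (p / (p - 1))" for x
    unfolding norm_mult using p by (intro young_le) auto
  show gw: "integrable N (\<lambda>x. g x * w x)"
  proof (rule Bochner_Integration.integrable_bound)
    show "integrable N (\<lambda>x. cmod (g x) powr p + cmod (w x) powr (p / (p - 1)))" using i by simp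
    show "AE x in N. norm (g x * w x) \<le> norm (cmod (g x) powr p + cmod (w x) powr (p / (p - 1)))"
      using le by simp
  qed measurable
  have "cmod (\<integral>x. g x * w x \<partial>N) \<le> (\<integral>x. cmod (g x * w x) \<partial>N)" by (rule integral_norm_bound)
  also have "\<dots> \<le> (\<integral>x. cmod (g x) powr p + cmod (w x) powr (p / (p - 1)) \<partial>N)"
    using gw i le by (intro integral_mono) auto
  finally show "cmod (\<integral>x. g x * w x \<partial>N) \<le> (\<integral>x. cmod (g x) powr p \<partial>N) + (\<integral>x. cmod (w x) powr (p / (p - 1)) \<partial>N)"
    using i by simp
qed

context impedance_problem
begin

text \<open>This replaces a Sobolev embedding. By \<open>weight_bounded\<close>, |y|^2 for y in a
  ball of H1 pairs boundedly with each nonnegative weight in \<open>L^P\<close>, and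
  \<open>positive_uniform_boundedness\<close> turns this into a bound in the dual exponent.
  \<open>weight_square_integrable\<close> is what identifies the Bochner integrals with the
  nonnegative ones.\<close>

lemma sobolev_power_bound:
  assumes P: "2 < P"
  shows "\<exists>D\<ge>0. \<forall>y\<in>H1 \<Omega>. H1_norm \<Omega> y \<le> R \<longrightarrow> integrable M (\<lambda>x. ((cmod (y x))\<^sup>2) powr (P / (P - 1))) \<and>
    (\<integral>x. ((cmod (y x))\<^sup>2) powr (P / (P - 1)) \<partial>M) \<le> D"
proof -
  let ?A = "{(\<lambda>x. (cmod (y x))\<^sup>2) | y. y \<in> H1 \<Omega> \<and> H1_norm \<Omega> y \<le> R}"
  have "\<exists>D. \<forall>g\<in>?A. (\<integral>\<^sup>+ x. ennreal (g x powr (P / (P - 1))) \<partial>M) \<le> ennreal D"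
  proof (rule positive_uniform_boundedness[OF finite_M])
    fix m :: "real^2 \<Rightarrow> real"
    assume "m \<in> borel_measurable M" "\<And>x. 0 \<le> m x" "integrable M (\<lambda>x. m x powr P)"
    then have m: "weight P m" and m0: "\<And>x. 0 \<le> m x" by (auto simp: weight_def)
    obtain C where C: "0 \<le> C" "\<And>y. y \<in> H1 \<Omega> \<Longrightarrow> (\<integral>x. m x * (cmod (y x))\<^sup>2 \<partial>M) \<le> C * (H1_norm \<Omega> y)\<^sup>2"
      using weight_bounded[OF P m] by blast
    have "(\<integral>\<^sup>+ x. ennreal (m x * (cmod (y x))\<^sup>2) \<partial>M) \<le> ennreal (C * R\<^sup>2)"
      if y: "y \<in> H1 \<Omega>" "H1_norm \<Omega> y \<le> R" for y
    proof -
      have "(\<integral>\<^sup>+ x. ennreal (m x * (cmod (y x))\<^sup>2) \<partial>M) = ennreal (\<integral>x. m x * (cmod (y x))\<^sup>2 \<partial>M)"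
        using m0 by (intro nn_integral_eq_integral weight_square_integrable[OF P m y(1)]) auto
      also have "\<dots> \<le> ennreal (C * R\<^sup>2)"
        using C(2)[OF y(1)] mult_left_mono[OF power_mono[OF y(2) H1_norm_nonneg] C(1), of 2]
        by (intro ennreal_leI) linarith
      finally show ?thesis .
    qed
    then show "\<exists>C. \<forall>g\<in>?A. (\<integral>\<^sup>+ x. ennreal (m x * g x) \<partial>M) \<le> ennreal C" by blast
  next
    fix g assume "g \<in> ?A"
    then obtain y where y: "g = (\<lambda>x. (cmod (y x))\<^sup>2)" "y \<in> H1 \<Omega>" by blast
    have [measurable]: "y \<in> borel_measurable M" using y(2) by (intro L2_measurable H1_L2)
    show "g \<in> borel_measurable M" unfolding y(1) by measurable
    show "0 \<le> g x" for x by (simp add: y(1))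
  qed (use P in simp)
  then obtain D where D0: "\<forall>g\<in>?A. (\<integral>\<^sup>+ x. ennreal (g x powr (P / (P - 1))) \<partial>M) \<le> ennreal D" by (elim exE)
  have D: "(\<integral>\<^sup>+ x. ennreal (((cmod (y x))\<^sup>2) powr (P / (P - 1))) \<partial>M) \<le> ennreal D"
    if "y \<in> H1 \<Omega>" "H1_norm \<Omega> y \<le> R" for y
    by (rule bspec[OF D0]) (use that in blast)
  have "integrable M (\<lambda>x. ((cmod (y x))\<^sup>2) powr (P / (P - 1))) \<and>
    (\<integral>x. ((cmod (y x))\<^sup>2) powr (P / (P - 1)) \<partial>M) \<le> max D 0" if y: "y \<in> H1 \<Omega>" "H1_norm \<Omega> y \<le> R" for y
  proof
    have [measurable]: "y \<in> borel_measurable M" using y(1) by (intro L2_measurable H1_L2)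
    show i: "integrable M (\<lambda>x. ((cmod (y x))\<^sup>2) powr (P / (P - 1)))"
    proof (rule integrableI_bounded)
      show "(\<integral>\<^sup>+ x. ennreal (norm (((cmod (y x))\<^sup>2) powr (P / (P - 1)))) \<partial>M) < \<infinity>"
        using D[OF y] by (simp add: order_le_less_trans)
    qed measurable
    have "ennreal (\<integral>x. ((cmod (y x))\<^sup>2) powr (P / (P - 1)) \<partial>M) \<le> ennreal (max D 0)"
      using D[OF y] nn_integral_eq_integral[OF i] by (simp add: ennreal_leI order_trans max_def)
    then show "(\<integral>x. ((cmod (y x))\<^sup>2) powr (P / (P - 1)) \<partial>M) \<le> max D 0" by simp
  qed
  then show ?thesis by (intro exI[of _ "max D 0"]) auto
qed

text \<open>The arithmetic-geometric mean inequality with parameter \<open>l\<close> separates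
  \<open>y\<close> from \<open>\<phi>\<close>. The factor with \<open>\<phi>\<close> is merely
  bounded; the one with \<open>y\<close> is small by \<open>truncated_young_le\<close>, its tail
  through \<open>T\<close> and the rest through the L2 norm. The radius 2 accommodates differences
  of elements of the unit ball.\<close>

lemma equi_small:
  assumes p: "2 < p" and A: "0 \<le> A" and e: "0 < e"
  shows "\<exists>\<eta>>0. \<forall>h y \<phi>. h \<in> borel_measurable M \<longrightarrow> (\<forall>x. 0 \<le> h x) \<longrightarrow> integrable M (\<lambda>x. h x powr p) \<longrightarrow>
    (\<integral>x. h x powr p \<partial>M) \<le> A \<longrightarrow> y \<in> H1 \<Omega> \<longrightarrow> \<phi> \<in> H1 \<Omega> \<longrightarrow> H1_norm \<Omega> y \<le> 2 \<longrightarrow> H1_norm \<Omega> \<phi> \<le> 2 \<longrightarrow>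
    L2_norm M y \<le> \<eta> \<longrightarrow> integrable M (\<lambda>x. h x * (cmod (y x) * cmod (\<phi> x))) \<and>
    (\<integral>x. h x * (cmod (y x) * cmod (\<phi> x)) \<partial>M) \<le> e"
proof -
  \<comment> \<open>The midpoint leaves room on both sides: above 2 for
    \<open>sobolev_power_bound\<close>, below \<open>p\<close> for the decay in
    \<open>T\<close>.\<close>
  define P where "P = (2 + p) / 2"
  have P: "2 < P" "1 < P" "P < p" using p by (auto simp: P_def)
  let ?s = "P / (P - 1)"
  obtain D where D: "0 \<le> D" "\<And>y. y \<in> H1 \<Omega> \<Longrightarrow> H1_norm \<Omega> y \<le> 2 \<Longrightarrow> integrable M (\<lambda>x. ((cmod (y x))\<^sup>2) powr ?s)"
    "\<And>y. y \<in> H1 \<Omega> \<Longrightarrow> H1_norm \<Omega> y \<le> 2 \<Longrightarrow> (\<integral>x. ((cmod (y x))\<^sup>2) powr ?s \<partial>M) \<le> D"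
    using sobolev_power_bound[OF P(1), of 2] by blast
  \<comment> \<open>\<open>B\<close> bounds the weighted square integral of \<open>\<phi>\<close>:
    level 1 in the truncated estimate gives the squared norm, at most 4, plus \<open>A + D\<close>.
    With the next definition \<open>l * B = e / 2\<close>.\<close>
  define B where "B = 4 + A + D"
  define l where "l = e / (2 * B)"
  have B: "0 < B" using A D by (simp add: B_def)
  have l: "0 < l" using e B by (simp add: l_def)
  have "((\<lambda>T. T powr (1 - p / P)) \<longlongrightarrow> 0) at_top"
    using P by (intro tendsto_neg_powr filterlim_ident) (simp add: field_simps)
  then have "\<forall>\<^sub>F T in at_top. T powr (1 - p / P) < e * l / (4 * B)"
    using e l B by (intro order_tendstoD(2)) auto
  then obtain T where T: "1 \<le> T" "T powr (1 - p / P) < e * l / (4 * B)"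
    using eventually_happens'[OF _ eventually_conj[OF _ eventually_ge_at_top[of 1]]] by fastforce
  \<comment> \<open>Then \<open>T * \<eta>\<^sup>2 = e * l / 4\<close>, and the tail is at most
    \<open>e * l / 4\<close> by the choice of \<open>T\<close>; together, divided by
    \<open>l\<close>, they make up the other \<open>e / 2\<close>.\<close>
  define \<eta> where "\<eta> = sqrt (e * l / (4 * T))"
  have \<eta>: "0 < \<eta>" "\<eta>\<^sup>2 = e * l / (4 * T)" using e l T(1) by (auto simp: \<eta>_def)
  have "integrable M (\<lambda>x. h x * (cmod (y x) * cmod (\<phi> x))) \<and> (\<integral>x. h x * (cmod (y x) * cmod (\<phi> x)) \<partial>M) \<le> e"
    if h [measurable]: "h \<in> borel_measurable M" and h0: "\<And>x. 0 \<le> h x"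
      and hi: "integrable M (\<lambda>x. h x powr p)" and hA: "(\<integral>x. h x powr p \<partial>M) \<le> A"
      and y: "y \<in> H1 \<Omega>" and \<phi>: "\<phi> \<in> H1 \<Omega>" and y2: "H1_norm \<Omega> y \<le> 2" and \<phi>2: "H1_norm \<Omega> \<phi> \<le> 2"
      and yL: "L2_norm M y \<le> \<eta>" for h y \<phi>
  proof -
    have [measurable]: "y \<in> borel_measurable M" "\<phi> \<in> borel_measurable M" using y \<phi> by (auto intro: L2_measurable H1_L2)
    have w: "integrable M (\<lambda>x. h x * (cmod (z x))\<^sup>2)"
      "(\<integral>x. h x * (cmod (z x))\<^sup>2 \<partial>M) \<le> t * (L2_norm M z)\<^sup>2 + t powr (1 - p / P) * (A + D)"
      if z: "z \<in> H1 \<Omega>" "H1_norm \<Omega> z \<le> 2" and t: "1 \<le> t" for z t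
    proof -
      have [measurable]: "z \<in> borel_measurable M" using z(1) by (intro L2_measurable H1_L2)
      have z2: "integrable M (\<lambda>x. (cmod (z x))\<^sup>2)" using H1_L2[OF z(1)] by (simp add: L2_iff)
      let ?b = "\<lambda>x. t * (cmod (z x))\<^sup>2 + t powr (1 - p / P) * (h x powr p + ((cmod (z x))\<^sup>2) powr ?s)"
      have bi: "integrable M ?b" using z2 hi D(2)[OF z] by auto
      have le: "h x * (cmod (z x))\<^sup>2 \<le> ?b x" for x
        using h0 t P by (intro truncated_young_le) auto
      show i: "integrable M (\<lambda>x. h x * (cmod (z x))\<^sup>2)"
      proof (rule Bochner_Integration.integrable_bound[OF bi])
        show "AE x in M. norm (h x * (cmod (z x))\<^sup>2) \<le> norm (?b x)"
        proof (intro always_eventually allI)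
          fix x
          have "0 \<le> h x * (cmod (z x))\<^sup>2" using h0 by simp
          then show "norm (h x * (cmod (z x))\<^sup>2) \<le> norm (?b x)" using le[of x] by (simp only: real_norm_def)
        qed
      qed measurable
      have "(\<integral>x. h x * (cmod (z x))\<^sup>2 \<partial>M) \<le> (\<integral>x. ?b x \<partial>M)" by (intro integral_mono i bi le)
      also have "\<dots> = t * (L2_norm M z)\<^sup>2 + t powr (1 - p / P) * ((\<integral>x. h x powr p \<partial>M) + (\<integral>x. ((cmod (z x))\<^sup>2) powr ?s \<partial>M))"
        using z2 hi D(2)[OF z] by (simp add: L2_norm_sq)
      also have "\<dots> \<le> t * (L2_norm M z)\<^sup>2 + t powr (1 - p / P) * (A + D)"
        using hA D(3)[OF z] by (intro add_left_mono mult_left_mono add_mono) auto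
      finally show "(\<integral>x. h x * (cmod (z x))\<^sup>2 \<partial>M) \<le> t * (L2_norm M z)\<^sup>2 + t powr (1 - p / P) * (A + D)" .
    qed
    let ?c = "\<lambda>x. (h x * (cmod (y x))\<^sup>2) / l + l * (h x * (cmod (\<phi> x))\<^sup>2)"
    have ci: "integrable M ?c" using w(1)[OF y y2 T(1)] w(1)[OF \<phi> \<phi>2 T(1)] by auto
    have amgm: "a * b \<le> a\<^sup>2 / l + l * b\<^sup>2" if "0 \<le> a" "0 \<le> b" for a b :: real
    proof -
      have "2 * (a / sqrt l) * (sqrt l * b) \<le> (a / sqrt l)\<^sup>2 + (sqrt l * b)\<^sup>2" by (rule sum_squares_bound)
      moreover have "(a / sqrt l) * (sqrt l * b) = a * b" using l by simp
      moreover have "0 \<le> a * b" using that by simp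
      ultimately have "a * b \<le> (a / sqrt l)\<^sup>2 + (sqrt l * b)\<^sup>2" by linarith
      then show ?thesis using l by (simp add: power_divide power_mult_distrib)
    qed
    have le: "h x * (cmod (y x) * cmod (\<phi> x)) \<le> ?c x" for x
      using mult_left_mono[OF amgm[of "cmod (y x)" "cmod (\<phi> x)"] h0[of x]] by (simp add: algebra_simps)
    have i: "integrable M (\<lambda>x. h x * (cmod (y x) * cmod (\<phi> x)))"
    proof (rule Bochner_Integration.integrable_bound[OF ci])
      show "AE x in M. norm (h x * (cmod (y x) * cmod (\<phi> x))) \<le> norm (?c x)"
      proof (intro always_eventually allI)
        fix x
        have "0 \<le> h x * (cmod (y x) * cmod (\<phi> x))" using h0 by simp
        then show "norm (h x * (cmod (y x) * cmod (\<phi> x))) \<le> norm (?c x)" using le[of x] by (simp only: real_norm_def)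
      qed
    qed measurable
    have "(\<integral>x. h x * (cmod (y x) * cmod (\<phi> x)) \<partial>M) \<le> (\<integral>x. ?c x \<partial>M)" by (intro integral_mono i ci le)
    also have "\<dots> = (\<integral>x. h x * (cmod (y x))\<^sup>2 \<partial>M) / l + l * (\<integral>x. h x * (cmod (\<phi> x))\<^sup>2 \<partial>M)"
      using w(1)[OF y y2 T(1)] w(1)[OF \<phi> \<phi>2 T(1)] by simp
    also have "\<dots> \<le> (e * l / 2) / l + l * B"
    proof (intro add_mono divide_right_mono mult_left_mono)
      have "(\<integral>x. h x * (cmod (y x))\<^sup>2 \<partial>M) \<le> T * (L2_norm M y)\<^sup>2 + T powr (1 - p / P) * (A + D)"
        by (rule w(2)[OF y y2 T(1)])
      also have "\<dots> \<le> T * \<eta>\<^sup>2 + e * l / (4 * B) * B"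
        using T A D(1) yL L2_norm_nonneg[of M y] e l by (intro add_mono mult_left_mono mult_mono power_mono) (auto simp: B_def)
      also have "\<dots> = e * l / 2" using T(1) B by (simp add: \<eta>(2))
      finally show "(\<integral>x. h x * (cmod (y x))\<^sup>2 \<partial>M) \<le> e * l / 2" .
      have "(L2_norm M \<phi>)\<^sup>2 \<le> 2\<^sup>2"
        using order_trans[OF L2_norm_le_H1_norm \<phi>2] by (intro power_mono L2_norm_nonneg)
      then show "(\<integral>x. h x * (cmod (\<phi> x))\<^sup>2 \<partial>M) \<le> B"
        using w(2)[OF \<phi> \<phi>2 order_refl] by (simp add: B_def)
    qed (use l in auto)
    also have "\<dots> = e" using l B by (simp add: l_def)
    finally show ?thesis using i by blast
  qed
  then show ?thesis using \<eta>(1) by blast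
qed

end

section \<open>Bounds for weakly convergent potentials\<close>

context impedance_problem
begin

text \<open>The convergence of the potentials that the proof uses: for finite \<open>p\<close> it is weak
  convergence, and for \<open>p = \<infinity>\<close> weak-* convergence implies it with exponent \<open>3\<close>.\<close>

definition potentials_converge :: "real \<Rightarrow> (nat \<Rightarrow> real^2 \<Rightarrow> real) \<Rightarrow> (real^2 \<Rightarrow> real) \<Rightarrow> bool" where
  "potentials_converge p qs q \<longleftrightarrow> (\<forall>n. qs n \<in> potentials (ereal p) \<Omega>) \<and> q \<in> potentials (ereal p) \<Omega> \<and>
    (\<forall>w. w \<in> borel_measurable M \<longrightarrow> integrable M (\<lambda>x. cmod (w x) powr (p / (p - 1))) \<longrightarrow>
      (\<lambda>n. \<integral>x. complex_of_real (qs n x) * w x \<partial>M) \<longlonglongrightarrow> (\<integral>x. complex_of_real (q x) * w x \<partial>M))"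

lemma potentials_iff:
  "r \<in> potentials (ereal p) \<Omega> \<longleftrightarrow> r \<in> borel_measurable M \<and> integrable M (\<lambda>x. \<bar>r x\<bar> powr p) \<and> (AE x in M. -1 \<le> r x)"
proof -
  have "(\<lambda>x. complex_of_real (r x)) \<in> borel_measurable M \<longleftrightarrow> r \<in> borel_measurable M"
  proof
    assume "(\<lambda>x. complex_of_real (r x)) \<in> borel_measurable M"
    then have "(\<lambda>x. Re (complex_of_real (r x))) \<in> borel_measurable M" by measurable
    then show "r \<in> borel_measurable M" by simp
  qed measurable
  then show ?thesis by (simp add: potentials_def Lp_def)
qed

lemma abs_1_plus_powr_le: "1 < p \<Longrightarrow> \<bar>1 + t\<bar> powr p \<le> 2 powr p * (1 + \<bar>t\<bar> powr p)" for t p :: real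
proof -
  assume p: "1 < p"
  have "\<bar>1 + t\<bar> \<le> 2 * max 1 \<bar>t\<bar>" by linarith
  then have "\<bar>1 + t\<bar> powr p \<le> (2 * max 1 \<bar>t\<bar>) powr p" using p by (intro powr_mono2) auto
  also have "\<dots> = 2 powr p * (max 1 \<bar>t\<bar>) powr p" by (simp add: powr_mult)
  also have "(max 1 \<bar>t\<bar>) powr p \<le> 1 + \<bar>t\<bar> powr p" by (cases "\<bar>t\<bar> \<le> 1") (auto simp: max_def)
  finally show ?thesis by simp
qed

lemma integrable_1_plus:
  assumes p: "1 < p" and r: "r \<in> potentials (ereal p) \<Omega>"
  shows "integrable M (\<lambda>x. \<bar>1 + r x\<bar> powr p)"
proof (rule Bochner_Integration.integrable_bound)
  show "integrable M (\<lambda>x. 2 powr p * (1 + \<bar>r x\<bar> powr p))"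
    using r integrable_const_M[of "1::real"] by (simp add: potentials_iff)
  have [measurable]: "r \<in> borel_measurable M" using r by (simp add: potentials_iff)
  show "(\<lambda>x. \<bar>1 + r x\<bar> powr p) \<in> borel_measurable M" by measurable
  show "AE x in M. norm (\<bar>1 + r x\<bar> powr p) \<le> norm (2 powr p * (1 + \<bar>r x\<bar> powr p))"
    using abs_1_plus_powr_le[OF p] by (intro always_eventually allI) (simp add: abs_of_nonneg)
qed

lemma weight_1_plus:
  assumes p: "1 < p" and r: "r \<in> potentials (ereal p) \<Omega>"
  shows "weight p (\<lambda>x. 1 + r x)"
proof -
  have [measurable]: "r \<in> borel_measurable M" and r1: "AE x in M. -1 \<le> r x" using r by (auto simp: potentials_iff)
  have "integrable M (\<lambda>x. \<bar>1 + r x\<bar> powr p) \<longleftrightarrow> integrable M (\<lambda>x. (1 + r x) powr p)"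
    using r1 by (intro integrable_cong_AE) (auto elim!: eventually_mono)
  then show ?thesis using integrable_1_plus[OF p r] r1 by (auto simp: weight_def elim: eventually_mono)
qed

text \<open>Convergent pairings are bounded, so \<open>positive_uniform_boundedness\<close> applies
  with exchanged exponents: weights in \<open>L^p'\<close> for \<open>p' = p / (p - 1)\<close>,
  whose dual exponent is \<open>p\<close>. The shift by 1 makes the potentials nonnegative almost
  everywhere, and the absolute value makes them so everywhere, as the principle demands.\<close>

lemma potentials_bounded:
  assumes p: "1 < p" and c: "potentials_converge p qs q"
  shows "\<exists>A\<ge>0. \<forall>n. (\<integral>x. \<bar>1 + qs n x\<bar> powr p \<partial>M) \<le> A"
proof -
  let ?A = "range (\<lambda>n x. \<bar>1 + qs n x\<bar>)"
  have qm [measurable]: "qs n \<in> borel_measurable M" and q1: "AE x in M. -1 \<le> qs n x"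
    and qi: "integrable M (\<lambda>x. \<bar>qs n x\<bar> powr p)" for n
    using c by (auto simp: potentials_converge_def potentials_iff)
  define p' where "p' = p / (p - 1)"
  have p': "1 < p'" "p' / (p' - 1) = p" using p by (auto simp: p'_def field_simps)
  have "\<exists>D. \<forall>g\<in>?A. (\<integral>\<^sup>+ x. ennreal (g x powr (p' / (p' - 1))) \<partial>M) \<le> ennreal D"
  proof (rule positive_uniform_boundedness[OF finite_M p'(1)])
    fix m :: "real^2 \<Rightarrow> real"
    assume mm [measurable]: "m \<in> borel_measurable M" and m0: "\<And>x. 0 \<le> m x" and mi: "integrable M (\<lambda>x. m x powr p')"
    have m: "integrable M (\<lambda>x. cmod (complex_of_real (m x)) powr (p / (p - 1)))"
      using mi m0 by (simp add: p'_def)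
    have qmi: "integrable M (\<lambda>x. complex_of_real (qs n x) * complex_of_real (m x))" for n
      using qi m p by (intro young_integrable) auto
    then have qmr: "integrable M (\<lambda>x. qs n x * m x)" for n
      using integrable_Re[OF qmi[of n]] by simp
    have "integrable M (\<lambda>x. complex_of_real 1 * complex_of_real (m x))"
      using m p integrable_const_M[of "1::real"] by (intro young_integrable) auto
    then have mr: "integrable M m" using integrable_Re by fastforce
    have "(\<lambda>n. \<integral>x. complex_of_real (qs n x) * complex_of_real (m x) \<partial>M) \<longlonglongrightarrow> (\<integral>x. complex_of_real (q x) * complex_of_real (m x) \<partial>M)"
      using c m unfolding potentials_converge_def by (auto simp del: of_real_mult)
    then have "Bseq (\<lambda>n. \<integral>x. complex_of_real (qs n x) * complex_of_real (m x) \<partial>M)"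
      by (intro convergent_imp_Bseq convergentI)
    then obtain C where C: "\<And>n. cmod (\<integral>x. complex_of_real (qs n x) * complex_of_real (m x) \<partial>M) \<le> C"
      by (auto simp: Bseq_def)
    have C': "(\<integral>x. qs n x * m x \<partial>M) \<le> C" for n
    proof -
      have "(\<integral>x. complex_of_real (qs n x) * complex_of_real (m x) \<partial>M) = complex_of_real (\<integral>x. qs n x * m x \<partial>M)"
        unfolding of_real_mult[symmetric] by (rule integral_complex_of_real)
      then show ?thesis using C[of n] by simp
    qed
    have "(\<integral>\<^sup>+ x. ennreal (m x * \<bar>1 + qs n x\<bar>) \<partial>M) \<le> ennreal ((\<integral>x. m x \<partial>M) + C)" for n
    proof -
      have "(\<integral>\<^sup>+ x. ennreal (m x * \<bar>1 + qs n x\<bar>) \<partial>M) = (\<integral>\<^sup>+ x. ennreal (m x + qs n x * m x) \<partial>M)"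
        using q1[of n] by (intro nn_integral_cong_AE) (auto elim!: eventually_mono simp: algebra_simps)
      also have "\<dots> = ennreal (\<integral>x. m x + qs n x * m x \<partial>M)"
      proof (intro nn_integral_eq_integral)
        show "AE x in M. 0 \<le> m x + qs n x * m x"
          using q1[of n]
        proof eventually_elim
          case (elim x)
          have "0 \<le> (1 + qs n x) * m x" using elim m0 by (intro mult_nonneg_nonneg) auto
          then show ?case by (simp add: algebra_simps)
        qed
      qed (use mr qmr in auto)
      also have "\<dots> \<le> ennreal ((\<integral>x. m x \<partial>M) + C)" using mr qmr C' by (intro ennreal_leI) simp
      finally show ?thesis .
    qed
    then show "\<exists>C. \<forall>g\<in>?A. (\<integral>\<^sup>+ x. ennreal (m x * g x) \<partial>M) \<le> ennreal C" by blast
  qed auto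
  then obtain D where D0: "\<forall>g\<in>?A. (\<integral>\<^sup>+ x. ennreal (g x powr p) \<partial>M) \<le> ennreal D" unfolding p'(2) by (elim exE)
  have "(\<integral>x. \<bar>1 + qs n x\<bar> powr p \<partial>M) \<le> max D 0" for n
  proof -
    have i: "integrable M (\<lambda>x. \<bar>1 + qs n x\<bar> powr p)"
      using c by (intro integrable_1_plus p) (simp add: potentials_converge_def)
    have "(\<integral>\<^sup>+ x. ennreal (\<bar>1 + qs n x\<bar> powr p) \<partial>M) \<le> ennreal D" by (rule bspec[OF D0]) blast
    then have "ennreal (\<integral>x. \<bar>1 + qs n x\<bar> powr p \<partial>M) \<le> ennreal (max D 0)"
      using nn_integral_eq_integral[OF i] by (simp add: ennreal_leI order_trans max_def)
    then show ?thesis by simp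
  qed
  then show ?thesis by (intro exI[of _ "max D 0"]) auto
qed

text \<open>With X the difference of the two mass forms, X(y,z) = X(Y,Z) + X(y-Y,z) + X(Y,z-Z). The
  integrability premises exclude default values when the difference of two integrals is estimated by
  one.\<close>

lemma op_M_diff_le:
  assumes p: "2 < p" and r: "r \<in> potentials (ereal p) \<Omega>" and r': "r' \<in> potentials (ereal p) \<Omega>"
    and y: "y \<in> H1 \<Omega>" "z \<in> H1 \<Omega>" and Y: "Y \<in> H1 \<Omega>" "Z \<in> H1 \<Omega>"
    and i1: "integrable M (\<lambda>x. (\<bar>1 + r x\<bar> + \<bar>1 + r' x\<bar>) * (cmod (y x - Y x) * cmod (z x)))"
    and i2: "integrable M (\<lambda>x. (\<bar>1 + r x\<bar> + \<bar>1 + r' x\<bar>) * (cmod (z x - Z x) * cmod (Y x)))"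
  shows "cmod (op_M \<Omega> (\<lambda>x. 1 + r x) y z - op_M \<Omega> (\<lambda>x. 1 + r' x) y z)
    \<le> cmod (op_M \<Omega> (\<lambda>x. 1 + r x) Y Z - op_M \<Omega> (\<lambda>x. 1 + r' x) Y Z)
      + (\<integral>x. (\<bar>1 + r x\<bar> + \<bar>1 + r' x\<bar>) * (cmod (y x - Y x) * cmod (z x)) \<partial>M)
      + (\<integral>x. (\<bar>1 + r x\<bar> + \<bar>1 + r' x\<bar>) * (cmod (z x - Z x) * cmod (Y x)) \<partial>M)"
proof -
  let ?h = "\<lambda>x. \<bar>1 + r x\<bar> + \<bar>1 + r' x\<bar>"
  let ?X = "\<lambda>y z. op_M \<Omega> (\<lambda>x. 1 + r x) y z - op_M \<Omega> (\<lambda>x. 1 + r' x) y z"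
  have p1: "1 < p" using p by simp
  interpret m: hermitian_form "H1 \<Omega>" "op_M \<Omega> (\<lambda>x. 1 + r x)" by (rule op_M_form[OF p weight_1_plus[OF p1 r]])
  interpret m': hermitian_form "H1 \<Omega>" "op_M \<Omega> (\<lambda>x. 1 + r' x)" by (rule op_M_form[OF p weight_1_plus[OF p1 r']])
  have [measurable]: "r \<in> borel_measurable M" "r' \<in> borel_measurable M" using r r' by (auto simp: potentials_iff)
  have le: "cmod (?X a b) \<le> (\<integral>x. ?h x * (cmod (a x) * cmod (b x)) \<partial>M)"
    if a: "a \<in> H1 \<Omega>" and b: "b \<in> H1 \<Omega>" and i: "integrable M (\<lambda>x. ?h x * (cmod (a x) * cmod (b x)))" for a b
  proof -
    have [measurable]: "a \<in> borel_measurable M" "b \<in> borel_measurable M" using a b by (auto intro: L2_measurable H1_L2)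
    have I: "integrable M (\<lambda>x. complex_of_real (1 + s x) * a x * cnj (b x))"
      if [measurable]: "s \<in> borel_measurable M" and s: "\<And>x. \<bar>1 + s x\<bar> \<le> ?h x" for s
    proof (rule Bochner_Integration.integrable_bound[OF i])
      show "AE x in M. norm (complex_of_real (1 + s x) * a x * cnj (b x)) \<le> norm (?h x * (cmod (a x) * cmod (b x)))"
      proof (intro always_eventually allI)
        fix x
        have "\<bar>1 + s x\<bar> * (cmod (a x) * cmod (b x)) \<le> ?h x * (cmod (a x) * cmod (b x))"
          using s by (intro mult_right_mono) auto
        then show "norm (complex_of_real (1 + s x) * a x * cnj (b x)) \<le> norm (?h x * (cmod (a x) * cmod (b x)))"
          by (simp add: norm_mult mult.assoc del: of_real_add)
      qed
    qed measurable
    have I1: "integrable M (\<lambda>x. complex_of_real (1 + r x) * a x * cnj (b x))"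
      "integrable M (\<lambda>x. complex_of_real (1 + r' x) * a x * cnj (b x))" by (intro I; simp)+
    have "?X a b = (\<integral>x. complex_of_real (1 + r x) * a x * cnj (b x) - complex_of_real (1 + r' x) * a x * cnj (b x) \<partial>M)"
      unfolding op_M_def L2_inner_def by (rule Bochner_Integration.integral_diff[symmetric, OF I1])
    also have "cmod \<dots> \<le> (\<integral>x. ?h x * (cmod (a x) * cmod (b x)) \<partial>M)"
    proof (rule Bochner_Integration.integral_norm_bound_integral[OF _ i])
      show "integrable M (\<lambda>x. complex_of_real (1 + r x) * a x * cnj (b x) - complex_of_real (1 + r' x) * a x * cnj (b x))"
        by (intro Bochner_Integration.integrable_diff I1)
      fix x
      have "cmod (complex_of_real (1 + r x) * a x * cnj (b x) - complex_of_real (1 + r' x) * a x * cnj (b x))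
        \<le> cmod (complex_of_real (1 + r x) * a x * cnj (b x)) + cmod (complex_of_real (1 + r' x) * a x * cnj (b x))"
        by (rule norm_triangle_ineq4)
      then show "cmod (complex_of_real (1 + r x) * a x * cnj (b x) - complex_of_real (1 + r' x) * a x * cnj (b x))
        \<le> ?h x * (cmod (a x) * cmod (b x))"
        by (simp add: norm_mult mult.assoc distrib_right del: of_real_add)
    qed
    finally show ?thesis .
  qed
  let ?d = "\<lambda>x. y x - Y x" and ?e = "\<lambda>x. z x - Z x"
  have d: "?d \<in> H1 \<Omega>" "?e \<in> H1 \<Omega>" using y Y m.diff_closed by auto
  have eq: "?X y z = ?X Y Z + (?X ?d z + ?X Y ?e)"
    using y Y d by (simp add: m.diff_left m'.diff_left m.diff_right m'.diff_right)
  have "cmod (?X y z) \<le> cmod (?X Y Z) + (cmod (?X ?d z) + cmod (?X Y ?e))"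
    unfolding eq by (intro order_trans[OF norm_triangle_ineq] add_left_mono norm_triangle_ineq)
  moreover have "cmod (?X ?d z) \<le> (\<integral>x. ?h x * (cmod (y x - Y x) * cmod (z x)) \<partial>M)"
    by (rule le[OF d(1) y(2) i1])
  moreover have "cmod (?X Y ?e) \<le> (\<integral>x. ?h x * (cmod (z x - Z x) * cmod (Y x)) \<partial>M)"
    using le[OF Y(1) d(2)] i2 by (simp add: mult.commute[of "cmod (Y _)"])
  ultimately show ?thesis by linarith
qed

end

context impedance_problem
begin

text \<open>On the unit ball the form is, up to a small error, determined by its value at one of finitely
  many (here: along a subsequence, one) pairs of functions, where weak convergence applies.\<close>

lemma forms_converge_uniformly:
  assumes emb: "H2_compactly_embedded_in_H1 \<Omega>" and reg: "helmholtz_H2_regular \<Omega>"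
    and p: "2 < p" and c: "potentials_converge p qs q" and e: "0 < e"
  shows "\<exists>N. \<forall>n\<ge>N. \<forall>y\<in>H1 \<Omega>. \<forall>z\<in>H1 \<Omega>. H1_norm \<Omega> y \<le> 1 \<longrightarrow> H1_norm \<Omega> z \<le> 1 \<longrightarrow>
    cmod (op_M \<Omega> (\<lambda>x. 1 + qs n x) y z - op_M \<Omega> (\<lambda>x. 1 + q x) y z) \<le> e"
proof (rule ccontr)
  interpret H: hermitian_form "H1 \<Omega>" H1_inner by (rule H1_form)
  let ?X = "\<lambda>n y z. op_M \<Omega> (\<lambda>x. 1 + qs n x) y z - op_M \<Omega> (\<lambda>x. 1 + q x) y z"
  assume "\<not> ?thesis"
  \<comment> \<open>Index and both functions are packed into a triple so that one application of
    choice yields the whole sequence of counterexamples.\<close>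
  then have "\<forall>N. \<exists>t. N \<le> fst t \<and> fst (snd t) \<in> H1 \<Omega> \<and> snd (snd t) \<in> H1 \<Omega> \<and> H1_norm \<Omega> (fst (snd t)) \<le> 1 \<and>
      H1_norm \<Omega> (snd (snd t)) \<le> 1 \<and> e < cmod (?X (fst t) (fst (snd t)) (snd (snd t)))"
    by (simp add: not_le) blast
  then obtain t where t: "\<forall>N. N \<le> fst (t N) \<and> fst (snd (t N)) \<in> H1 \<Omega> \<and> snd (snd (t N)) \<in> H1 \<Omega> \<and> H1_norm \<Omega> (fst (snd (t N))) \<le> 1 \<and>
      H1_norm \<Omega> (snd (snd (t N))) \<le> 1 \<and> e < cmod (?X (fst (t N)) (fst (snd (t N))) (snd (snd (t N))))"
    by (drule_tac choice) (elim exE)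
  define n y z where "n N = fst (t N)" and "y N = fst (snd (t N))" and "z N = snd (snd (t N))" for N
  have n: "N \<le> n N" and y: "y N \<in> H1 \<Omega>" "H1_norm \<Omega> (y N) \<le> 1" and z: "z N \<in> H1 \<Omega>" "H1_norm \<Omega> (z N) \<le> 1"
    and big: "e < cmod (?X (n N) (y N) (z N))" for N
    using spec[OF t, of N] by (auto simp: n_def y_def z_def)
  obtain s1 :: "nat \<Rightarrow> nat" where s1: "strict_mono s1"
    "\<And>e. 0 < e \<Longrightarrow> \<exists>N. \<forall>i\<ge>N. \<forall>j\<ge>N. L2_norm M (\<lambda>x. y (s1 i) x - y (s1 j) x) < e"
    using rellich[OF emb reg, of y 1] y by blast
  \<comment> \<open>The second extraction is made along \<open>s1\<close>; the Cauchy property of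
    the first sequence survives because \<open>i \<le> s2 i\<close>.\<close>
  obtain s2 :: "nat \<Rightarrow> nat" where s2: "strict_mono s2"
    "\<And>e. 0 < e \<Longrightarrow> \<exists>N. \<forall>i\<ge>N. \<forall>j\<ge>N. L2_norm M (\<lambda>x. z (s1 (s2 i)) x - z (s1 (s2 j)) x) < e"
    using rellich[OF emb reg, of "\<lambda>i. z (s1 i)" 1] z by blast
  define s where "s i = s1 (s2 i)" for i
  have s: "strict_mono s" using s1(1) s2(1) by (auto simp: s_def strict_mono_def)
  have p1: "1 < p" using p by simp
  have qp: "qs n \<in> potentials (ereal p) \<Omega>" "q \<in> potentials (ereal p) \<Omega>" for n
    using c by (auto simp: potentials_converge_def)
  have [measurable]: "qs n \<in> borel_measurable M" "q \<in> borel_measurable M" for n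
    using qp by (auto simp: potentials_iff)
  obtain A0 where A0: "0 \<le> A0" "\<And>n. (\<integral>x. \<bar>1 + qs n x\<bar> powr p \<partial>M) \<le> A0"
    using potentials_bounded[OF p1 c] by blast
  define A where "A = A0 + (\<integral>x. \<bar>1 + q x\<bar> powr p \<partial>M)"
  have A: "0 \<le> A" "\<And>n. (\<integral>x. \<bar>1 + qs n x\<bar> powr p \<partial>M) \<le> A" "(\<integral>x. \<bar>1 + q x\<bar> powr p \<partial>M) \<le> A"
    using A0 by (auto simp: A_def intro: add_nonneg_nonneg add_increasing2)
  \<comment> \<open>Each of the two potentials may contribute \<open>e / 8\<close>, hence each of
    the two replaced arguments \<open>e / 4\<close>. More than \<open>e / 2\<close> remains for the
    fixed pair, where weak convergence leaves less than \<open>e / 4\<close>.\<close>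
  have e8: "0 < e / 8" using e by simp
  obtain \<eta> where \<eta>: "0 < \<eta>" and small: "\<And>h y \<phi>. h \<in> borel_measurable M \<Longrightarrow> (\<And>x. 0 \<le> h x) \<Longrightarrow> integrable M (\<lambda>x. h x powr p) \<Longrightarrow>
    (\<integral>x. h x powr p \<partial>M) \<le> A \<Longrightarrow> y \<in> H1 \<Omega> \<Longrightarrow> \<phi> \<in> H1 \<Omega> \<Longrightarrow> H1_norm \<Omega> y \<le> 2 \<Longrightarrow> H1_norm \<Omega> \<phi> \<le> 2 \<Longrightarrow>
    L2_norm M y \<le> \<eta> \<Longrightarrow> integrable M (\<lambda>x. h x * (cmod (y x) * cmod (\<phi> x))) \<and>
    (\<integral>x. h x * (cmod (y x) * cmod (\<phi> x)) \<partial>M) \<le> e / 8"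
    using equi_small[OF p A(1) e8] by (elim exE conjE) blast
  have sm: "integrable M (\<lambda>x. (\<bar>1 + qs m x\<bar> + \<bar>1 + q x\<bar>) * (cmod (a x) * cmod (b x))) \<and>
      (\<integral>x. (\<bar>1 + qs m x\<bar> + \<bar>1 + q x\<bar>) * (cmod (a x) * cmod (b x)) \<partial>M) \<le> e / 4"
    if "a \<in> H1 \<Omega>" "b \<in> H1 \<Omega>" "H1_norm \<Omega> a \<le> 2" "H1_norm \<Omega> b \<le> 2" "L2_norm M a \<le> \<eta>" for m a b
  proof -
    have "integrable M (\<lambda>x. \<bar>1 + qs m x\<bar> * (cmod (a x) * cmod (b x))) \<and> (\<integral>x. \<bar>1 + qs m x\<bar> * (cmod (a x) * cmod (b x)) \<partial>M) \<le> e / 8"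
      by (rule small[OF _ _ integrable_1_plus[OF p1 qp(1)] A(2) that]) auto
    moreover have "integrable M (\<lambda>x. \<bar>1 + q x\<bar> * (cmod (a x) * cmod (b x))) \<and> (\<integral>x. \<bar>1 + q x\<bar> * (cmod (a x) * cmod (b x)) \<partial>M) \<le> e / 8"
      by (rule small[OF _ _ integrable_1_plus[OF p1 qp(2)] A(3) that]) auto
    ultimately show ?thesis by (simp add: distrib_right)
  qed
  obtain N1 where N1: "\<And>i j. i \<ge> N1 \<Longrightarrow> j \<ge> N1 \<Longrightarrow> L2_norm M (\<lambda>x. y (s1 i) x - y (s1 j) x) < \<eta>"
    using s1(2)[OF \<eta>] by blast
  obtain N2 where N2: "\<And>i j. i \<ge> N2 \<Longrightarrow> j \<ge> N2 \<Longrightarrow> L2_norm M (\<lambda>x. z (s i) x - z (s j) x) < \<eta>"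
    using s2(2)[OF \<eta>] unfolding s_def by blast
  \<comment> \<open>The pair at \<open>s J\<close> stays fixed from here on, while the index of the
    potential tends to infinity.\<close>
  define J where "J = max N1 N2"
  let ?Y = "y (s J)" and ?Z = "z (s J)"
  have bound: "e < cmod (?X (n (s i)) ?Y ?Z) + e / 4 + e / 4" if i: "J \<le> i" for i
  proof -
    have "N1 \<le> s2 i" "N1 \<le> s2 J" using i strict_mono_imp_increasing[OF s2(1)] unfolding J_def
      by (meson max.bounded_iff max.cobounded1 order_trans)+
    then have ly: "L2_norm M (\<lambda>x. y (s i) x - ?Y x) \<le> \<eta>" using N1[of "s2 i" "s2 J"] by (simp add: s_def)
    have lz: "L2_norm M (\<lambda>x. z (s i) x - ?Z x) \<le> \<eta>" using N2[of i J] i by (simp add: J_def)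
    have dy: "(\<lambda>x. y (s i) x - ?Y x) \<in> H1 \<Omega>" "H1_norm \<Omega> (\<lambda>x. y (s i) x - ?Y x) \<le> 2"
      using H.diff_closed[OF y(1) y(1)] H.nrm_diff_le[OF y(1) y(1), of "s i" "s J"] y(2)[of "s i"] y(2)[of "s J"]
      by (auto simp: H1_nrm)
    have dz: "(\<lambda>x. z (s i) x - ?Z x) \<in> H1 \<Omega>" "H1_norm \<Omega> (\<lambda>x. z (s i) x - ?Z x) \<le> 2"
      using H.diff_closed[OF z(1) z(1)] H.nrm_diff_le[OF z(1) z(1), of "s i" "s J"] z(2)[of "s i"] z(2)[of "s J"]
      by (auto simp: H1_nrm)
    have y2: "H1_norm \<Omega> ?Y \<le> 2" and z2: "H1_norm \<Omega> (z (s i)) \<le> 2" using y(2)[of "s J"] z(2)[of "s i"] by auto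
    note a = sm[OF dy(1) z(1) dy(2) z2 ly, of "n (s i)"] and b = sm[OF dz(1) y(1) dz(2) y2 lz, of "n (s i)"]
    show ?thesis
      using op_M_diff_le[OF p qp y(1) z(1) y(1) z(1) conjunct1[OF a] conjunct1[OF b]]
        conjunct2[OF a] conjunct2[OF b] big[of "s i"] by linarith
  qed
  \<comment> \<open>By \<open>sobolev_power_bound\<close> at the exponent \<open>p\<close> itself,
    this product lies in the dual space that \<open>potentials_converge\<close> tests with.\<close>
  define w where "w x = ?Y x * cnj (?Z x)" for x
  have [measurable]: "?Y \<in> borel_measurable M" "?Z \<in> borel_measurable M"
    by (rule L2_measurable[OF H1_L2[OF y(1)]], rule L2_measurable[OF H1_L2[OF z(1)]])
  have [measurable]: "w \<in> borel_measurable M" unfolding w_def by measurable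
  have wi: "integrable M (\<lambda>x. cmod (w x) powr (p / (p - 1)))"
  proof (rule Bochner_Integration.integrable_bound)
    let ?s = "p / (p - 1)"
    obtain D where D: "\<And>y. y \<in> H1 \<Omega> \<Longrightarrow> H1_norm \<Omega> y \<le> 1 \<Longrightarrow> integrable M (\<lambda>x. ((cmod (y x))\<^sup>2) powr ?s)"
      using sobolev_power_bound[OF p, of 1] by blast
    show "integrable M (\<lambda>x. ((cmod (?Y x))\<^sup>2) powr ?s + ((cmod (?Z x))\<^sup>2) powr ?s)"
      using D[OF y] D[OF z] by (intro Bochner_Integration.integrable_add)
    have "cmod (w x) powr ?s \<le> ((cmod (?Y x))\<^sup>2) powr ?s + ((cmod (?Z x))\<^sup>2) powr ?s" for x
    proof -
      have "cmod (w x) \<le> max ((cmod (?Y x))\<^sup>2) ((cmod (?Z x))\<^sup>2)"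
        unfolding w_def norm_mult complex_mod_cnj power2_eq_square
        unfolding le_max_iff_disj
        by (cases "cmod (?Y x) \<le> cmod (?Z x)") (auto intro: mult_right_mono mult_left_mono)
      then have "cmod (w x) powr ?s \<le> (max ((cmod (?Y x))\<^sup>2) ((cmod (?Z x))\<^sup>2)) powr ?s"
        using p by (intro powr_mono2) auto
      also have "\<dots> \<le> ((cmod (?Y x))\<^sup>2) powr ?s + ((cmod (?Z x))\<^sup>2) powr ?s" by (auto simp: max_def)
      finally show ?thesis .
    qed
    then show "AE x in M. norm (cmod (w x) powr ?s) \<le> norm (((cmod (?Y x))\<^sup>2) powr ?s + ((cmod (?Z x))\<^sup>2) powr ?s)"
      by (intro always_eventually allI) (simp add: abs_of_nonneg)
  qed measurable
  have "(\<lambda>m. \<integral>x. complex_of_real (qs m x) * w x \<partial>M) \<longlonglongrightarrow> (\<integral>x. complex_of_real (q x) * w x \<partial>M)"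
    using c wi unfolding potentials_converge_def by auto
  then have "\<forall>\<^sub>F m in sequentially. dist (\<integral>x. complex_of_real (qs m x) * w x \<partial>M) (\<integral>x. complex_of_real (q x) * w x \<partial>M) < e / 4"
    using e by (intro tendstoD) auto
  then obtain N3 where N3: "\<And>m. m \<ge> N3 \<Longrightarrow> cmod ((\<integral>x. complex_of_real (qs m x) * w x \<partial>M) - (\<integral>x. complex_of_real (q x) * w x \<partial>M)) < e / 4"
    by (auto simp: eventually_sequentially dist_norm)
  have Xw: "?X m ?Y ?Z = (\<integral>x. complex_of_real (qs m x) * w x \<partial>M) - (\<integral>x. complex_of_real (q x) * w x \<partial>M)" for m
  proof -
    have "integrable M (\<lambda>x. complex_of_real 1 * w x)"
      using wi p integrable_const_M[of "1::real"] by (intro young_integrable(1)[of _ _ _ p]) auto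
    then have w1: "integrable M w" by simp
    have "integrable M (\<lambda>x. complex_of_real (r x) * w x)" if "r \<in> potentials (ereal p) \<Omega>" for r
      using that wi p by (intro young_integrable(1)[of _ _ _ p]) (auto simp: potentials_iff)
    then have i: "integrable M (\<lambda>x. complex_of_real (qs m x) * w x)" "integrable M (\<lambda>x. complex_of_real (q x) * w x)"
      using qp by auto
    have "op_M \<Omega> (\<lambda>x. 1 + r x) ?Y ?Z = (\<integral>x. w x + complex_of_real (r x) * w x \<partial>M)" for r
      unfolding op_M_def L2_inner_def w_def by (simp add: algebra_simps)
    then show ?thesis using w1 i by simp
  qed
  have "N3 \<le> n (s (max J N3))"
    using n[of "s (max J N3)"] strict_mono_imp_increasing[OF s, of "max J N3"] by linarith
  then have "cmod (?X (n (s (max J N3))) ?Y ?Z) < e / 4" unfolding Xw by (rule N3)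
  then show False using bound[of "max J N3"] e by simp
qed

section \<open>Convergence of the solutions\<close>

text \<open>\<open>antidual_norm\<close> is an infimum of reals, so even its nonnegativity requires
  an admissible constant. The sign is wanted because the constant of the inverse may be negative and
  is replaced by its absolute value.\<close>

lemma antidual_norm_le:
  assumes "0 \<le> C" "\<And>\<phi>. \<phi> \<in> H1 \<Omega> \<Longrightarrow> cmod (F \<phi>) \<le> C * H1_norm \<Omega> \<phi>"
  shows "antidual_norm \<Omega> F \<le> C" "0 \<le> antidual_norm \<Omega> F"
proof -
  show "antidual_norm \<Omega> F \<le> C"
    unfolding antidual_norm_def using assms by (intro cInf_lower) (auto intro: bdd_belowI[of _ 0])
  show "0 \<le> antidual_norm \<Omega> F"
    unfolding antidual_norm_def using assms by (intro cInf_greatest) auto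
qed

text \<open>The difference of two solutions solves the limit equation with the source
  \<open>k\<^sup>2 (q\<^sub>n - q) u\<^sub>n\<close>, which is small compared with \<open>u\<^sub>n\<close> by the uniform convergence of the forms.\<close>

theorem solutions_converge:
  assumes emb: "H2_compactly_embedded_in_H1 \<Omega>" and reg: "helmholtz_H2_regular \<Omega>"
    and p: "2 < p" and c: "potentials_converge p qs q"
    and wp: "helmholtz_bijective_bounded_inverse \<Omega> k q"
    and us: "\<And>n. helmholtz_solution \<Omega> k (qs n) f (us n)" and u: "helmholtz_solution \<Omega> k q f u"
  shows "(\<lambda>n. H1_norm \<Omega> (\<lambda>x. us n x - u x)) \<longlonglongrightarrow> 0"
proof -
  interpret H: complete_hermitian_form "H1 \<Omega>" H1_inner by (rule H1_complete_form)
  let ?N = "H1_norm \<Omega>"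
  let ?X = "\<lambda>n y z. op_M \<Omega> (\<lambda>x. 1 + qs n x) y z - op_M \<Omega> (\<lambda>x. 1 + q x) y z"
  have p1: "1 < p" using p by simp
  have qp: "qs n \<in> potentials (ereal p) \<Omega>" "q \<in> potentials (ereal p) \<Omega>" for n
    using c by (auto simp: potentials_converge_def)
  note wq = weight_1_plus[OF p1 qp(2)] and wn = weight_1_plus[OF p1 qp(1)]
  \<comment> \<open>Elements of norm zero cannot be scaled to the unit sphere; boundedness of the
    mass form handles them.\<close>
  have zero: "op_M \<Omega> m y z = 0" if m: "weight p m" and yz: "y \<in> H1 \<Omega>" "z \<in> H1 \<Omega>" "?N y = 0 \<or> ?N z = 0" for m y z
  proof -
    obtain C where C: "0 \<le> C" "\<And>y. y \<in> H1 \<Omega> \<Longrightarrow> (\<integral>x. m x * (cmod (y x))\<^sup>2 \<partial>M) \<le> C * (?N y)\<^sup>2"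
      using weight_bounded[OF p m] by blast
    have "cmod (op_M \<Omega> m y z) \<le> C * ?N y * ?N z"
      using H.bounded_form_le[OF op_M_form[OF p m] C(1) _ yz(1,2)] C(2) by (simp add: H1_nrm op_M_self)
    then show ?thesis using yz(3) by auto
  qed
  have Xle: "cmod (?X n y z) \<le> e * ?N y * ?N z"
    if b: "\<And>y z. y \<in> H1 \<Omega> \<Longrightarrow> z \<in> H1 \<Omega> \<Longrightarrow> ?N y \<le> 1 \<Longrightarrow> ?N z \<le> 1 \<Longrightarrow> cmod (?X n y z) \<le> e"
      and y: "y \<in> H1 \<Omega>" and z: "z \<in> H1 \<Omega>" for n e y z
  proof (cases "?N y = 0 \<or> ?N z = 0")
    case True
    then show ?thesis using zero[OF wn y z] zero[OF wq y z] by auto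
  next
    case False
    then have pos: "0 < ?N y" "0 < ?N z" using H1_norm_nonneg[of y] H1_norm_nonneg[of z] by auto
    interpret m: hermitian_form "H1 \<Omega>" "op_M \<Omega> (\<lambda>x. 1 + qs n x)" by (rule op_M_form[OF p wn])
    interpret m': hermitian_form "H1 \<Omega>" "op_M \<Omega> (\<lambda>x. 1 + q x)" by (rule op_M_form[OF p wq])
    let ?a = "complex_of_real (1 / ?N y)" and ?b = "complex_of_real (1 / ?N z)"
    let ?y = "\<lambda>x. ?a * y x" and ?z = "\<lambda>x. ?b * z x"
    have yz: "?y \<in> H1 \<Omega>" "?z \<in> H1 \<Omega>" by (rule H1_scale[OF y], rule H1_scale[OF z])
    have nab: "cmod ?a = 1 / ?N y" "cmod ?b = 1 / ?N z" using pos by (simp_all add: norm_divide)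
    have nn: "?N ?y \<le> 1" "?N ?z \<le> 1"
      using H.nrm_scale[OF y, of ?a] H.nrm_scale[OF z, of ?b] pos unfolding H1_nrm nab by simp_all
    have "?X n ?y ?z = ?a * cnj ?b * ?X n y z"
      unfolding m.scale_left[OF y yz(2)] m'.scale_left[OF y yz(2)] m.scale_right[OF z y] m'.scale_right[OF z y]
      by (simp add: algebra_simps)
    then have "cmod (?X n ?y ?z) = (1 / ?N y) * (1 / ?N z) * cmod (?X n y z)"
      by (simp only: norm_mult complex_mod_cnj nab)
    then have "(1 / ?N y) * (1 / ?N z) * cmod (?X n y z) \<le> e" using b[OF yz nn] by simp
    then show ?thesis using pos by (simp add: field_simps)
  qed
  obtain C0 where C0: "\<And>y. y \<in> H1 \<Omega> \<Longrightarrow> ?N y \<le> C0 * antidual_norm \<Omega> (helmholtz_op \<Omega> k q y)"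
    using wp unfolding helmholtz_bijective_bounded_inverse_def by blast
  have usH: "us n \<in> H1 \<Omega>" and uH: "u \<in> H1 \<Omega>" for n using us u by (auto simp: helmholtz_solution_def)
  have est: "?N (\<lambda>x. us n x - u x) \<le> \<bar>C0\<bar> * k\<^sup>2 * e * ?N (us n)"
    if e: "0 \<le> e" and b: "\<And>y z. y \<in> H1 \<Omega> \<Longrightarrow> z \<in> H1 \<Omega> \<Longrightarrow> ?N y \<le> 1 \<Longrightarrow> ?N z \<le> 1 \<Longrightarrow> cmod (?X n y z) \<le> e" for n e
  proof -
    let ?d = "\<lambda>x. us n x - u x"
    have d: "?d \<in> H1 \<Omega>" using usH uH by (rule H.diff_closed)
    have "cmod (helmholtz_op \<Omega> k q ?d \<phi>) \<le> (k\<^sup>2 * e * ?N (us n)) * ?N \<phi>" if \<phi>: "\<phi> \<in> H1 \<Omega>" for \<phi>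
    proof -
      \<comment> \<open>The term of \<open>u\<close> equals \<open>f \<phi>\<close>, which is also
        the operator for \<open>qs n\<close> at \<open>us n\<close>. Gradient and boundary parts
        then cancel.\<close>
      have "helmholtz_op \<Omega> k q ?d \<phi> = helmholtz_op \<Omega> k q (us n) \<phi> - helmholtz_op \<Omega> k (qs n) (us n) \<phi>"
        using helmholtz_op_diff[OF p wq usH uH \<phi>] us[of n] u \<phi> by (simp add: helmholtz_solution_def)
      also have "\<dots> = complex_of_real (k\<^sup>2) * ?X n (us n) \<phi>"
        by (simp add: helmholtz_op_def algebra_simps)
      finally have "cmod (helmholtz_op \<Omega> k q ?d \<phi>) = k\<^sup>2 * cmod (?X n (us n) \<phi>)"
        by (simp only: norm_mult norm_of_real) simp
      also have "\<dots> \<le> k\<^sup>2 * (e * ?N (us n) * ?N \<phi>)" by (intro mult_left_mono Xle[OF b usH \<phi>]) auto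
      finally show ?thesis by (simp add: mult.assoc)
    qed
    then have a: "antidual_norm \<Omega> (helmholtz_op \<Omega> k q ?d) \<le> k\<^sup>2 * e * ?N (us n)"
      "0 \<le> antidual_norm \<Omega> (helmholtz_op \<Omega> k q ?d)"
      using e H1_norm_nonneg by (auto intro!: antidual_norm_le[of "k\<^sup>2 * e * ?N (us n)"])
    have "?N ?d \<le> C0 * antidual_norm \<Omega> (helmholtz_op \<Omega> k q ?d)" by (rule C0[OF d])
    also have "\<dots> \<le> \<bar>C0\<bar> * antidual_norm \<Omega> (helmholtz_op \<Omega> k q ?d)" using a(2) by (intro mult_right_mono) auto
    also have "\<dots> \<le> \<bar>C0\<bar> * (k\<^sup>2 * e * ?N (us n))" using a(1) by (intro mult_left_mono) auto
    finally show ?thesis by (simp add: mult.assoc)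
  qed
  define K where "K = \<bar>C0\<bar> * k\<^sup>2 + 1"
  have K: "0 < K" "\<bar>C0\<bar> * k\<^sup>2 \<le> K" by (auto simp: K_def add_nonneg_pos)
  show ?thesis
  proof (rule LIMSEQ_I)
    fix r :: real assume r: "0 < r"
    \<comment> \<open>\<open>K * e \<le> 1 / 2\<close> lets half of the error be absorbed, and the
      second bound leaves at most \<open>r / (2 * (?N u + 1)) * ?N u\<close>, which is below
      \<open>r\<close>.\<close>
    define e where "e = min (1 / 2) (r / (4 * (?N u + 1))) / K"
    have Ke: "K * e = min (1 / 2) (r / (4 * (?N u + 1)))" using K by (simp add: e_def)
    have e: "0 < e" using K r H1_norm_nonneg[of u] by (simp add: e_def add_nonneg_pos)
    have Ke': "K * e \<le> 1 / 2" "K * e \<le> r / (4 * (?N u + 1))"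
      unfolding Ke by (rule min.cobounded1, rule min.cobounded2)
    obtain N where N: "\<And>n y z. n \<ge> N \<Longrightarrow> y \<in> H1 \<Omega> \<Longrightarrow> z \<in> H1 \<Omega> \<Longrightarrow> ?N y \<le> 1 \<Longrightarrow> ?N z \<le> 1 \<Longrightarrow> cmod (?X n y z) \<le> e"
      using forms_converge_uniformly[OF emb reg p c e] by blast
    have "norm (?N (\<lambda>x. us n x - u x) - 0) < r" if n: "n \<ge> N" for n
    proof -
      let ?D = "?N (\<lambda>x. us n x - u x)"
      have "?D \<le> \<bar>C0\<bar> * k\<^sup>2 * e * ?N (us n)" by (rule est[OF less_imp_le[OF e] N[OF n]])
      also have "\<dots> \<le> K * e * (?D + ?N u)"
        using H.nrm_le_add[OF usH uH, of n] K e H1_norm_nonneg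
        by (intro mult_mono) (auto simp: H1_nrm)
      also have "\<dots> \<le> 1 / 2 * ?D + r / (4 * (?N u + 1)) * ?N u"
        unfolding distrib_left[of "K * e"] using Ke' H1_norm_nonneg by (intro add_mono mult_right_mono)
      finally have "?D \<le> r / (2 * (?N u + 1)) * ?N u" using H1_norm_nonneg[of u] by (simp add: field_simps)
      also have "\<dots> < r"
      proof -
        have "r * ?N u < r * (2 * (?N u + 1))" using r H1_norm_nonneg[of u] by (intro mult_strict_left_mono) auto
        then show ?thesis using H1_norm_nonneg[of u] by (simp add: pos_divide_less_eq)
      qed
      finally show ?thesis using H1_norm_nonneg by simp
    qed
    then show "\<exists>no. \<forall>n\<ge>no. norm (?N (\<lambda>x. us n x - u x) - 0) < r" by blast
  qed
qed

end

section \<open>Both modes of convergence as convergence of pairings\<close>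

text \<open>Weak convergence is stated with abstract functionals; this supplies the concrete ones,
  integration against functions of the dual exponent.\<close>

lemma Lp_dual_mult:
  assumes p: "1 < p" and w: "w \<in> borel_measurable N" "integrable N (\<lambda>x. cmod (w x) powr (p / (p - 1)))"
  shows "(\<lambda>g. \<integral>x. g x * w x \<partial>N) \<in> Lp_dual (ereal p) N"
proof -
  have mem: "g \<in> borel_measurable N" "integrable N (\<lambda>x. cmod (g x) powr p)" if "g \<in> Lp (ereal p) N" for g
    using that by (auto simp: Lp_def)
  have i: "integrable N (\<lambda>x. g x * w x)" if "g \<in> Lp (ereal p) N" for g
    by (rule young_integrable(1)[OF mem(1)[OF that] w(1) p mem(2)[OF that] w(2)])
  define C where "C = 1 + (\<integral>x. cmod (w x) powr (p / (p - 1)) \<partial>N)"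
  have "cmod (\<integral>x. g x * w x \<partial>N) \<le> C * Lp_norm (ereal p) N g" if g: "g \<in> Lp (ereal p) N" for g
  proof -
    note [measurable] = mem(1)[OF g] w(1)
    let ?I = "\<integral>x. cmod (g x) powr p \<partial>N"
    define R where "R = ?I powr (1 / p)"
    have norm: "Lp_norm (ereal p) N g = R" by (simp add: Lp_norm_def R_def)
    have I0: "0 \<le> ?I" by simp
    show ?thesis
    proof (cases "?I = 0")
      case True
      then have "AE x in N. cmod (g x) powr p = 0"
        using integral_nonneg_eq_0_iff_AE[OF mem(2)[OF g]] by simp
      then have "AE x in N. g x * w x = 0" by eventually_elim simp
      then have "(\<integral>x. g x * w x \<partial>N) = (\<integral>x. 0 \<partial>N)" by (intro integral_cong_AE) auto
      then show ?thesis by (simp add: norm R_def True)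
    next
      case False
      then have R: "0 < R" "R powr p = ?I" using I0 p by (simp_all add: R_def powr_powr)
      \<comment> \<open>After normalisation the additive Young bound becomes the constant
        \<open>C\<close>, and homogeneity restores the factor \<open>R\<close>. The case of norm
        zero had to be split off for this.\<close>
      let ?g = "\<lambda>x. complex_of_real (1 / R) * g x"
      have e: "cmod (?g x) powr p = (1 / ?I) * cmod (g x) powr p" for x
        using R I0 by (simp add: norm_mult norm_divide powr_divide R(2)[symmetric])
      have "cmod (\<integral>x. ?g x * w x \<partial>N) \<le> (\<integral>x. cmod (?g x) powr p \<partial>N) + (\<integral>x. cmod (w x) powr (p / (p - 1)) \<partial>N)"
      proof (rule young_integrable(2)[OF _ w(1) p _ w(2)])
        show "integrable N (\<lambda>x. cmod (?g x) powr p)" unfolding e using mem(2)[OF g] by simp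
      qed measurable
      also have "(\<integral>x. cmod (?g x) powr p \<partial>N) = 1" unfolding e using False by simp
      also have "(\<integral>x. ?g x * w x \<partial>N) = complex_of_real (1 / R) * (\<integral>x. g x * w x \<partial>N)" by (simp add: mult.assoc)
      finally have "(1 / R) * cmod (\<integral>x. g x * w x \<partial>N) \<le> C"
        using R(1) unfolding C_def by (simp add: norm_mult norm_divide)
      then show ?thesis using R(1) by (simp add: norm field_simps)
    qed
  qed
  then show ?thesis using i by (auto simp: Lp_dual_def distrib_right mult.assoc)
qed

context impedance_problem
begin

lemma potentials_converge_if_weakly:
  assumes p: "1 < p" and r: "\<And>n. qs n \<in> potentials (ereal p) \<Omega>" "q \<in> potentials (ereal p) \<Omega>"
    and w: "weakly_converges (ereal p) M (\<lambda>n x. complex_of_real (qs n x)) (\<lambda>x. complex_of_real (q x))"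
  shows "potentials_converge p qs q"
  unfolding potentials_converge_def
proof (intro conjI allI impI r)
  fix v assume "v \<in> borel_measurable M" "integrable M (\<lambda>x. cmod (v x) powr (p / (p - 1)))"
  then have "(\<lambda>g. \<integral>x. g x * v x \<partial>M) \<in> Lp_dual (ereal p) M" by (rule Lp_dual_mult[OF p])
  from bspec[OF conjunct2[OF conjunct2[OF w[unfolded weakly_converges_def]]] this]
  show "(\<lambda>n. \<integral>x. complex_of_real (qs n x) * v x \<partial>M) \<longlonglongrightarrow> (\<integral>x. complex_of_real (q x) * v x \<partial>M)" .
qed

lemma potentials_infinity_subset:
  assumes r: "r \<in> potentials \<infinity> \<Omega>"
  shows "r \<in> potentials (ereal 3) \<Omega>"
proof -
  have [measurable]: "(\<lambda>x. complex_of_real (r x)) \<in> borel_measurable M" using r by (simp add: potentials_def Lp_def)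
  obtain C where C: "AE x in M. cmod (complex_of_real (r x)) \<le> C" using r by (auto simp: potentials_def Lp_def)
  have "integrable M (\<lambda>x. cmod (complex_of_real (r x)) powr 3)"
  proof (rule Bochner_Integration.integrable_bound)
    show "integrable M (\<lambda>x. C powr 3)" by (rule integrable_const_M)
    show "AE x in M. norm (cmod (complex_of_real (r x)) powr 3) \<le> norm (C powr 3)"
      using C by eventually_elim (simp add: powr_mono2)
  qed measurable
  then show ?thesis using r by (simp add: potentials_def Lp_def)
qed

text \<open>On a bounded domain, bounded potentials lie in L^3 and the test class with exponent 3/2
  lies in L^1, so weak-* convergence reduces to a finite exponent above 2.\<close>

lemma potentials_converge_if_weak_star:
  assumes r: "\<And>n. qs n \<in> potentials \<infinity> \<Omega>" "q \<in> potentials \<infinity> \<Omega>"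
    and w: "weak_star_converges M (\<lambda>n x. complex_of_real (qs n x)) (\<lambda>x. complex_of_real (q x))"
  shows "potentials_converge 3 qs q"
  unfolding potentials_converge_def
proof (intro conjI allI impI potentials_infinity_subset r)
  fix v assume v: "v \<in> borel_measurable M" "integrable M (\<lambda>x. cmod (v x) powr (3 / (3 - 1)))"
  have "integrable M (\<lambda>x. complex_of_real 1 * v x)"
    using v integrable_const_M[of "1::real"] by (intro young_integrable(1)[of _ _ _ 3]) auto
  then have "v \<in> Lp 1 M" using v(1) by (simp add: Lp_def one_ereal_def)
  then show "(\<lambda>n. \<integral>x. complex_of_real (qs n x) * v x \<partial>M) \<longlonglongrightarrow> (\<integral>x. complex_of_real (q x) * v x \<partial>M)"
    using w unfolding weak_star_converges_def by blast
qed

end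

theorem theorem3p9:
  fixes \<Omega> :: "(real^2) set" and k :: real and f :: "(real^2 \<Rightarrow> complex) \<Rightarrow> complex"
    and p :: ereal and qs :: "nat \<Rightarrow> real^2 \<Rightarrow> real" and q :: "real^2 \<Rightarrow> real"
    and u :: "(real^2 \<Rightarrow> real) \<Rightarrow> real^2 \<Rightarrow> complex"
  assumes domain: "sufficiently_smooth_domain \<Omega>"
    and k: "k > 0"
    and f: "f \<in> antidual \<Omega>"
    and well_posed: "\<And>p' r. 2 < p' \<Longrightarrow> r \<in> potentials p' \<Omega> \<Longrightarrow>
                       helmholtz_bijective_bounded_inverse \<Omega> k r"
    and p: "2 < p"
    and qs: "\<And>n. qs n \<in> potentials p \<Omega>"
    and q: "q \<in> potentials p \<Omega>"
    and weak: "p < \<infinity> \<Longrightarrow> weakly_converges p (lebesgue_on \<Omega>)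
                 (\<lambda>n x. complex_of_real (qs n x)) (\<lambda>x. complex_of_real (q x))"
    and weak_star: "p = \<infinity> \<Longrightarrow> weak_star_converges (lebesgue_on \<Omega>)
                 (\<lambda>n x. complex_of_real (qs n x)) (\<lambda>x. complex_of_real (q x))"
    and u: "\<And>r. r \<in> potentials p \<Omega> \<Longrightarrow> helmholtz_solution \<Omega> k r f (u r)"
  shows "(\<lambda>n. H1_norm \<Omega> (\<lambda>x. u (qs n) x - u q x)) \<longlonglongrightarrow> 0"
proof -
  have dom: "open \<Omega>" "bounded \<Omega>" and emb: "H2_compactly_embedded_in_H1 \<Omega>" and reg: "helmholtz_H2_regular \<Omega>"
    using domain by (auto simp: sufficiently_smooth_domain_def bounded_C1_domain_def)
  interpret impedance_problem \<Omega> k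
    using dom k well_posed by unfold_locales (auto simp: helmholtz_bijective_bounded_inverse_def)
  have "\<exists>s>2. potentials_converge s qs q"
  proof (cases p)
    case (real s)
    then have s: "2 < s" using p by (simp add: numeral_eq_ereal)
    then have "potentials_converge s qs q"
      using qs q weak unfolding real by (intro potentials_converge_if_weakly) auto
    then show ?thesis using s by blast
  next
    case PInf
    then show ?thesis using qs q weak_star by (intro exI[of _ 3]) (auto intro: potentials_converge_if_weak_star)
  qed (use p in simp)
  then obtain s where "2 < s" "potentials_converge s qs q" by blast
  then show ?thesis
    by (intro solutions_converge[OF emb reg _ _ well_posed[OF p q] u[OF qs] u[OF q]])
qed

end
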